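(* Let $d\in\mathbb{N}$, $\sigma\in(0,1]$ with $\sigma<d/2$ if $d\in\{1,2\}$, and $\alpha_0=\frac{d/2+\sigma}{2}$. Then $w_{\sigma,\alpha}=\kappa_{\sigma-\alpha}/\kappa_{-\alpha}$ is a Hardy weight for $\Delta^\sigma$ on $\mathbb{Z}^d$ for every $\alpha\in(\sigma,d/2)$, and (a) for $\sigma<\alpha<\alpha_0$, $w_{\sigma,\alpha}$ is positive critical; (b) for $\alpha=\alpha_0$, $w_{\sigma,\alpha}$ is null-critical; (c) for $\alpha_0<\alpha<d/2$, $w_{\sigma,\alpha}$ is subcritical.
   Context: For $f:\mathbb{Z}^d\to\mathbb{R}$ let $\Delta f(x)=\sum_{y:|y-x|=1}(f(x)-f(y))$ ($|\cdot|$ Euclidean norm), with heat semigroup $e^{-t\Delta}$ on $\ell^2(\mathbb{Z}^d)$; $1_0$ is the indicator of $\{0\}$. For $\sigma\in(0,1)$, $\Delta^\sigma$ is defined on $\ell^2$ by the spectral theorem, $\Delta^1=\Delta$. For $\beta\in(-d/2,1]$ the Riesz kernel $\kappa_\beta:\mathbb{Z}^d\to[0,\infty)$ is given by $\kappa_0=1_0$, $\kappa_1(x)=1_{\{|x|=1\}}$, $\kappa_\beta(0)=0$ if $\beta\in(0,1)$, and otherwise $\kappa_\beta(x)=\frac{1}{|\Gamma(-\beta)|}\int_0^\infty e^{-t\Delta}1_0(x)\,\frac{dt}{t^{1+\beta}}$. Let $Q^\sigma(f)=\frac12\sum_{x,y}\kappa_\sigma(x-y)(f(x)-f(y))^2$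 (equal to $\langle\Delta^\sigma\varphi,\varphi\rangle$ for finitely supported $\varphi$), and let $\mathcal{D}_0^\sigma$ be the closure of finitely supported functions $C_c(\mathbb{Z}^d)$ under $\|\varphi\|=\sqrt{Q^\sigma(\varphi)+|\varphi(0)|^2}$. A function $w:\mathbb{Z}^d\to[0,\infty)$ is a Hardy weight if $Q^\sigma(\varphi)\ge\sum_xw(x)\varphi(x)^2$ for all $\varphi\in C_c(\mathbb{Z}^d)$ (then also for all $\varphi\in\mathcal{D}_0^\sigma$). A Hardy weight $w$ is subcritical if there is a Hardy weight $w'\ge w$ with $w'\ne w$, and critical otherwise. A critical Hardy weight $w$ is positive critical if there is a nonzero $v\in\mathcal{D}_0^\sigma$ with $Q^\sigma(v)=\sum_xw(x)v(x)^2$, and null-critical otherwise. *)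

theory Defs
  imports "HOL-Analysis.Analysis"
begin

definition lnorm :: "int ^ 'd \<Rightarrow> real" where
  "lnorm x = sqrt (\<Sum>i\<in>UNIV. (real_of_int (x $ i))^2)"

text \<open>Number of nearest-neighbour walks of length n from 0 to x, i.e. (A^n 1_0)(x),
  A the adjacency operator of Z^d.\<close>
fun walks :: "nat \<Rightarrow> int ^ 'd \<Rightarrow> real" where
  "walks 0 x = (if x = 0 then 1 else 0)"
| "walks (Suc n) x = (\<Sum>y\<in>{y. lnorm (y - x) = 1}. walks n y)"

text \<open>Heat kernel e^{-t Delta} 1_0 (x); since Delta = 2d I - A is bounded,
  e^{-t Delta} = e^{-2dt} e^{tA} with e^{tA} given by its exponential series.\<close>
definition heat :: "real \<Rightarrow> int ^ 'd \<Rightarrow> real" where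
  "heat t x = (\<Sum>n. exp (- 2 * real CARD('d) * t) * t ^ n / fact n * walks n x)"

definition kappa :: "real \<Rightarrow> int ^ 'd \<Rightarrow> real" where
  "kappa \<beta> x =
    (if \<beta> = 0 then (if x = 0 then 1 else 0)
     else if \<beta> = 1 then (if lnorm x = 1 then 1 else 0)
     else if 0 < \<beta> \<and> \<beta> < 1 \<and> x = 0 then 0
     else (1 / \<bar>Gamma (- \<beta>)\<bar>) *
          (\<integral>t\<in>{0<..}. heat t x / t powr (1 + \<beta>) \<partial>lborel))"

definition Qform :: "real \<Rightarrow> (int ^ 'd \<Rightarrow> real) \<Rightarrow> ennreal" where
  "Qform \<sigma> f = (\<Sum>\<^sub>\<infinity>(x, y)\<in>UNIV. ennreal (kappa \<sigma> (x - y) * (f x - f y)^2)) / 2"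

definition fin_supp :: "(int ^ 'd \<Rightarrow> real) \<Rightarrow> bool" where
  "fin_supp \<phi> \<longleftrightarrow> finite {x. \<phi> x \<noteq> 0}"

text \<open>D_0^sigma, the closure of C_c under sqrt(Q^sigma(phi) + |phi(0)|^2), realised as a
  space of functions (elements of the completion identified with pointwise limits).\<close>
definition D0 :: "real \<Rightarrow> (int ^ 'd \<Rightarrow> real) set" where
  "D0 \<sigma> = {f. \<exists>\<phi>. (\<forall>n. fin_supp (\<phi> n)) \<and>
                 (\<lambda>n. Qform \<sigma> (\<lambda>x. \<phi> n x - f x)) \<longlonglongrightarrow> 0 \<and>
                 (\<lambda>n. \<phi> n 0) \<longlonglongrightarrow> f 0}"

definition wsum :: "(int ^ 'd \<Rightarrow> real) \<Rightarrow> (int ^ 'd \<Rightarrow> real) \<Rightarrow> ennreal" where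
  "wsum w \<phi> = (\<Sum>\<^sub>\<infinity>x\<in>UNIV. ennreal (w x * (\<phi> x)^2))"

definition hardy_weight :: "real \<Rightarrow> (int ^ 'd \<Rightarrow> real) \<Rightarrow> bool" where
  "hardy_weight \<sigma> w \<longleftrightarrow> (\<forall>x. 0 \<le> w x) \<and>
     (\<forall>\<phi>. fin_supp \<phi> \<longrightarrow> wsum w \<phi> \<le> Qform \<sigma> \<phi>)"

definition subcritical :: "real \<Rightarrow> (int ^ 'd \<Rightarrow> real) \<Rightarrow> bool" where
  "subcritical \<sigma> w \<longleftrightarrow> hardy_weight \<sigma> w \<and>
     (\<exists>w'. hardy_weight \<sigma> w' \<and> (\<forall>x. w x \<le> w' x) \<and> w' \<noteq> w)"

definition critical :: "real \<Rightarrow> (int ^ 'd \<Rightarrow> real) \<Rightarrow> bool" where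
  "critical \<sigma> w \<longleftrightarrow> hardy_weight \<sigma> w \<and> \<not> subcritical \<sigma> w"

definition positive_critical :: "real \<Rightarrow> (int ^ 'd \<Rightarrow> real) \<Rightarrow> bool" where
  "positive_critical \<sigma> w \<longleftrightarrow> critical \<sigma> w \<and>
     (\<exists>v\<in>D0 \<sigma>. v \<noteq> (\<lambda>_. 0) \<and> Qform \<sigma> v = wsum w v)"

definition null_critical :: "real \<Rightarrow> (int ^ 'd \<Rightarrow> real) \<Rightarrow> bool" where
  "null_critical \<sigma> w \<longleftrightarrow> critical \<sigma> w \<and> \<not> positive_critical \<sigma> w"

definition hardy_w :: "real \<Rightarrow> real \<Rightarrow> int ^ 'd \<Rightarrow> real" where
  "hardy_w \<sigma> \<alpha> x = kappa (\<sigma> - \<alpha>) x / kappa (- \<alpha>) x"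

end

theory Submission
  imports Defs "HOL-Probability.Probability" "HOL-Real_Asymp.Real_Asymp"
begin

text \<open>
  Write \<open>u = \<kappa>\<^bsub>-\<alpha>\<^esub>\<close> and \<open>\<rho> = \<kappa>\<^bsub>\<sigma>-\<alpha>\<^esub>\<close>, two time integrals of the heat kernel \<open>p\<^sub>t\<close>. The semigroup law
  and a Beta integral give \<open>\<Delta>\<^sup>\<sigma> u = \<rho>\<close>, so \<open>w = \<rho> / u\<close> and the ground state representation
  \<open>Q(\<phi>) = \<Sum> w \<phi>\<^sup>2 + E(\<phi> / u)\<close> makes \<open>w\<close> a Hardy weight.

  Truncating \<open>u\<close> to times below \<open>T\<close> gives test functions \<open>v\<close> with \<open>\<Delta>\<^sup>\<sigma> v\<close> at most the truncation of \<open>\<rho>\<close>.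
  The bound \<open>p\<^sub>t \<le> C t\<^bsup>-d/2\<^esup>\<close> then yields \<open>Q(v) - \<Sum> w v\<^sup>2 \<le> C T\<^bsup>2\<alpha>-\<sigma>-d/2\<^esup>\<close>, which tends to \<open>0\<close> for
  \<open>\<alpha> < \<alpha>\<^sub>0\<close> and stays bounded for \<open>\<alpha> = \<alpha>\<^sub>0\<close>; averaging upgrades boundedness to a null sequence, so \<open>w\<close>
  is critical in both cases. The ground state \<open>u\<close> has \<open>\<Sum> w u\<^sup>2 = \<Sum> \<rho> u < \<infinity>\<close> precisely when \<open>\<alpha> < \<alpha>\<^sub>0\<close>,
  and a minimiser in the form domain must be a multiple of \<open>u\<close>.

  For \<open>\<alpha> > \<alpha>\<^sub>0\<close> the local central limit theorem gives \<open>w\<^bsub>\<sigma>,\<alpha>\<^esub> \<sim> c(\<alpha>) |x|\<^bsup>-2\<sigma>\<^esup>\<close> with \<open>c(\<alpha>) < c(\<alpha>\<^sub>0)\<close>.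
  Hence \<open>\<kappa>\<^bsub>-\<alpha>\<^sub>0\<^esub>\<close> is a supersolution for \<open>w\<^bsub>\<sigma>,\<alpha>\<^esub>\<close> off a finite set that is small against \<open>u\<close> at infinity, and a
  positive supersolution not proportional to \<open>u\<close> makes the weight subcritical.
\<close>

section \<open>Energy forms\<close>

text \<open>The form is an infinite double sum, and neither u nor its truncations in time have
  finite support. Identities for the Hardy deficit are therefore proved for finitely supported
  functions, where the deficit is a finite sum, and reach the form domain by Fatou; an equality then
  becomes an inequality, in the direction that is needed. The truncated potentials are cut off once
  more, to finite sets, at the price of the mass left outside.

  Truncation in time suits the semigroup: applying e^{-s\<Delta>} shifts time by s, and discarding
  what passes T has a favourable sign. The exponent 2\<alpha>-\<sigma>-d/2 pairs the total mass of
  early times, a power of T, with a uniform bound for late times; \<open>\<alpha>\<^sub>0\<close> is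
  its zero.

  The same \<open>\<alpha>\<^sub>0\<close> governs c(\<alpha>), a quotient of Gamma values that is
  even in the distance of \<alpha> from \<open>\<alpha>\<^sub>0\<close> and largest at distance 0.
  The local limit theorem does not control times that are short compared with |x|^2; an off-diagonal
  bound of order |x|^{-d}, obtained by exponential tilting, dominates them.\<close>

lemma infsum_eq_nn_integral_count_space:
  fixes f :: "'a::countable \<Rightarrow> ennreal"
  shows "infsum f UNIV = (\<integral>\<^sup>+x. f x \<partial>count_space UNIV)"
proof (rule antisym)
  have fin: "sum f F = (\<integral>\<^sup>+x. f x * indicator F x \<partial>count_space UNIV)" if "finite F" for F
    using that by (subst nn_integral_count_space'[where A = F]) (auto simp: indicator_def)
  show "infsum f UNIV \<le> (\<integral>\<^sup>+x. f x \<partial>count_space UNIV)"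
    by (subst nonneg_infsum_complete)
       (auto intro!: SUP_least nn_integral_mono simp: fin indicator_def)
  \<comment> \<open>Countability gives an increasing exhaustion by finite sets, to which monotone
    convergence applies.\<close>
  define F where "F n = {x::'a. to_nat x < n}" for n
  have finF: "finite (F n)" for n
    unfolding F_def by (rule finite_imageD[where f = to_nat]) (auto intro: finite_subset[of _ "{..<n}"])
  have "(\<integral>\<^sup>+x. f x \<partial>count_space UNIV) = (\<integral>\<^sup>+x. (SUP n. f x * indicator (F n) x) \<partial>count_space UNIV)"
  proof (rule nn_integral_cong)
    fix x
    have "f x * indicator (F n) x \<le> f x" for n by (auto simp: indicator_def)
    moreover have "f x * indicator (F (Suc (to_nat x))) x = f x" by (simp add: F_def)
    ultimately show "f x = (SUP n. f x * indicator (F n) x)"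
      by (intro antisym SUP_least SUP_upper2[of "Suc (to_nat x)"]) auto
  qed
  also have "\<dots> = (SUP n. (\<integral>\<^sup>+x. f x * indicator (F n) x \<partial>count_space UNIV))"
    by (rule nn_integral_monotone_convergence_SUP)
       (auto simp: incseq_def le_fun_def F_def indicator_def)
  also have "\<dots> = (SUP n. sum f (F n))"
    by (simp add: fin[OF finF])
  also have "\<dots> \<le> infsum f UNIV"
    by (subst nonneg_infsum_complete) (auto intro!: SUP_mono finF)
  finally show "(\<integral>\<^sup>+x. f x \<partial>count_space UNIV) \<le> infsum f UNIV" .
qed

text \<open>With its converse below, this carries nonnegative sums to extended real integrals and
  back, so that lattice sums can be exchanged with series and time integrals by Tonelli.\<close>

lemma has_sum_imp_nn_integral:
  fixes f :: "'a::countable \<Rightarrow> real"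
  assumes "(f has_sum v) UNIV" "\<And>x. 0 \<le> f x"
  shows "(\<integral>\<^sup>+x. ennreal (f x) \<partial>count_space UNIV) = ennreal v"
proof -
  have "f summable_on UNIV" "infsum f UNIV = v"
    using assms(1) by (auto simp: summable_on_def infsumI)
  then have "ennreal v = (SUP F\<in>{F. finite F \<and> F \<subseteq> UNIV}. ennreal (sum f F))"
    using infsum_nonneg_is_SUPREMUM_ennreal[of f UNIV] assms(2) by simp
  also have "\<dots> = infsum (\<lambda>x. ennreal (f x)) UNIV"
    using assms(2) by (subst nonneg_infsum_complete) (auto simp: sum_ennreal)
  finally show ?thesis by (simp add: infsum_eq_nn_integral_count_space)
qed

lemma nn_integral_imp_has_sum:
  fixes f :: "'a::countable \<Rightarrow> real"
  assumes "(\<integral>\<^sup>+x. ennreal (f x) \<partial>count_space UNIV) = ennreal v" "\<And>x. 0 \<le> f x" "0 \<le> v"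
  shows "(f has_sum v) UNIV"
proof -
  have "sum f F \<le> v" if "finite F" for F
  proof -
    have "ennreal (sum f F) = (\<Sum>x\<in>F. ennreal (f x))" using assms(2) by (simp add: sum_ennreal)
    also have "\<dots> \<le> infsum (\<lambda>x. ennreal (f x)) UNIV"
      using that by (subst nonneg_infsum_complete) (auto intro!: SUP_upper)
    finally show ?thesis using assms by (simp add: infsum_eq_nn_integral_count_space)
  qed
  then have "f summable_on UNIV"
    by (intro nonneg_bounded_partial_sums_imp_summable_on[where C = v])
       (auto simp: assms eventually_finite_subsets_at_top)
  then have h: "(f has_sum infsum f UNIV) UNIV" by simp
  have "ennreal (infsum f UNIV) = ennreal v"
    using has_sum_imp_nn_integral[OF h assms(2)] assms(1) by simp
  then show ?thesis using h assms by (simp add: infsum_nonneg)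
qed

definition energy :: "('a::countable \<Rightarrow> 'a \<Rightarrow> real) \<Rightarrow> ('a \<Rightarrow> real) \<Rightarrow> ennreal" where
  "energy b f = (\<integral>\<^sup>+(x, y). ennreal (b x y * (f x - f y)^2) \<partial>count_space UNIV) / 2"

text \<open>Real valued and bilinear, unlike \<open>energy\<close>. The diagonal m is a separate
  argument and not the row sum of b, so that a weight can be absorbed into it.\<close>

definition form :: "('a \<Rightarrow> 'a \<Rightarrow> real) \<Rightarrow> ('a \<Rightarrow> real) \<Rightarrow> 'a set \<Rightarrow> ('a \<Rightarrow> real) \<Rightarrow> ('a \<Rightarrow> real) \<Rightarrow> real" where
  "form b m S f g = (\<Sum>x\<in>S. m x * f x * g x) - (\<Sum>x\<in>S. \<Sum>y\<in>S. b x y * f x * g y)"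

lemma Qform_eq_energy: "Qform \<sigma> f = energy (\<lambda>x y. kappa \<sigma> (x - y)) f"
  unfolding Qform_def energy_def by (simp add: infsum_eq_nn_integral_count_space case_prod_unfold)

lemma wsum_eq_nn_integral: "wsum w f = (\<integral>\<^sup>+x. ennreal (w x * (f x)^2) \<partial>count_space UNIV)"
  unfolding wsum_def by (simp add: infsum_eq_nn_integral_count_space)

text \<open>Expand the square: since b is symmetric with row sums m, each of the two square terms
  sums to \<Sum> m f^2, and the cross term is a finite sum. The energy being nonnegative, so is the
  form.\<close>

lemma energy_finite_support:
  fixes b :: "'a::countable \<Rightarrow> 'a \<Rightarrow> real"
  assumes nonneg: "\<And>x y. 0 \<le> b x y" and sym: "\<And>x y. b x y = b y x"
    and rows: "\<And>x. ((\<lambda>y. b x y) has_sum m x) UNIV"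
    and S: "finite S" "\<And>x. x \<notin> S \<Longrightarrow> f x = 0"
  shows "energy b f = ennreal (form b m S f f)" "0 \<le> form b m S f f"
proof -
  define c where "c = (\<Sum>x\<in>S. m x * f x * f x)"
  define e where "e = (\<Sum>x\<in>S. \<Sum>y\<in>S. b x y * f x * f y)"
  let ?g = "\<lambda>(x, y). b x y * (f x)^2"
  have row: "((\<lambda>y. ?g (x, y)) has_sum m x * (f x)^2) UNIV" for x
    using has_sum_cmult_left[OF rows[of x], of "(f x)^2"] by simp
  have "((\<lambda>x. m x * (f x)^2) has_sum (\<Sum>x\<in>S. m x * (f x)^2)) UNIV"
    using S by (intro has_sum_finite_neutralI) auto
  then have hx: "((\<lambda>x. m x * (f x)^2) has_sum c) UNIV"
    by (simp add: c_def power2_eq_square mult.assoc)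
  have g: "(?g has_sum c) (UNIV \<times> UNIV)"
  proof (rule has_sum_SigmaI[OF row hx summable_on_SigmaI[OF row]])
    show "(\<lambda>x. m x * (f x)^2) summable_on UNIV" using hx by (rule has_sum_imp_summable)
    show "0 \<le> ?g (x, y)" for x y using nonneg by simp
  qed
  have g': "((\<lambda>(x, y). b x y * (f y)^2) has_sum c) (UNIV \<times> UNIV)"
  proof -
    have "(\<lambda>(x, y). b x y * (f y)^2) = (\<lambda>(x, y). ?g (y, x))"
      using sym by (auto simp: fun_eq_iff)
    then show ?thesis using g by (simp only: has_sum_swap[of ?g])
  qed
  have "((\<lambda>(x,y). b x y * f x * f y) has_sum (\<Sum>(x,y)\<in>S \<times> S. b x y * f x * f y)) (UNIV \<times> UNIV)"
    using S by (intro has_sum_finite_neutralI) (auto split: prod.splits)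
  then have h: "((\<lambda>(x,y). b x y * f x * f y) has_sum e) (UNIV \<times> UNIV)"
    by (simp add: e_def sum.cartesian_product)
  have "((\<lambda>z. (case z of (x, y) \<Rightarrow> b x y * (f x)^2) + (case z of (x, y) \<Rightarrow> b x y * (f y)^2)
      + (-2) * (case z of (x, y) \<Rightarrow> b x y * f x * f y)) has_sum c + c + (-2) * e) (UNIV \<times> UNIV)"
    by (intro has_sum_add has_sum_cmult_right g g' h)
  then have hs: "((\<lambda>(x,y). b x y * (f x - f y)^2) has_sum 2 * (c - e)) UNIV"
    by (auto simp: case_prod_unfold power2_eq_square algebra_simps)
  have form: "form b m S f f = c - e" by (simp add: form_def c_def e_def)
  have pos: "0 \<le> 2 * (c - e)"
    by (rule has_sum_nonneg[OF hs]) (auto simp: nonneg)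
  have "energy b f = ennreal (2 * (c - e)) / 2"
    unfolding energy_def using has_sum_imp_nn_integral[OF hs] nonneg by (auto simp: case_prod_unfold)
  also have "\<dots> = ennreal (c - e)"
  proof -
    have "2 * (c - e) / 2 = c - e" by simp
    then show ?thesis using ennreal_divide_numeral[OF pos, of "num.Bit0 num.One"] by (simp only:)
  qed
  finally show "energy b f = ennreal (form b m S f f)" unfolding form by simp
  show "0 \<le> form b m S f f" unfolding form using pos by simp
qed

lemma wsum_finite_support:
  fixes f :: "int ^ 'd::finite \<Rightarrow> real"
  assumes "finite S" "\<And>x. x \<notin> S \<Longrightarrow> f x = 0" "\<And>x. 0 \<le> w x"
  shows "wsum w f = ennreal (\<Sum>x\<in>S. w x * (f x)^2)"
proof -
  have "(\<integral>\<^sup>+x. ennreal (w x * (f x)^2) \<partial>count_space UNIV) = (\<Sum>x\<in>S. ennreal (w x * (f x)^2))"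
    by (rule nn_integral_count_space') (use assms in auto)
  also have "\<dots> = ennreal (\<Sum>x\<in>S. w x * (f x)^2)"
    by (rule sum_ennreal) (use assms(3) in simp)
  finally show ?thesis unfolding wsum_eq_nn_integral .
qed

lemma fin_supp_superset:
  assumes "fin_supp f" obtains S where "finite S" "\<And>x. x \<notin> S \<Longrightarrow> f x = 0"
  by (rule that[of "{x. f x \<noteq> 0}"]) (use assms in \<open>auto simp: fin_supp_def\<close>)

text \<open>Lower semicontinuity under pointwise convergence, by Fatou on pairs of points; this is
  how facts about finite support reach the form domain.\<close>

lemma energy_Fatou:
  assumes "\<And>x. (\<lambda>n. g n x) \<longlonglongrightarrow> f x" "\<And>x y. 0 \<le> b x y"
  shows "energy b f \<le> liminf (\<lambda>n. energy b (g n))"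
proof -
  let ?I = "\<lambda>f. (\<integral>\<^sup>+(x, y). ennreal (b x y * (f x - f y)^2) \<partial>count_space UNIV)"
  have "?I f = (\<integral>\<^sup>+z. liminf (\<lambda>n. ennreal (case z of (x, y) \<Rightarrow> b x y * (g n x - g n y)^2)) \<partial>count_space UNIV)"
  proof (rule nn_integral_cong)
    fix z :: "'a \<times> 'a"
    obtain x y where z: "z = (x, y)" by fastforce
    have "(\<lambda>n. ennreal (b x y * (g n x - g n y)^2)) \<longlonglongrightarrow> ennreal (b x y * (f x - f y)^2)"
      by (intro tendsto_intros assms tendsto_ennrealI)
    then show "(case z of (x, y) \<Rightarrow> ennreal (b x y * (f x - f y)^2)) =
      liminf (\<lambda>n. ennreal (case z of (x, y) \<Rightarrow> b x y * (g n x - g n y)^2))"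
      unfolding z by (simp add: lim_imp_Liminf)
  qed
  also have "\<dots> \<le> liminf (\<lambda>n. ?I (g n))"
    by (rule order_trans[OF nn_integral_liminf]) (auto simp: case_prod_unfold)
  finally have "?I f / 2 \<le> liminf (\<lambda>n. ?I (g n)) / 2"
    by (rule divide_right_mono_ennreal)
  also have "\<dots> = liminf (\<lambda>n. ?I (g n) / 2)"
  proof -
    have "continuous_on UNIV (\<lambda>x::ennreal. x / 2)"
      unfolding divide_ennreal_def continuous_on_def
      by (auto intro!: tendsto_mult_ennreal tendsto_ident_at)
    then show ?thesis 
      by (intro Liminf_compose_continuous_mono[symmetric]) (auto simp: mono_def divide_right_mono_ennreal)
  qed
  finally show ?thesis unfolding energy_def .
qed

text \<open>A triangle inequality for the root of the energy, in a quadratic form that makes sense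
  for infinite values. Sending \<epsilon> to 0 loses nothing once the energy of g is
  negligible.\<close>

lemma energy_add_le:
  assumes "\<And>x y. 0 \<le> b x y" "0 < \<epsilon>"
  shows "energy b (\<lambda>x. f x + g x) \<le> ennreal (1 + \<epsilon>) * energy b f + ennreal (1 + 1 / \<epsilon>) * energy b g"
proof -
  let ?I = "\<lambda>f. (\<integral>\<^sup>+(x, y). ennreal (b x y * (f x - f y)^2) \<partial>count_space UNIV)"
  have "?I (\<lambda>x. f x + g x) \<le> (\<integral>\<^sup>+z. ennreal (1 + \<epsilon>) * (case z of (x, y) \<Rightarrow> ennreal (b x y * (f x - f y)^2))
      + ennreal (1 + 1 / \<epsilon>) * (case z of (x, y) \<Rightarrow> ennreal (b x y * (g x - g y)^2)) \<partial>count_space UNIV)"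
  proof (rule nn_integral_mono)
    fix z :: "'a \<times> 'a"
    obtain x y where z: "z = (x, y)" by fastforce
    define p q where "p = f x - f y" and "q = g x - g y"
    \<comment> \<open>Young's inequality 2pq \<le> \<epsilon> p^2 + q^2 / \<epsilon>.\<close>
    have "0 \<le> (\<epsilon> * p - q)^2 / \<epsilon>" using assms(2) by simp
    then have "(p + q)^2 \<le> (1 + \<epsilon>) * p^2 + (1 + 1 / \<epsilon>) * q^2"
      using assms(2) by (simp add: power2_eq_square field_simps)
    then have "b x y * (p + q)^2 \<le> b x y * ((1 + \<epsilon>) * p^2 + (1 + 1 / \<epsilon>) * q^2)"
      by (intro mult_left_mono assms)
    then have "ennreal (b x y * (p + q)^2)
        \<le> ennreal ((1 + \<epsilon>) * (b x y * p^2) + (1 + 1 / \<epsilon>) * (b x y * q^2))"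
      by (intro ennreal_leI) (simp add: algebra_simps)
    also have "\<dots> = ennreal (1 + \<epsilon>) * ennreal (b x y * p^2) + ennreal (1 + 1 / \<epsilon>) * ennreal (b x y * q^2)"
      using assms by (subst ennreal_plus) (auto simp: ennreal_mult intro!: mult_nonneg_nonneg add_nonneg_nonneg)
    finally show "(case z of (x, y) \<Rightarrow> ennreal (b x y * (f x + g x - (f y + g y))\<^sup>2))
      \<le> ennreal (1 + \<epsilon>) * (case z of (x, y) \<Rightarrow> ennreal (b x y * (f x - f y)^2))
      + ennreal (1 + 1 / \<epsilon>) * (case z of (x, y) \<Rightarrow> ennreal (b x y * (g x - g y)^2))"
      unfolding z p_def q_def by (simp add: algebra_simps)
  qed
  also have "\<dots> = ennreal (1 + \<epsilon>) * ?I f + ennreal (1 + 1 / \<epsilon>) * ?I g"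
    by (subst nn_integral_add) (auto simp: nn_integral_cmult)
  finally show ?thesis
    unfolding energy_def
    by (metis (no_types, lifting) add_divide_distrib_ennreal divide_right_mono_ennreal ennreal_times_divide)
qed

lemma energy_ge:
  fixes b :: "'a::countable \<Rightarrow> 'a \<Rightarrow> real"
  shows "ennreal (b x y * (f x - f y)^2) / 2 \<le> energy b f"
proof -
  have "ennreal (b x y * (f x - f y)^2) = (\<integral>\<^sup>+z. (case z of (x, y) \<Rightarrow> ennreal (b x y * (f x - f y)^2))
      * indicator {(x, y)} z \<partial>count_space UNIV)"
    by simp
  also have "\<dots> \<le> (\<integral>\<^sup>+(x, y). ennreal (b x y * (f x - f y)^2) \<partial>count_space UNIV)"
    by (intro nn_integral_mono) (auto simp: indicator_def)
  finally show ?thesis unfolding energy_def by (rule divide_right_mono_ennreal)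
qed

lemma energy_eq_0_imp:
  fixes b :: "'a::countable \<Rightarrow> 'a \<Rightarrow> real"
  assumes "energy b f = 0" "0 < b x y"
  shows "f x = f y"
proof -
  have "ennreal (b x y * (f x - f y)^2) = 0"
    using assms(1) by (auto simp: energy_def divide_ennreal_def nn_integral_0_iff_AE AE_count_space)
  then have "b x y * (f x - f y)^2 \<le> 0" using ennreal_eq_0_iff by blast
  then show ?thesis using assms(2) by (simp add: mult_le_0_iff)
qed

section \<open>Ground states and criticality\<close>

lemma liminf_add_ennreal:
  fixes f g :: "nat \<Rightarrow> ennreal"
  shows "liminf f + liminf g \<le> liminf (\<lambda>n. f n + g n)"
proof -
  have "liminf f + liminf g = (SUP n. (INF m\<in>{n..}. f m) + (INF m\<in>{n..}. g m))"
    unfolding liminf_SUP_INF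
    by (rule ennreal_SUP_add[symmetric]) (auto simp: incseq_def intro!: INF_superset_mono)
  also have "\<dots> \<le> liminf (\<lambda>n. f n + g n)"
    unfolding liminf_SUP_INF by (intro SUP_mono) (auto intro!: INF_greatest add_mono INF_lower)
  finally show ?thesis .
qed

lemma ennreal_le_of_le_one_plus:
  assumes "\<And>\<epsilon>. 0 < \<epsilon> \<Longrightarrow> x \<le> ennreal (1 + \<epsilon>) * y"
  shows "x \<le> (y::ennreal)"
proof (rule ennreal_le_epsilon)
  fix e :: real assume y: "y < \<top>" and e: "0 < e"
  then obtain q where q: "y = ennreal q" "0 \<le> q" by (cases y) auto
  \<comment> \<open>The summand 1 guards against q = 0.\<close>
  define \<epsilon> where "\<epsilon> = e / (q + 1)"
  have \<epsilon>: "0 < \<epsilon>" using e q by (simp add: \<epsilon>_def)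
  have "x \<le> ennreal (1 + \<epsilon>) * y" by (rule assms[OF \<epsilon>])
  also have "\<dots> = ennreal ((1 + \<epsilon>) * q)" using \<epsilon> q by (simp add: ennreal_mult)
  also have "\<dots> \<le> ennreal (q + e)"
    using e q by (intro ennreal_leI) (simp add: \<epsilon>_def field_simps)
  also have "\<dots> = y + ennreal e" using q e by simp
  finally show "x \<le> y + ennreal e" .
qed

lemma lnorm_axis:
  fixes x :: "int ^ 'd::finite"
  shows "lnorm (axis i 1 :: int ^ 'd) = 1" "lnorm (- axis i 1 :: int ^ 'd) = 1"
  by (simp_all add: lnorm_def axis_def if_distrib power2_eq_square if_distribR cong: if_cong)

text \<open>Connectedness of the lattice as an induction rule: the l1 norm drops when a nonzero
  coordinate moves one unit towards 0.\<close>

lemma lattice_induct: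
  fixes x :: "int ^ 'd::finite"
  assumes "P 0" and step: "\<And>x y. lnorm (x - y) = 1 \<Longrightarrow> P x \<Longrightarrow> P y"
  shows "P x"
proof (induction "\<Sum>i\<in>UNIV. nat \<bar>x $ i\<bar>" arbitrary: x rule: less_induct)
  case less
  show ?case
  proof (cases "x = 0")
    case False
    then obtain i where i: "x $ i \<noteq> 0" by (auto simp: vec_eq_iff)
    define y where "y = x - axis i (sgn (x $ i))"
    have "(\<Sum>j\<in>UNIV. nat \<bar>y $ j\<bar>) < (\<Sum>j\<in>UNIV. nat \<bar>x $ j\<bar>)"
      using i by (intro sum_strict_mono_ex1)
        (auto simp: y_def axis_def sgn_if intro!: exI[of _ i])
    then have "P y" by (rule less)
    moreover have "y - x = axis i 1 \<or> y - x = - axis i 1"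
      using i by (auto simp: y_def sgn_if vec_eq_iff axis_def)
    then have "lnorm (y - x) = 1" using lnorm_axis[of i] by auto
    ultimately show ?thesis using step by blast
  qed (use assms in simp)
qed

text \<open>The form as f tested against an operator applied to g; it is small when g almost solves
  the equation on the support of f.\<close>

lemma form_alt: "form b m S f g = (\<Sum>x\<in>S. f x * (m x * g x - (\<Sum>y\<in>S. b x y * g y)))"
  unfolding form_def
  by (simp add: right_diff_distrib sum_subtractf sum_distrib_left mult.assoc mult.left_commute)

lemma form_add_left: "form b m S (\<lambda>x. f x + g x) h = form b m S f h + form b m S g h"
  unfolding form_alt by (simp add: distrib_right sum.distrib)

lemma form_scale_left: "form b m S (\<lambda>x. c * f x) h = c * form b m S f h"
  unfolding form_alt by (simp add: sum_distrib_left mult.assoc)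

lemma form_commute:
  fixes b :: "'a \<Rightarrow> 'a \<Rightarrow> real"
  assumes "\<And>x y. b x y = b y x"
  shows "form b m S f g = form b m S g f"
proof -
  have "(\<Sum>x\<in>S. \<Sum>y\<in>S. b x y * f x * g y) = (\<Sum>y\<in>S. \<Sum>x\<in>S. b x y * f x * g y)"
    by (rule sum.swap)
  also have "\<dots> = (\<Sum>x\<in>S. \<Sum>y\<in>S. b x y * g x * f y)"
    by (intro sum.cong refl) (simp only: assms[of _ _] mult.assoc mult.commute mult.left_commute)
  finally show ?thesis unfolding form_def by (simp add: mult_ac)
qed

lemma form_quadratic:
  fixes b :: "'a \<Rightarrow> 'a \<Rightarrow> real"
  assumes "\<And>x y. b x y = b y x"
  shows "form b m S (\<lambda>x. f x + c * g x) (\<lambda>x. f x + c * g x)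
    = form b m S f f + 2 * c * form b m S f g + c^2 * form b m S g g"
  unfolding form_add_left form_scale_left
proof -
  have r: "form b m S h (\<lambda>x. f x + c * g x) = form b m S f h + c * form b m S g h" for h
    by (subst form_commute[OF assms]) (simp add: form_add_left form_scale_left)
  show "form b m S f (\<lambda>x. f x + c * g x) + c * form b m S g (\<lambda>x. f x + c * g x)
    = form b m S f f + 2 * c * form b m S f g + c^2 * form b m S g g"
    unfolding r using form_commute[of b m S g f, OF assms] by (simp add: power2_eq_square algebra_simps)
qed

text \<open>With L f = k f - (convolution of \<open>kappa \<sigma>\<close> with f), the assumption
  \<open>eqn\<close> says L u = w u. Everything on criticality uses only this equation, positivity
  of u, and summability, symmetry and positivity on edges of the kernel, so that it can be applied
  to ground states other than potentials.\<close>

locale hardy_pair =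
  fixes \<sigma> k :: real and u w :: "int ^ 'd::finite \<Rightarrow> real"
  assumes K_nonneg: "\<And>x. 0 \<le> kappa \<sigma> (x :: int ^ 'd)"
    and K_sym: "\<And>x. kappa \<sigma> (- x :: int ^ 'd) = kappa \<sigma> x"
    and K_sum: "((\<lambda>x. kappa \<sigma> (x :: int ^ 'd)) has_sum k) UNIV"
    and K_nbr: "\<And>x. lnorm x = 1 \<Longrightarrow> 0 < kappa \<sigma> (x :: int ^ 'd)"
    and u_pos: "\<And>x. 0 < u x" and w_nonneg: "\<And>x. 0 \<le> w x"
    and eqn: "\<And>x. ((\<lambda>y. kappa \<sigma> (x - y) * u y) has_sum (k - w x) * u x) UNIV"
begin

text \<open>On the diagonal, and for f supported in S, this is the Hardy deficit Q(f) - \<Sum> w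
  f^2.\<close>

abbreviation hf :: "(int ^ 'd) set \<Rightarrow> (int ^ 'd \<Rightarrow> real) \<Rightarrow> (int ^ 'd \<Rightarrow> real) \<Rightarrow> real" where
  "hf \<equiv> form (\<lambda>x y. kappa \<sigma> (x - y)) (\<lambda>x. k - w x)"

lemma K_sym': "kappa \<sigma> (x - y) = kappa \<sigma> (y - x :: int ^ 'd)"
  using K_sym[of "y - x"] by simp

lemma rows: "((\<lambda>y. kappa \<sigma> (x - y :: int ^ 'd)) has_sum k) UNIV"
proof -
  have "bij_betw (\<lambda>y. x - y) UNIV UNIV"
    by (rule bij_betwI[where g = "\<lambda>y. x - y"]) auto
  then show ?thesis
    using has_sum_reindex_bij_betw[of "\<lambda>y. x - y" UNIV UNIV "kappa \<sigma>" k] K_sum by simp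
qed

lemma form_extend:
  assumes "finite T" "S \<subseteq> T" "\<And>x. x \<notin> S \<Longrightarrow> f x = 0" "\<And>x. x \<notin> S \<Longrightarrow> g x = 0"
  shows "form b m T f g = form b m S f g"
proof -
  have "(\<Sum>x\<in>T. m x * f x * g x) = (\<Sum>x\<in>S. m x * f x * g x)"
    using assms by (intro sum.mono_neutral_right) auto
  moreover have "(\<Sum>x\<in>T. \<Sum>y\<in>T. b x y * f x * g y) = (\<Sum>x\<in>S. \<Sum>y\<in>T. b x y * f x * g y)"
    using assms by (intro sum.mono_neutral_right) auto
  moreover have "(\<Sum>x\<in>S. \<Sum>y\<in>T. b x y * f x * g y) = (\<Sum>x\<in>S. \<Sum>y\<in>S. b x y * f x * g y)"
    using assms by (intro sum.cong refl sum.mono_neutral_right) auto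
  ultimately show ?thesis by (simp add: form_def)
qed

text \<open>Substituting f = u h turns the deficit into the energy of h with conductances u(x)
  \<kappa>(x-y) u(y). By \<open>eqn\<close> the rows of these sum to u (k - w) u, which is the
  diagonal needed for \<open>energy_finite_support\<close>.\<close>

lemma ground_state:
  assumes "finite S" "\<And>x. x \<notin> S \<Longrightarrow> f x = 0"
  shows "energy (\<lambda>x y. u x * kappa \<sigma> (x - y) * u y) (\<lambda>x. f x / u x) = ennreal (hf S f f)"
    and "0 \<le> hf S f f"
proof -
  let ?b = "\<lambda>x y. u x * kappa \<sigma> (x - y) * u y" and ?m = "\<lambda>x. u x * ((k - w x) * u x)"
  have eq: "form ?b ?m S (\<lambda>x. f x / u x) (\<lambda>x. f x / u x) = hf S f f"
    using u_pos by (simp add: form_def less_imp_neq[THEN not_sym] mult_ac)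
  have pos: "0 \<le> ?b x y" for x y
    using u_pos K_nonneg by (simp add: less_imp_le)
  have sym: "?b x y = ?b y x" for x y
    using K_sym'[of x y] by simp
  have sum: "((\<lambda>y. ?b x y) has_sum ?m x) UNIV" for x
    using has_sum_cmult_right[OF eqn[of x], of "u x"] by (simp add: mult.assoc)
  have "x \<notin> S \<Longrightarrow> f x / u x = 0" for x using assms by simp
  note * = energy_finite_support[of ?b ?m S "\<lambda>x. f x / u x", OF pos sym sum assms(1) this]
  show "energy ?b (\<lambda>x. f x / u x) = ennreal (hf S f f)" using *(1) eq by simp
  show "0 \<le> hf S f f" using *(2) eq by simp
qed

lemma Qform_finite_support:
  assumes "finite S" "\<And>x. x \<notin> S \<Longrightarrow> f x = 0"
  shows "Qform \<sigma> f = ennreal (hf S f f + (\<Sum>x\<in>S. w x * (f x)^2))"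
proof -
  have "Qform \<sigma> f = ennreal (form (\<lambda>x y. kappa \<sigma> (x - y)) (\<lambda>_. k) S f f)"
    unfolding Qform_eq_energy
    by (rule energy_finite_support) (use K_nonneg K_sym' rows assms in auto)
  moreover have "form (\<lambda>x y. kappa \<sigma> (x - y)) (\<lambda>_. k) S f f = hf S f f + (\<Sum>x\<in>S. w x * (f x)^2)"
    unfolding form_def by (simp add: algebra_simps power2_eq_square sum.distrib sum_subtractf)
  ultimately show ?thesis by simp
qed

lemma Qform_split:
  assumes "finite S" "\<And>x. x \<notin> S \<Longrightarrow> f x = 0"
  shows "Qform \<sigma> f = ennreal (hf S f f) + wsum w f"
  using Qform_finite_support[OF assms] ground_state(2)[OF assms] wsum_finite_support[of S f w, OF assms w_nonneg]
  by (simp add: ennreal_plus sum_nonneg w_nonneg)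

section \<open>Hardy property and criticality of the weight\<close>

lemma hardy: "hardy_weight \<sigma> w"
  unfolding hardy_weight_def
proof (intro conjI allI impI w_nonneg)
  fix \<phi> :: "int ^ 'd \<Rightarrow> real" assume "fin_supp \<phi>"
  then obtain S where S: "finite S" "\<And>x. x \<notin> S \<Longrightarrow> \<phi> x = 0" by (rule fin_supp_superset) blast
  have "Qform \<sigma> \<phi> = ennreal (hf S \<phi> \<phi>) + wsum w \<phi>" by (rule Qform_split) (use S in auto)
  then show "wsum w \<phi> \<le> Qform \<sigma> \<phi>" by simp
qed

text \<open>Finitely supported approximations of u from below with deficit at most C. The bound is a
  parameter rather than a sequence tending to 0, because averaging acts on a fixed bound.\<close>

definition null_seq :: "real \<Rightarrow> (nat \<Rightarrow> int ^ 'd \<Rightarrow> real) \<Rightarrow> bool" where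
  "null_seq C \<phi> \<longleftrightarrow> (\<forall>n. \<exists>S. finite S \<and> (\<forall>x. x \<notin> S \<longrightarrow> \<phi> n x = 0) \<and> hf S (\<phi> n) (\<phi> n) \<le> C)
     \<and> (\<forall>n x. 0 \<le> \<phi> n x \<and> \<phi> n x \<le> u x) \<and> (\<forall>x. (\<lambda>n. \<phi> n x) \<longlonglongrightarrow> u x)"

text \<open>A Hardy weight w' above w, larger at z, would force (w' - w)(z) times the square of the
  n-th function at z below the deficit; but these values tend to u(z) > 0 while the deficit can be
  made arbitrarily small.\<close>

lemma critical_if_null_seqs:
  assumes "\<And>\<epsilon>. 0 < \<epsilon> \<Longrightarrow> \<exists>\<phi>. null_seq \<epsilon> \<phi>"
  shows "critical \<sigma> w"
  unfolding critical_def subcritical_def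
proof (intro conjI hardy notI)
  assume "hardy_weight \<sigma> w \<and> (\<exists>w'. hardy_weight \<sigma> w' \<and> (\<forall>x. w x \<le> w' x) \<and> w' \<noteq> w)"
  then obtain w' where h: "hardy_weight \<sigma> w'" and ge: "\<And>x. w x \<le> w' x" and "w' \<noteq> w" by blast
  then obtain z where "w' z \<noteq> w z" by blast
  with ge[of z] have z: "w z < w' z" by simp
  \<comment> \<open>Half of the limit of (w' z - w z) * (\<phi> n z)^2, so that the bound by
    \<epsilon> contradicts the limit.\<close>
  define \<epsilon> where "\<epsilon> = (w' z - w z) * (u z)^2 / 2"
  have \<epsilon>: "0 < \<epsilon>" using z u_pos[of z] by (simp add: \<epsilon>_def)
  then obtain \<phi> where \<phi>: "null_seq \<epsilon> \<phi>" using assms by blast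
  have "(w' z - w z) * (\<phi> n z)^2 \<le> \<epsilon>" for n
  proof -
    obtain S0 where S0: "finite S0" "\<And>x. x \<notin> S0 \<Longrightarrow> \<phi> n x = 0" and le: "hf S0 (\<phi> n) (\<phi> n) \<le> \<epsilon>"
      using \<phi> unfolding null_seq_def by blast
    \<comment> \<open>Adding z makes its term occur in the sums even if \<phi> n vanishes
      there.\<close>
    define S where "S = insert z S0"
    have S: "finite S" "\<And>x. x \<notin> S \<Longrightarrow> \<phi> n x = 0" using S0 by (auto simp: S_def)
    have hS: "hf S (\<phi> n) (\<phi> n) \<le> \<epsilon>"
      unfolding S_def by (subst form_extend[of "insert z S0" S0]) (use S0 le in auto)
    have "fin_supp (\<phi> n)" using S unfolding fin_supp_def by (metis (mono_tags, lifting) finite_subset mem_Collect_eq subsetI)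
    then have "wsum w' (\<phi> n) \<le> Qform \<sigma> (\<phi> n)" using h by (simp add: hardy_weight_def)
    moreover have w'0: "0 \<le> w' x" for x using h by (simp add: hardy_weight_def)
    ultimately have "ennreal (\<Sum>x\<in>S. w' x * (\<phi> n x)^2) \<le> ennreal (hf S (\<phi> n) (\<phi> n) + (\<Sum>x\<in>S. w x * (\<phi> n x)^2))"
      using Qform_finite_support[of S "\<phi> n", OF S] wsum_finite_support[of S "\<phi> n" w', OF S w'0] by simp
    then have "(\<Sum>x\<in>S. w' x * (\<phi> n x)^2) \<le> hf S (\<phi> n) (\<phi> n) + (\<Sum>x\<in>S. w x * (\<phi> n x)^2)"
      using ground_state(2)[of S "\<phi> n", OF S] by (subst (asm) ennreal_le_iff) (simp_all add: sum_nonneg w_nonneg)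
    then have "(\<Sum>x\<in>S. (w' x - w x) * (\<phi> n x)^2) \<le> \<epsilon>"
      using hS by (simp add: algebra_simps sum_subtractf)
    moreover have "(w' z - w z) * (\<phi> n z)^2 \<le> (\<Sum>x\<in>S. (w' x - w x) * (\<phi> n x)^2)"
      using S(1) ge by (intro member_le_sum) (auto simp: S_def)
    ultimately show ?thesis by linarith
  qed
  moreover have "(\<lambda>n. (w' z - w z) * (\<phi> n z)^2) \<longlonglongrightarrow> (w' z - w z) * (u z)^2"
    using \<phi> by (intro tendsto_intros) (auto simp: null_seq_def)
  ultimately have "(w' z - w z) * (u z)^2 \<le> \<epsilon>" by (intro LIMSEQ_le_const2) auto
  then show False using \<epsilon> by (simp add: \<epsilon>_def)
qed

text \<open>The limit of the pairing is f tested against (L - w) u = 0. Only the finitely many rows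
  in S matter, and in each of them a finite piece of the convolution almost reaches (k - w) u. Since
  all entries are nonnegative, further points of T only lower the value, so the bound holds for
  every T although the supports of \<phi> j are not controlled.\<close>

lemma hf_cross_small:
  assumes \<phi>: "null_seq C \<phi>" and S: "finite S" and f: "\<And>x. 0 \<le> f x" "\<And>x. x \<notin> S \<Longrightarrow> f x = 0" and \<delta>: "0 < \<delta>"
  shows "\<forall>\<^sub>F j in sequentially. \<forall>T. finite T \<longrightarrow> S \<subseteq> T \<longrightarrow> (\<forall>x. x \<notin> T \<longrightarrow> \<phi> j x = 0) \<longrightarrow> hf T f (\<phi> j) \<le> \<delta>"
proof -
  have lim: "(\<lambda>j. \<phi> j x) \<longlonglongrightarrow> u x" and nn: "0 \<le> \<phi> j x" for x j using \<phi> by (auto simp: null_seq_def)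
  \<comment> \<open>Row errors are weighted by f, so each may be \<delta> divided by the total of f;
    the 1 guards against f = 0.\<close>
  define \<eta> where "\<eta> = \<delta> / (1 + (\<Sum>x\<in>S. f x))"
  have fs: "0 \<le> (\<Sum>x\<in>S. f x)" using f by (intro sum_nonneg) auto
  have \<eta>: "0 < \<eta>" using \<delta> fs by (simp add: \<eta>_def)
  have row: "\<exists>F. finite F \<and> (\<forall>\<^sub>F j in sequentially. (k - w x) * \<phi> j x - (\<Sum>y\<in>F. kappa \<sigma> (x - y) * \<phi> j y) \<le> \<eta>)" for x
  proof -
    have "\<forall>\<^sub>F F in finite_subsets_at_top UNIV. (\<Sum>y\<in>F. kappa \<sigma> (x - y) * u y) > (k - w x) * u x - \<eta>"
      using eqn[of x] \<eta> unfolding has_sum_def by (intro order_tendstoD) auto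
    then obtain F where F: "finite F" "(\<Sum>y\<in>F. kappa \<sigma> (x - y) * u y) > (k - w x) * u x - \<eta>"
      by (auto simp: eventually_finite_subsets_at_top)
    have "(\<lambda>j. (k - w x) * \<phi> j x - (\<Sum>y\<in>F. kappa \<sigma> (x - y) * \<phi> j y)) \<longlonglongrightarrow>
        (k - w x) * u x - (\<Sum>y\<in>F. kappa \<sigma> (x - y) * u y)"
      by (intro tendsto_intros lim)
    then have "\<forall>\<^sub>F j in sequentially. (k - w x) * \<phi> j x - (\<Sum>y\<in>F. kappa \<sigma> (x - y) * \<phi> j y) < \<eta>"
      by (rule order_tendstoD) (use F in linarith)
    then show ?thesis using F(1) by (auto elim!: eventually_mono)
  qed
  have "\<exists>F. \<forall>x. finite (F x) \<and> (\<forall>\<^sub>F j in sequentially. (k - w x) * \<phi> j x - (\<Sum>y\<in>F x. kappa \<sigma> (x - y) * \<phi> j y) \<le> \<eta>)"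
    by (intro choice allI row)
  then obtain F where F: "\<And>x. finite (F x)" and
    ev: "\<And>x. \<forall>\<^sub>F j in sequentially. (k - w x) * \<phi> j x - (\<Sum>y\<in>F x. kappa \<sigma> (x - y) * \<phi> j y) \<le> \<eta>"
    by blast
  have "\<forall>\<^sub>F j in sequentially. \<forall>x\<in>S. (k - w x) * \<phi> j x - (\<Sum>y\<in>F x. kappa \<sigma> (x - y) * \<phi> j y) \<le> \<eta>"
    using S ev by (intro eventually_ball_finite) auto
  then show ?thesis
  proof (rule eventually_mono, intro allI impI)
    fix j T assume j: "\<forall>x\<in>S. (k - w x) * \<phi> j x - (\<Sum>y\<in>F x. kappa \<sigma> (x - y) * \<phi> j y) \<le> \<eta>"
      and T: "finite T" "S \<subseteq> T" "\<forall>x. x \<notin> T \<longrightarrow> \<phi> j x = 0"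
    have sub: "(\<Sum>y\<in>F x. kappa \<sigma> (x - y) * \<phi> j y) \<le> (\<Sum>y\<in>T. kappa \<sigma> (x - y) * \<phi> j y)" for x
    proof -
      have "(\<Sum>y\<in>F x. kappa \<sigma> (x - y) * \<phi> j y) = (\<Sum>y\<in>F x \<inter> T. kappa \<sigma> (x - y) * \<phi> j y)"
        using F T by (intro sum.mono_neutral_right) auto
      also have "\<dots> \<le> (\<Sum>y\<in>T. kappa \<sigma> (x - y) * \<phi> j y)"
        using T nn K_nonneg by (intro sum_mono2) auto
      finally show ?thesis .
    qed
    have "hf T f (\<phi> j) = (\<Sum>x\<in>T. f x * ((k - w x) * \<phi> j x - (\<Sum>y\<in>T. kappa \<sigma> (x - y) * \<phi> j y)))"
      by (rule form_alt)
    also have "\<dots> = (\<Sum>x\<in>S. f x * ((k - w x) * \<phi> j x - (\<Sum>y\<in>T. kappa \<sigma> (x - y) * \<phi> j y)))"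
      using T f by (intro sum.mono_neutral_right) auto
    also have "\<dots> \<le> (\<Sum>x\<in>S. f x * \<eta>)"
    proof (intro sum_mono mult_left_mono f)
      fix x assume "x \<in> S"
      then show "(k - w x) * \<phi> j x - (\<Sum>y\<in>T. kappa \<sigma> (x - y) * \<phi> j y) \<le> \<eta>" using j sub[of x] by fastforce
    qed
    also have "\<dots> = (\<Sum>x\<in>S. f x) * \<eta>" by (simp add: sum_distrib_right)
    also have "\<dots> \<le> \<delta>" using fs \<delta> by (simp add: \<eta>_def field_simps)
    finally show "hf T f (\<phi> j) \<le> \<delta>" .
  qed
qed

text \<open>Averaging a member of a null sequence with a much later one halves the bound, because the
  ground state is orthogonal to every finitely supported function.\<close>

lemma null_seq_halve:
  assumes \<phi>: "null_seq C \<phi>" and \<delta>: "0 < \<delta>"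
  shows "\<exists>\<psi>. null_seq (C / 2 + \<delta>) \<psi>"
proof -
  have bnd: "0 \<le> \<phi> n x" "\<phi> n x \<le> u x" and lim: "(\<lambda>n. \<phi> n x) \<longlonglongrightarrow> u x" for n x
    using \<phi> by (auto simp: null_seq_def)
  obtain S where S: "\<And>n. finite (S n)" "\<And>n x. x \<notin> S n \<Longrightarrow> \<phi> n x = 0" "\<And>n. hf (S n) (\<phi> n) (\<phi> n) \<le> C"
    using \<phi> unfolding null_seq_def by metis
  have "\<exists>j\<ge>i. hf (S i \<union> S j) (\<phi> i) (\<phi> j) \<le> \<delta>" for i
  proof -
    have "\<forall>\<^sub>F j in sequentially. hf (S i \<union> S j) (\<phi> i) (\<phi> j) \<le> \<delta> \<and> j \<ge> i"
    proof (rule eventually_conj[OF eventually_mono[OF hf_cross_small[where f = "\<phi> i" and S = "S i", OF \<phi>]] eventually_ge_at_top])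
    qed (use S bnd \<delta> in auto)
    then show ?thesis by (auto simp: eventually_sequentially)
  qed
  then obtain j where j: "\<And>i. j i \<ge> i" "\<And>i. hf (S i \<union> S (j i)) (\<phi> i) (\<phi> (j i)) \<le> \<delta>" by metis
  define \<psi> where "\<psi> i x = (\<phi> i x + \<phi> (j i) x) / 2" for i x
  have "null_seq (C / 2 + \<delta>) \<psi>"
    unfolding null_seq_def
  proof (intro conjI allI)
    fix i
    let ?T = "S i \<union> S (j i)"
    define g where "g x = \<phi> i x + 1 * \<phi> (j i) x" for x
    have \<psi>: "\<psi> i = (\<lambda>x. 1/2 * g x)" by (simp add: \<psi>_def g_def fun_eq_iff)
    have "hf ?T (\<psi> i) (\<psi> i) = 1/2 * hf ?T g (\<psi> i)" unfolding \<psi> by (rule form_scale_left)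
    also have "hf ?T g (\<psi> i) = hf ?T (\<psi> i) g" by (rule form_commute[OF K_sym'])
    also have "hf ?T (\<psi> i) g = 1/2 * hf ?T g g" unfolding \<psi> by (rule form_scale_left)
    finally have "4 * hf ?T (\<psi> i) (\<psi> i) = hf ?T g g" by simp
    then have "4 * hf ?T (\<psi> i) (\<psi> i) = hf ?T (\<phi> i) (\<phi> i) + 2 * hf ?T (\<phi> i) (\<phi> (j i)) + hf ?T (\<phi> (j i)) (\<phi> (j i))"
      unfolding g_def form_quadratic[OF K_sym'] by simp
    moreover have "hf ?T (\<phi> i) (\<phi> i) \<le> C"
      by (subst form_extend[of ?T "S i"]) (use S in auto)
    moreover have "hf ?T (\<phi> (j i)) (\<phi> (j i)) \<le> C"
      by (subst form_extend[of ?T "S (j i)"]) (use S in auto)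
    \<comment> \<open>Four times the left side is at most C + 2\<delta> + C.\<close>
    ultimately have "hf ?T (\<psi> i) (\<psi> i) \<le> C / 2 + \<delta>" using j(2)[of i] \<delta> by linarith
    moreover have "\<And>x. x \<notin> ?T \<Longrightarrow> \<psi> i x = 0" using S(2) by (simp add: \<psi>_def)
    ultimately show "\<exists>S. finite S \<and> (\<forall>x. x \<notin> S \<longrightarrow> \<psi> i x = 0) \<and> hf S (\<psi> i) (\<psi> i) \<le> C / 2 + \<delta>"
      using S(1) by (intro exI[of _ ?T]) auto
  next
    fix i x show "0 \<le> \<psi> i x" "\<psi> i x \<le> u x"
      using bnd[of i x] bnd[of "j i" x] by (simp_all add: \<psi>_def)
  next
    fix x
    have "filterlim j at_top sequentially"
      using j(1) by (rule filterlim_at_top_mono[OF filterlim_ident always_eventually[OF allI]])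
    then have "(\<lambda>i. \<phi> (j i) x) \<longlonglongrightarrow> u x" using lim by (rule filterlim_compose[rotated])
    then have "(\<lambda>i. (\<phi> i x + \<phi> (j i) x) / 2) \<longlonglongrightarrow> (u x + u x) / 2"
      using lim by (intro tendsto_intros) auto
    then show "(\<lambda>i. \<psi> i x) \<longlonglongrightarrow> u x" by (simp add: \<psi>_def)
  qed
  then show ?thesis by blast
qed

text \<open>Halving with a small loss can be iterated, so one bound, however large, is as good as
  arbitrarily small ones.\<close>

lemma critical_if_bounded:
  assumes "null_seq C \<phi>" shows "critical \<sigma> w"
proof (rule critical_if_null_seqs)
  have mono: "null_seq a \<psi> \<Longrightarrow> a \<le> a' \<Longrightarrow> null_seq a' \<psi>" for a a' \<psi>
    unfolding null_seq_def by (meson order_trans)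
  \<comment> \<open>Positivity of D allows a quarter of the current bound as the loss in each
    halving; a half plus a quarter gives the factor 3/4.\<close>
  define D where "D = max C 1"
  have "\<exists>\<psi>. null_seq (D * (3/4)^n) \<psi>" for n
  proof (induction n)
    case 0
    show ?case using assms mono[of C \<phi> D] by (auto simp: D_def)
  next
    case (Suc n)
    then obtain \<psi> where "null_seq (D * (3/4)^n) \<psi>" by blast
    moreover have "0 < D * (3/4)^n / 4" by (simp add: D_def)
    ultimately obtain \<psi>' where "null_seq (D * (3/4)^n / 2 + D * (3/4)^n / 4) \<psi>'"
      using null_seq_halve by blast
    then show ?case by (auto simp: field_simps)
  qed
  moreover fix \<epsilon> :: real assume "0 < \<epsilon>"
  then have "\<exists>n. D * (3/4)^n < \<epsilon>"
  proof -
    have "(\<lambda>n. D * (3/4)^n) \<longlonglongrightarrow> D * 0" by (intro tendsto_intros LIMSEQ_power_zero) simp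
    then have "\<forall>\<^sub>F n in sequentially. D * (3/4)^n < \<epsilon>" using \<open>0 < \<epsilon>\<close> by (intro order_tendstoD) auto
    then show ?thesis by (auto simp: eventually_sequentially)
  qed
  ultimately show "\<exists>\<phi>. null_seq \<epsilon> \<phi>" using mono by (meson less_imp_le)
qed

section \<open>The form domain and minimisers\<close>

lemma D0_pointwise:
  assumes "(\<lambda>n. Qform \<sigma> (\<lambda>x. \<phi> n x - v x)) \<longlonglongrightarrow> 0" "(\<lambda>n. \<phi> n 0) \<longlonglongrightarrow> v (0 :: int ^ 'd)"
  shows "(\<lambda>n. \<phi> n x) \<longlonglongrightarrow> v x"
\<comment> \<open>Convergence at 0 is assumed, and the energy controls increments across every edge
  because the kernel is positive there; connectedness does the rest.\<close>
proof (induction x rule: lattice_induct)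
  case (2 x y)
  define d where "d n x = \<phi> n x - v x" for n x
  have "(\<lambda>n. ennreal (kappa \<sigma> (x - y) * (d n x - d n y)^2) / 2) \<longlonglongrightarrow> 0"
  proof (rule tendsto_sandwich[OF _ _ tendsto_const assms(1)])
    show "\<forall>\<^sub>F n in sequentially. ennreal (kappa \<sigma> (x - y) * (d n x - d n y)^2) / 2 \<le> Qform \<sigma> (\<lambda>x. \<phi> n x - v x)"
      unfolding Qform_eq_energy d_def by (intro always_eventually allI energy_ge)
  qed auto
  then have "(\<lambda>n. ennreal (kappa \<sigma> (x - y) * (d n x - d n y)^2 / 2)) \<longlonglongrightarrow> 0"
    using K_nonneg by (simp add: ennreal_divide_numeral)
  then have "(\<lambda>n. kappa \<sigma> (x - y) * (d n x - d n y)^2 / 2) \<longlonglongrightarrow> 0"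
    using K_nonneg by (subst (asm) ennreal_tendsto_0_iff) auto
  then have "(\<lambda>n. 2 / kappa \<sigma> (x - y) * (kappa \<sigma> (x - y) * (d n x - d n y)^2 / 2)) \<longlonglongrightarrow> 2 / kappa \<sigma> (x - y) * 0"
    by (intro tendsto_intros)
  then have "(\<lambda>n. (d n x - d n y)^2) \<longlonglongrightarrow> 0" using K_nbr[OF 2(1)] by simp
  then have "(\<lambda>n. d n x - d n y) \<longlonglongrightarrow> 0"
    using tendsto_real_sqrt[of "\<lambda>n. (d n x - d n y)^2" 0] by (simp add: tendsto_rabs_zero_iff)
  moreover have "(\<lambda>n. d n x) \<longlonglongrightarrow> 0" using 2(2) by (simp add: d_def LIM_zero)
  ultimately have "(\<lambda>n. d n x - (d n x - d n y)) \<longlonglongrightarrow> 0 - 0" by (intro tendsto_diff)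
  then show ?case by (simp add: d_def LIM_zero_iff)
qed (rule assms(2))

lemma D0_Qform_finite:
  fixes v :: "int ^ 'd \<Rightarrow> real"
  assumes "v \<in> D0 \<sigma>" shows "Qform \<sigma> v < \<top>"
proof -
  obtain \<phi> where \<phi>: "\<And>n. fin_supp (\<phi> n)" "(\<lambda>n. Qform \<sigma> (\<lambda>x. \<phi> n x - v x)) \<longlonglongrightarrow> 0"
    using assms by (auto simp: D0_def)
  have "\<forall>\<^sub>F n in sequentially. Qform \<sigma> (\<lambda>x. \<phi> n x - v x) < \<top>"
    using \<phi>(2) by (rule order_tendstoD) simp
  then obtain n where n: "Qform \<sigma> (\<lambda>x. \<phi> n x - v x) < \<top>" by (auto simp: eventually_sequentially)
  obtain S where "finite S" "\<And>x. x \<notin> S \<Longrightarrow> \<phi> n x = 0" using \<phi>(1) by (rule fin_supp_superset) blast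
  then have Qn: "Qform \<sigma> (\<phi> n) < \<top>" by (subst Qform_finite_support[of S]) auto
  have m: "Qform \<sigma> (\<lambda>x. v x - \<phi> n x) = Qform \<sigma> (\<lambda>x. \<phi> n x - v x)"
    unfolding Qform_eq_energy energy_def
    by (intro arg_cong[where f = "\<lambda>I. I / 2"] nn_integral_cong) (auto simp: power2_eq_square algebra_simps)
  have "Qform \<sigma> v = Qform \<sigma> (\<lambda>x. \<phi> n x + (v x - \<phi> n x))" by simp
  also have "\<dots> \<le> ennreal (1 + 1) * Qform \<sigma> (\<phi> n) + ennreal (1 + 1 / 1) * Qform \<sigma> (\<lambda>x. v x - \<phi> n x)"
    unfolding Qform_eq_energy by (rule energy_add_le) (rule K_nonneg, simp)
  also have "\<dots> < \<top>" using n Qn m by (simp add: ennreal_mult_less_top)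
  finally show ?thesis .
qed

text \<open>For the finitely supported approximants this is an equality. Fatou bounds both terms on
  the left, and the right side converges up to a factor 1 + \<epsilon> because the energy of the
  difference tends to 0.\<close>

lemma ground_state_D0:
  fixes v :: "int ^ 'd \<Rightarrow> real"
  assumes "v \<in> D0 \<sigma>"
  shows "energy (\<lambda>x y. u x * kappa \<sigma> (x - y) * u y) (\<lambda>x. v x / u x) + wsum w v \<le> Qform \<sigma> v"
proof (rule ennreal_le_of_le_one_plus)
  fix \<epsilon> :: real assume \<epsilon>: "0 < \<epsilon>"
  let ?b = "\<lambda>x y. u x * kappa \<sigma> (x - y) * u y"
  obtain \<phi> where \<phi>: "\<And>n. fin_supp (\<phi> n)" "(\<lambda>n. Qform \<sigma> (\<lambda>x. \<phi> n x - v x)) \<longlonglongrightarrow> 0" "(\<lambda>n. \<phi> n 0) \<longlonglongrightarrow> v 0"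
    using assms by (auto simp: D0_def)
  note lim = D0_pointwise[OF \<phi>(2,3)]
  have E: "energy ?b (\<lambda>x. v x / u x) \<le> liminf (\<lambda>n. energy ?b (\<lambda>x. \<phi> n x / u x))"
  proof (rule energy_Fatou)
    show "(\<lambda>n. \<phi> n x / u x) \<longlonglongrightarrow> v x / u x" for x
      using u_pos[of x] by (intro tendsto_intros lim) auto
    show "0 \<le> ?b x y" for x y using u_pos K_nonneg by (simp add: less_imp_le)
  qed
  have W: "wsum w v \<le> liminf (\<lambda>n. wsum w (\<phi> n))"
  proof -
    have "wsum w v = (\<integral>\<^sup>+x. liminf (\<lambda>n. ennreal (w x * (\<phi> n x)^2)) \<partial>count_space UNIV)"
      unfolding wsum_eq_nn_integral
      by (intro nn_integral_cong lim_imp_Liminf[symmetric] tendsto_ennrealI tendsto_intros lim) auto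
    also have "\<dots> \<le> liminf (\<lambda>n. wsum w (\<phi> n))"
      unfolding wsum_eq_nn_integral by (rule nn_integral_liminf) auto
    finally show ?thesis .
  qed
  have eq: "energy ?b (\<lambda>x. \<phi> n x / u x) + wsum w (\<phi> n) = Qform \<sigma> (\<phi> n)" for n
  proof -
    obtain S where S: "finite S" "\<And>x. x \<notin> S \<Longrightarrow> \<phi> n x = 0" using \<phi>(1) by (rule fin_supp_superset) blast
    have "Qform \<sigma> (\<phi> n) = ennreal (hf S (\<phi> n) (\<phi> n)) + wsum w (\<phi> n)" by (rule Qform_split) (use S in auto)
    moreover have "energy ?b (\<lambda>x. \<phi> n x / u x) = ennreal (hf S (\<phi> n) (\<phi> n))" by (rule ground_state(1)) (use S in auto)
    ultimately show ?thesis by simp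
  qed
  have le: "Qform \<sigma> (\<phi> n) \<le> ennreal (1 + \<epsilon>) * Qform \<sigma> v + ennreal (1 + 1 / \<epsilon>) * Qform \<sigma> (\<lambda>x. \<phi> n x - v x)" for n
    using energy_add_le[of "\<lambda>x y. kappa \<sigma> (x - y)" \<epsilon> v "\<lambda>x. \<phi> n x - v x"] \<epsilon> K_nonneg
    by (simp add: Qform_eq_energy)
  have "(\<lambda>n. ennreal (1 + 1 / \<epsilon>) * Qform \<sigma> (\<lambda>x. \<phi> n x - v x)) \<longlonglongrightarrow> ennreal (1 + 1 / \<epsilon>) * 0"
    by (rule ennreal_tendsto_cmult[OF _ \<phi>(2)]) simp
  then have "(\<lambda>n. ennreal (1 + \<epsilon>) * Qform \<sigma> v + ennreal (1 + 1 / \<epsilon>) * Qform \<sigma> (\<lambda>x. \<phi> n x - v x))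
      \<longlonglongrightarrow> ennreal (1 + \<epsilon>) * Qform \<sigma> v + 0"
    by (intro tendsto_add tendsto_const) simp
  then have L: "liminf (\<lambda>n. ennreal (1 + \<epsilon>) * Qform \<sigma> v + ennreal (1 + 1 / \<epsilon>) * Qform \<sigma> (\<lambda>x. \<phi> n x - v x))
      = ennreal (1 + \<epsilon>) * Qform \<sigma> v"
    by (simp add: lim_imp_Liminf)
  have "energy ?b (\<lambda>x. v x / u x) + wsum w v
      \<le> liminf (\<lambda>n. energy ?b (\<lambda>x. \<phi> n x / u x)) + liminf (\<lambda>n. wsum w (\<phi> n))"
    by (rule add_mono[OF E W])
  also have "\<dots> \<le> liminf (\<lambda>n. Qform \<sigma> (\<phi> n))"
    unfolding eq[symmetric] by (rule liminf_add_ennreal)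
  also have "\<dots> \<le> ennreal (1 + \<epsilon>) * Qform \<sigma> v"
  proof -
    have "liminf (\<lambda>n. Qform \<sigma> (\<phi> n)) \<le> liminf (\<lambda>n. ennreal (1 + \<epsilon>) * Qform \<sigma> v
        + ennreal (1 + 1 / \<epsilon>) * Qform \<sigma> (\<lambda>x. \<phi> n x - v x))"
      by (intro Liminf_mono always_eventually allI le)
    then show ?thesis by (simp only: L)
  qed
  finally show "energy ?b (\<lambda>x. v x / u x) + wsum w v \<le> ennreal (1 + \<epsilon>) * Qform \<sigma> v" .
qed

text \<open>A minimiser v has transformed energy 0, so v / u is constant across edges and v is a
  multiple of u; its weighted sum would be infinite, although v has finite energy.\<close>

lemma null_critical_if:
  assumes "critical \<sigma> w" "wsum w u = \<top>"
  shows "null_critical \<sigma> w"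
  unfolding null_critical_def positive_critical_def
proof (intro conjI notI assms(1))
  assume "critical \<sigma> w \<and> (\<exists>v\<in>D0 \<sigma>. v \<noteq> (\<lambda>_. 0) \<and> Qform \<sigma> v = wsum w v)"
  then obtain v where v: "v \<in> D0 \<sigma>" "v \<noteq> (\<lambda>_. 0)" "Qform \<sigma> v = wsum w v" by blast
  let ?b = "\<lambda>x y. u x * kappa \<sigma> (x - y) * u y"
  \<comment> \<open>Finiteness is what permits cancelling the weighted sum below.\<close>
  have fin: "wsum w v < \<top>" using D0_Qform_finite[OF v(1)] v(3) by simp
  have "wsum w v + energy ?b (\<lambda>x. v x / u x) \<le> wsum w v + 0"
    using ground_state_D0[OF v(1)] unfolding v(3) by (subst add.commute) (simp only: add_0_right)
  then have E0: "energy ?b (\<lambda>x. v x / u x) = 0"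
    using fin unfolding ennreal_add_left_cancel_le by auto
  define c where "c = v 0 / u 0"
  have "v x / u x = c" for x
  proof (induction x rule: lattice_induct)
    case (2 x y)
    have "0 < ?b x y" using K_nbr[OF 2(1)] u_pos by simp
    then show ?case using energy_eq_0_imp[OF E0] 2(2) by simp
  qed (simp add: c_def)
  then have vu: "v x = c * u x" for x using u_pos[of x] by (metis less_irrefl nonzero_mult_div_cancel_right times_divide_eq_left)
  with v(2) have "c \<noteq> 0" by auto
  have "wsum w v = (\<integral>\<^sup>+x. ennreal (c^2) * ennreal (w x * (u x)^2) \<partial>count_space UNIV)"
    unfolding wsum_eq_nn_integral vu
    by (intro nn_integral_cong) (simp add: ennreal_mult[symmetric] w_nonneg power_mult_distrib mult_ac)
  also have "\<dots> = ennreal (c^2) * wsum w u"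
    unfolding wsum_eq_nn_integral by (simp add: nn_integral_cmult)
  also have "\<dots> = \<top>" using assms(2) \<open>c \<noteq> 0\<close> by (simp add: ennreal_mult_top)
  finally show False using fin by simp
qed

text \<open>Deficits tend to 0 and weighted sums converge by domination with w u^2, so the test
  functions converge to u in the form norm. Hence u lies in the form domain and attains
  equality.\<close>

lemma positive_critical_if:
  assumes fin: "wsum w u < \<top>" and e: "e \<longlonglongrightarrow> 0"
    and S: "\<And>n. finite (S n)" "\<And>n x. x \<notin> S n \<Longrightarrow> \<phi> n x = 0" "\<And>n. hf (S n) (\<phi> n) (\<phi> n) \<le> e n"
    and bnd: "\<And>n x. 0 \<le> \<phi> n x" "\<And>n x. \<phi> n x \<le> u x" and lim: "\<And>x. (\<lambda>n. \<phi> n x) \<longlonglongrightarrow> u x"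
  shows "positive_critical \<sigma> w"
proof -
  have e0: "0 \<le> e n" for n using ground_state(2)[of "S n" "\<phi> n"] S by (meson order_trans)
  obtain C where C: "\<And>n. e n \<le> C"
    using convergent_imp_Bseq[OF convergentI[OF e]] by (auto simp: Bseq_def intro: order_trans[OF abs_ge_self])
  have "null_seq C \<phi>"
    unfolding null_seq_def using S bnd lim C by (meson order_trans)
  then have crit: "critical \<sigma> w" by (rule critical_if_bounded)
  have conv: "(\<lambda>n. wsum w (\<lambda>x. a n x)) \<longlonglongrightarrow> wsum w (\<lambda>x. a' x)"
    if "\<And>n x. \<bar>a n x\<bar> \<le> u x" "\<And>x. (\<lambda>n. a n x) \<longlonglongrightarrow> a' x" for a a'
    unfolding wsum_eq_nn_integral
  proof (rule nn_integral_dominated_convergence[where w = "\<lambda>x. ennreal (w x * (u x)^2)"])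
    show "(\<integral>\<^sup>+x. ennreal (w x * (u x)^2) \<partial>count_space UNIV) < \<infinity>"
      using fin by (simp add: wsum_eq_nn_integral)
    show "AE x in count_space UNIV. ennreal (w x * (a n x)^2) \<le> ennreal (w x * (u x)^2)" for n
      using that(1) w_nonneg by (auto intro!: AE_I2 ennreal_leI mult_left_mono simp: abs_le_square_iff[symmetric])
        (metis abs_of_pos u_pos)
    show "AE x in count_space UNIV. (\<lambda>n. ennreal (w x * (a n x)^2)) \<longlonglongrightarrow> ennreal (w x * (a' x)^2)"
      by (intro AE_I2 tendsto_intros tendsto_ennrealI that(2))
  qed auto
  \<comment> \<open>The split of the form needs finite support, so it is applied to \<phi> n -
    \<phi> m, and then m tends to infinity.\<close>
  have diff: "Qform \<sigma> (\<lambda>x. \<phi> n x - u x) \<le> ennreal (2 * e n) + wsum w (\<lambda>x. \<phi> n x - u x)" for n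
  proof -
    have Q: "Qform \<sigma> (\<lambda>x. \<phi> n x - \<phi> m x) \<le> ennreal (2 * e n + 2 * e m) + wsum w (\<lambda>x. \<phi> n x - \<phi> m x)" for m
    proof -
      let ?T = "S n \<union> S m"
      have "hf ?T (\<lambda>x. \<phi> n x - \<phi> m x) (\<lambda>x. \<phi> n x - \<phi> m x) + hf ?T (\<lambda>x. \<phi> n x + \<phi> m x) (\<lambda>x. \<phi> n x + \<phi> m x)
        = 2 * hf ?T (\<phi> n) (\<phi> n) + 2 * hf ?T (\<phi> m) (\<phi> m)"
        using form_quadratic[of "\<lambda>x y. kappa \<sigma> (x - y)" "\<lambda>x. k - w x" ?T, OF K_sym', of "\<phi> n" 1 "\<phi> m"]
          form_quadratic[of "\<lambda>x y. kappa \<sigma> (x - y)" "\<lambda>x. k - w x" ?T, OF K_sym', of "\<phi> n" "-1" "\<phi> m"] by simp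
      moreover have "0 \<le> hf ?T (\<lambda>x. \<phi> n x + \<phi> m x) (\<lambda>x. \<phi> n x + \<phi> m x)"
        by (rule ground_state(2)) (use S in auto)
      moreover have "hf ?T (\<phi> n) (\<phi> n) \<le> e n"
        by (subst form_extend[of ?T "S n"]) (use S in auto)
      moreover have "hf ?T (\<phi> m) (\<phi> m) \<le> e m"
        by (subst form_extend[of ?T "S m"]) (use S in auto)
      ultimately have "hf ?T (\<lambda>x. \<phi> n x - \<phi> m x) (\<lambda>x. \<phi> n x - \<phi> m x) \<le> 2 * e n + 2 * e m" by linarith
      then show ?thesis
        using S by (subst Qform_split[of ?T]) (auto intro!: add_right_mono ennreal_leI)
    qed
    have "Qform \<sigma> (\<lambda>x. \<phi> n x - u x) \<le> liminf (\<lambda>m. Qform \<sigma> (\<lambda>x. \<phi> n x - \<phi> m x))"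
      unfolding Qform_eq_energy by (rule energy_Fatou) (auto intro!: tendsto_intros lim K_nonneg)
    also have "\<dots> \<le> liminf (\<lambda>m. ennreal (2 * e n + 2 * e m) + wsum w (\<lambda>x. \<phi> n x - \<phi> m x))"
      by (intro Liminf_mono always_eventually allI Q)
    also have "\<dots> = ennreal (2 * e n + 2 * 0) + wsum w (\<lambda>x. \<phi> n x - u x)"
    proof (intro lim_imp_Liminf tendsto_add tendsto_ennrealI tendsto_intros e conv lim)
      show "\<bar>\<phi> n x - \<phi> m x\<bar> \<le> u x" for m x using bnd[of n x] bnd[of m x] by (simp add: abs_if)
    qed simp
    finally show ?thesis by simp
  qed
  have Q0: "(\<lambda>n. Qform \<sigma> (\<lambda>x. \<phi> n x - u x)) \<longlonglongrightarrow> 0"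
  proof (rule tendsto_sandwich[OF _ _ tendsto_const])
    have "(\<lambda>n. ennreal (2 * e n) + wsum w (\<lambda>x. \<phi> n x - u x)) \<longlonglongrightarrow> ennreal (2 * 0) + wsum w (\<lambda>x. u x - u x)"
    proof (intro tendsto_add tendsto_ennrealI tendsto_intros e conv lim)
      show "\<bar>\<phi> n x - u x\<bar> \<le> u x" for n x using bnd[of n x] by (simp add: abs_if)
    qed
    then show "(\<lambda>n. ennreal (2 * e n) + wsum w (\<lambda>x. \<phi> n x - u x)) \<longlonglongrightarrow> 0"
      by (simp add: wsum_def)
  qed (auto intro!: always_eventually diff)
  have "fin_supp (\<phi> n)" for n
    unfolding fin_supp_def by (rule finite_subset[OF _ S(1)[of n]]) (use S(2) in blast)
  then have D: "u \<in> D0 \<sigma>" unfolding D0_def using Q0 lim[of 0] by blast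
  have "Qform \<sigma> u \<le> wsum w u"
  proof -
    have "Qform \<sigma> u \<le> liminf (\<lambda>n. Qform \<sigma> (\<phi> n))"
      unfolding Qform_eq_energy by (rule energy_Fatou) (auto intro!: lim K_nonneg)
    also have "\<dots> \<le> liminf (\<lambda>n. ennreal (e n) + wsum w (\<phi> n))"
      by (intro Liminf_mono always_eventually allI) (subst Qform_split, rule S, erule S, intro add_right_mono ennreal_leI S(3))
    also have "\<dots> = ennreal 0 + wsum w u"
      by (intro lim_imp_Liminf tendsto_add tendsto_ennrealI e conv lim) (use bnd in auto)
    finally show ?thesis by simp
  qed
  moreover have "wsum w u \<le> Qform \<sigma> u"
    by (rule order_trans[OF add_increasing ground_state_D0[OF D]]) simp_all
  moreover have "u \<noteq> (\<lambda>_. 0)" using u_pos[of 0] by auto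
  ultimately show ?thesis using crit D unfolding positive_critical_def by (auto intro!: bexI[of _ u])
qed

end

text \<open>The minimum of \<open>s\<close> and a multiple of \<open>u\<close> is a supersolution everywhere, and the geometric mean
  of two non-proportional supersolutions is a strict one.\<close>

lemma (in hardy_pair) subcritical_if:
  assumes s_pos: "\<And>x. 0 < s x"
    and s_eqn: "\<And>x. ((\<lambda>y. kappa \<sigma> (x - y) * s y) has_sum (k - ws x) * s x) UNIV"
    and fin: "finite {x. ws x < w x}"
    and small: "\<And>c. 0 < c \<Longrightarrow> \<exists>x. s x < c * u x"
  shows "subcritical \<sigma> w"
proof -
  \<comment> \<open>The point 0 makes A nonempty, so that \<open>Min\<close> is meaningful, and
    later serves as the base point where t = c u.\<close>
  define A where "A = insert 0 {x. ws x < w x}"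
  have A: "finite A" "A \<noteq> {}" using fin by (auto simp: A_def)
  \<comment> \<open>With this c the minimum t equals c u on A, that is, wherever s may fail to be a
    supersolution for w.\<close>
  define c where "c = Min ((\<lambda>x. s x / u x) ` A)"
  have c: "0 < c" "\<And>x. x \<in> A \<Longrightarrow> c * u x \<le> s x"
  proof -
    show "0 < c" unfolding c_def using A s_pos u_pos by (subst Min_gr_iff) auto
    fix x assume "x \<in> A"
    then have "c \<le> s x / u x" unfolding c_def using A by (intro Min_le) auto
    then show "c * u x \<le> s x" using u_pos[of x] by (simp add: field_simps)
  qed
  define t where "t x = min (s x) (c * u x)" for x
  define g where "g x = sqrt (u x * t x)" for x
  have t_pos: "0 < t x" for x using s_pos u_pos c by (simp add: t_def)
  have g_pos: "0 < g x" for x using t_pos u_pos by (simp add: g_def)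
  have K: "0 \<le> kappa \<sigma> (x - y)" for x y :: "int ^ 'd" by (rule K_nonneg)
  have summ_u: "(\<lambda>y. kappa \<sigma> (x - y) * u y) summable_on UNIV" for x
    using eqn[of x] by (rule has_sum_imp_summable)
  have summ: "(\<lambda>y. kappa \<sigma> (x - y) * f y) summable_on UNIV" if "\<And>y. 0 \<le> f y" "\<And>y. f y \<le> a * u y" for f a x
  proof (rule summable_on_comparison_test)
    show "(\<lambda>y. a * (kappa \<sigma> (x - y) * u y)) summable_on UNIV"
      by (intro summable_on_cmult_right summ_u)
    show "kappa \<sigma> (x - y) * f y \<le> a * (kappa \<sigma> (x - y) * u y)" for y
      using mult_left_mono[OF that(2)[of y] K[of x y]] by (simp add: mult_ac)
  qed (use K that in simp)
  have summ_t: "(\<lambda>y. kappa \<sigma> (x - y) * t y) summable_on UNIV" for x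
    by (rule summ[where a = c]) (use t_pos in \<open>auto simp: t_def less_imp_le\<close>)
  have g_le: "g y \<le> sqrt c * u y" for y
  proof -
    have "u y * t y \<le> u y * (c * u y)" using u_pos[of y] by (intro mult_left_mono) (auto simp: t_def)
    then have "g y \<le> sqrt (c * (u y)^2)" unfolding g_def by (intro real_sqrt_le_mono) (simp add: power2_eq_square mult_ac)
    then show ?thesis using u_pos[of y] by (simp add: real_sqrt_mult)
  qed
  have summ_g: "(\<lambda>y. kappa \<sigma> (x - y) * g y) summable_on UNIV" for x
    by (rule summ[where a = "sqrt c"]) (use g_pos g_le in \<open>auto simp: less_imp_le\<close>)
  define N where "N x = (\<Sum>\<^sub>\<infinity>y. kappa \<sigma> (x - y) * g y)" for x
  \<comment> \<open>Of s and c u, the one that agrees with t at x satisfies the inequality there and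
    dominates t elsewhere, so passing to t only lowers the convolution.\<close>
  have sup_t: "(\<Sum>\<^sub>\<infinity>y. kappa \<sigma> (x - y) * t y) \<le> (k - w x) * t x" for x
  proof (cases "t x = s x \<and> x \<notin> A")
    case True
    have "(\<Sum>\<^sub>\<infinity>y. kappa \<sigma> (x - y) * t y) \<le> (\<Sum>\<^sub>\<infinity>y. kappa \<sigma> (x - y) * s y)"
      by (intro infsum_mono summ_t mult_left_mono K has_sum_imp_summable[OF s_eqn]) (simp add: t_def)
    also have "\<dots> = (k - ws x) * s x" using s_eqn by (rule infsumI)
    also have "\<dots> \<le> (k - w x) * s x"
      using True s_pos[of x] by (intro mult_right_mono) (auto simp: A_def)
    finally show ?thesis using True by simp
  next
    case False
    then have tx: "t x = c * u x" using c(2)[of x] by (auto simp: t_def min_def)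
    have "(\<Sum>\<^sub>\<infinity>y. kappa \<sigma> (x - y) * t y) \<le> (\<Sum>\<^sub>\<infinity>y. c * (kappa \<sigma> (x - y) * u y))"
    proof (intro infsum_mono summ_t summable_on_cmult_right summ_u)
      show "kappa \<sigma> (x - y) * t y \<le> c * (kappa \<sigma> (x - y) * u y)" for y
        using mult_left_mono[of "t y" "c * u y", OF _ K[of x y]] by (simp add: t_def mult_ac)
    qed
    also have "\<dots> = c * ((k - w x) * u x)" using eqn by (intro infsumI has_sum_cmult_right)
    finally show ?thesis using tx by (simp only: mult.left_commute)
  qed
  \<comment> \<open>The inequality of the means as an identity, sqrt (a b) = (a + b)/2 - (sqrt a -
    sqrt b)^2 / 2 with a = u y / u x and b = t y / t x. The square is the source of
    strictness.\<close>
  have point: "g y = g x / 2 * (u y / u x) + g x / (2 * t x) * t y - g x / 2 * (sqrt (u y / u x) - sqrt (t y / t x))^2" for x y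
  proof -
    have "g y = g x * (sqrt (u y / u x) * sqrt (t y / t x))"
      using u_pos t_pos by (simp add: g_def real_sqrt_mult real_sqrt_divide less_imp_neq[THEN not_sym] less_imp_le)
    moreover have "(sqrt (u y / u x))^2 = u y / u x" "(sqrt (t y / t x))^2 = t y / t x"
      using u_pos t_pos by (simp_all add: less_imp_le)
    ultimately show ?thesis by (simp add: power2_diff field_simps)
  qed
  define D where "D x y = g x / 2 * (sqrt (u y / u x) - sqrt (t y / t x))^2" for x y
  have D0: "0 \<le> D x y" for x y using g_pos[of x] by (simp add: D_def)
  have point': "kappa \<sigma> (x - y) * g y + kappa \<sigma> (x - y) * D x y =
      g x / (2 * u x) * (kappa \<sigma> (x - y) * u y) + g x / (2 * t x) * (kappa \<sigma> (x - y) * t y)" for x y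
    using arg_cong[OF point[of y x], of "\<lambda>r. kappa \<sigma> (x - y) * r"] unfolding D_def
    by (simp add: ring_distribs mult_ac)
  \<comment> \<open>It suffices to retain the gain at a single point z.\<close>
  have bound: "N x + kappa \<sigma> (x - z) * D x z \<le> (k - w x) * g x" for x z
  proof -
    have sumR: "(\<lambda>y. g x / (2 * u x) * (kappa \<sigma> (x - y) * u y) + g x / (2 * t x) * (kappa \<sigma> (x - y) * t y)) summable_on UNIV"
      by (intro summable_on_add summable_on_cmult_right summ_u summ_t)
    have "((\<lambda>y. if y = z then kappa \<sigma> (x - y) * D x y else 0) has_sum kappa \<sigma> (x - z) * D x z) UNIV"
      using has_sum_finite_neutralI[of "{z}" UNIV "\<lambda>y. if y = z then kappa \<sigma> (x - y) * D x y else 0"] by simp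
    then have "((\<lambda>y. kappa \<sigma> (x - y) * g y + (if y = z then kappa \<sigma> (x - y) * D x y else 0)) has_sum N x + kappa \<sigma> (x - z) * D x z) UNIV"
      unfolding N_def using summ_g by (intro has_sum_add has_sum_infsum)
    then have "N x + kappa \<sigma> (x - z) * D x z \<le> (\<Sum>\<^sub>\<infinity>y. g x / (2 * u x) * (kappa \<sigma> (x - y) * u y) + g x / (2 * t x) * (kappa \<sigma> (x - y) * t y))"
    proof (rule has_sum_mono[OF _ has_sum_infsum[OF sumR]])
      show "kappa \<sigma> (x - y) * g y + (if y = z then kappa \<sigma> (x - y) * D x y else 0)
        \<le> g x / (2 * u x) * (kappa \<sigma> (x - y) * u y) + g x / (2 * t x) * (kappa \<sigma> (x - y) * t y)" for y
        unfolding point'[symmetric] using K[of x y] D0[of x y] by simp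
    qed
    also have "\<dots> = g x / (2 * u x) * (\<Sum>\<^sub>\<infinity>y. kappa \<sigma> (x - y) * u y) + g x / (2 * t x) * (\<Sum>\<^sub>\<infinity>y. kappa \<sigma> (x - y) * t y)"
      by (intro infsumI has_sum_add has_sum_cmult_right has_sum_infsum summ_u summ_t)
    also have "\<dots> \<le> g x / (2 * u x) * ((k - w x) * u x) + g x / (2 * t x) * ((k - w x) * t x)"
      using g_pos[of x] t_pos[of x] u_pos[of x] sup_t[of x] infsumI[OF eqn[of x]]
      by (intro add_mono mult_left_mono) (auto simp: less_imp_le)
    also have "\<dots> = (k - w x) * g x" using u_pos[of x] t_pos[of x] by (simp add: field_simps)
    finally show ?thesis .
  qed
  \<comment> \<open>Otherwise t / u would be constant with its value c at 0, whereas s < c u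
    somewhere by \<open>small\<close>.\<close>
  obtain x1 y1 where xy: "lnorm (x1 - y1) = 1" "t x1 / u x1 \<noteq> t y1 / u y1"
  proof (rule ccontr)
    assume "\<not> thesis"
    then have all: "\<And>x y. lnorm (x - y) = 1 \<Longrightarrow> t x / u x = t y / u y" using that by blast
    have "t x / u x = c" for x
    proof (induction x rule: lattice_induct)
      case 1 show ?case using c(2)[of 0] u_pos[of 0] by (simp add: t_def A_def)
    qed (use all in metis)
    moreover obtain x where "s x < c * u x" using small[OF c(1)] by blast
    then have "t x / u x < c" using u_pos[of x] by (simp add: t_def field_simps)
    ultimately show False by (metis less_irrefl)
  qed
  have "D x1 y1 \<noteq> 0"
  proof
    assume "D x1 y1 = 0"
    then have "u y1 / u x1 = t y1 / t x1" using g_pos[of x1] by (simp add: D_def)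
    then show False using xy(2) u_pos[of x1] u_pos[of y1] t_pos[of x1] by (simp add: field_simps)
  qed
  then have \<eta>: "0 < kappa \<sigma> (x1 - y1) * D x1 y1" using D0[of x1 y1] K_nbr[OF xy(1)] by simp
  \<comment> \<open>The weight for which g solves the equation exactly, so that g and w1 form a pair
    of the same kind and w1 is a Hardy weight.\<close>
  define w1 where "w1 x = k - N x / g x" for x
  have w1: "w x \<le> w1 x" for x
  proof -
    have "N x \<le> (k - w x) * g x" using bound[of x x] K[of x x] D0[of x x] by (meson add_increasing2 mult_nonneg_nonneg order_refl order_trans)
    then show ?thesis using g_pos[of x] by (simp add: w1_def field_simps)
  qed
  interpret g: hardy_pair \<sigma> k g w1
  proof
    show "((\<lambda>y. kappa \<sigma> (x - y) * g y) has_sum (k - w1 x) * g x) UNIV" for x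
      using has_sum_infsum[OF summ_g[of x]] g_pos[of x] by (simp add: w1_def N_def)
  qed (use K_nonneg K_sym K_sum K_nbr g_pos w_nonneg w1 order_trans in blast)+
  have "N x1 < (k - w x1) * g x1" using bound[of x1 y1] \<eta> by linarith
  then have "w x1 < w1 x1" using g_pos[of x1] by (simp add: w1_def field_simps)
  then have "w1 \<noteq> w" by auto
  then show ?thesis
    unfolding subcritical_def using hardy g.hardy w1 by blast
qed

section \<open>The heat kernel\<close>

lemma lnorm_eq_1_iff: "lnorm (z :: int ^ 'd::finite) = 1 \<longleftrightarrow> (\<exists>i. z = axis i 1 \<or> z = - axis i 1)"
proof
  assume "lnorm z = 1"
  then have "(\<Sum>i\<in>UNIV. (real_of_int (z $ i))^2) = 1" by (simp add: lnorm_def)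
  then have "real_of_int (\<Sum>i\<in>UNIV. (z $ i)^2) = 1" by simp
  then have s: "(\<Sum>i\<in>UNIV. (z $ i)^2) = 1" by linarith
  then obtain i where i: "z $ i \<noteq> 0" by (metis (no_types, lifting) sum.neutral power2_eq_square mult_zero_left zero_neq_one)
  have "(z $ i)^2 + (\<Sum>j\<in>UNIV - {i}. (z $ j)^2) = 1" using s by (simp add: sum.remove[of UNIV i])
  moreover have "0 \<le> (\<Sum>j\<in>UNIV - {i}. (z $ j)^2)" by (intro sum_nonneg) auto
  moreover have "0 < (z $ i)^2" using i by simp
  ultimately have zi: "(z $ i)^2 = 1" and r: "(\<Sum>j\<in>UNIV - {i}. (z $ j)^2) = 0" by linarith+
  have "z $ j = 0" if "j \<noteq> i" for j
    using r that by (subst (asm) sum_nonneg_eq_0_iff) auto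
  moreover have "z $ i = 1 \<or> z $ i = -1" using zi by (simp add: power2_eq_1_iff)
  ultimately show "\<exists>i. z = axis i 1 \<or> z = - axis i 1"
    by (intro exI[of _ i]) (auto simp: vec_eq_iff axis_def)
qed (use lnorm_axis in auto)

lemma neighbours_eq:
  fixes x :: "int ^ 'd::finite"
  shows "{y. lnorm (y - x) = 1} = (\<Union>i. {x + axis i 1, x - axis i 1})"
proof -
  have "y - x = axis i 1 \<longleftrightarrow> y = x + axis i 1" "y - x = - axis i 1 \<longleftrightarrow> y = x - axis i 1" for y i
    by (auto simp: algebra_simps)
  then show ?thesis unfolding lnorm_eq_1_iff by auto
qed

lemma sum_neighbours:
  fixes x :: "int ^ 'd::finite" and f :: "int ^ 'd \<Rightarrow> real"
  shows "(\<Sum>y\<in>{y. lnorm (y - x) = 1}. f y) = (\<Sum>i\<in>UNIV. f (x + axis i 1) + f (x - axis i 1))"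
proof -
  let ?p = "\<lambda>i. x + axis i 1" and ?m = "\<lambda>i. x - axis i 1"
  have ax: "axis i 1 = (axis j 1 :: int ^ 'd) \<longleftrightarrow> i = j" for i j by (auto simp: axis_eq_axis)
  have "{y. lnorm (y - x) = 1} = range ?p \<union> range ?m"
    unfolding neighbours_eq by auto
  moreover have "range ?p \<inter> range ?m = {}"
  proof -
    have "x + axis i 1 \<noteq> x - axis j 1" for i j
    proof
      assume "x + axis i 1 = x - axis j 1"
      then have "(x + axis i 1) $ i = (x - axis j 1) $ i" by simp
      then show False by (auto simp: axis_def split: if_splits)
    qed
    then show ?thesis by auto
  qed
  moreover have "inj ?p" "inj ?m" by (auto simp: inj_on_def ax)
  ultimately show ?thesis
    by (simp add: sum.union_disjoint sum.reindex sum.distrib o_def)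
qed

lemma finite_neighbours: "finite {y. lnorm (y - x :: int ^ 'd::finite) = 1}"
  unfolding neighbours_eq by auto

lemma card_neighbours: "card {y. lnorm (y - x :: int ^ 'd::finite) = 1} = 2 * CARD('d)"
  using sum_neighbours[of "\<lambda>_. 1" x] by simp

lemma walks_nonneg: "0 \<le> walks n (x :: int ^ 'd::finite)"
  by (induction n arbitrary: x) (auto intro: sum_nonneg)

lemma walks_pos_ex: "\<exists>n. 0 < walks n (x :: int ^ 'd::finite)"
proof (induction x rule: lattice_induct)
  case 1
  have "0 < walks 0 (0 :: int ^ 'd)" by simp
  then show ?case by blast
next
  case (2 x y)
  then obtain n where "0 < walks n x" by blast
  also have "walks n x \<le> walks (Suc n) y"
    using 2(1) by (auto intro!: member_le_sum finite_neighbours walks_nonneg)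
  finally show ?case by blast
qed

text \<open>Walk expansion of a bounded solution of \<open>\<partial>\<^sub>t F = A F\<close>, by Taylor's theorem around time \<open>s\<close>.\<close>

fun iterated_sum :: "(int ^ 'd::finite \<Rightarrow> real) \<Rightarrow> nat \<Rightarrow> int ^ 'd \<Rightarrow> real" where
  "iterated_sum g 0 x = g x"
| "iterated_sum g (Suc n) x = (\<Sum>y\<in>{y. lnorm (y - x) = 1}. iterated_sum g n y)"

lemma iterated_sum_delta: "iterated_sum (\<lambda>x. if x = 0 then 1 else 0) n x = walks n x"
  by (induction n arbitrary: x) auto

lemma iterated_sum_bound:
  fixes g :: "int ^ 'd::finite \<Rightarrow> real"
  assumes "\<And>x. \<bar>g x\<bar> \<le> M"
  shows "\<bar>iterated_sum g n x\<bar> \<le> (2 * real CARD('d))^n * M"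
proof (induction n arbitrary: x)
  case (Suc n)
  have "\<bar>iterated_sum g (Suc n) x\<bar> \<le> (\<Sum>y\<in>{y. lnorm (y - x) = 1}. \<bar>iterated_sum g n y\<bar>)"
    by (simp add: sum_abs)
  also have "\<dots> \<le> (\<Sum>y\<in>{y. lnorm (y - x) = 1}. (2 * real CARD('d))^n * M)"
    by (intro sum_mono Suc.IH)
  also have "\<dots> = (2 * real CARD('d))^Suc n * M" by (simp add: card_neighbours)
  finally show ?case .
qed (simp add: assms)

text \<open>The n-th time derivative is A^n F, bounded by (2d)^n M between s and s + t, so the
  Lagrange remainder is at most M times a term of an exponential series. A general base point s is
  needed for the semigroup law.\<close>

lemma adjacency_flow_sums:
  fixes F :: "real \<Rightarrow> int ^ 'd::finite \<Rightarrow> real"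
  assumes deriv: "\<And>t x. ((\<lambda>t. F t x) has_real_derivative (\<Sum>y\<in>{y. lnorm (y - x) = 1}. F t y)) (at t)"
    and bound: "\<And>t x. \<bar>F t x\<bar> \<le> B \<bar>t\<bar>" and B: "mono B"
  shows "(\<lambda>n. iterated_sum (F s) n x * t ^ n / fact n) sums F (s + t) x"
proof -
  define diff where "diff n r = iterated_sum (F (s + r)) n x" for n r
  have "((\<lambda>r. iterated_sum (F (s + r)) n x) has_real_derivative iterated_sum (F (s + r)) (Suc n) x) (at r)" for n r x
  proof (induction n arbitrary: x)
    case 0
    show ?case using DERIV_at_within_shift[of "\<lambda>t. F t x" _ s r UNIV] deriv[of x "s + r"] by (simp add: add.commute)
  next
    case (Suc n)
    show ?case
      unfolding iterated_sum.simps(2) by (intro DERIV_sum) (use Suc.IH in simp)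
  qed
  then have D: "\<forall>m r. DERIV (diff m) r :> diff (Suc m) r"
    unfolding diff_def by blast
  define M where "M = B (\<bar>s\<bar> + \<bar>t\<bar>)"
  have Mb: "\<bar>F (s + r) y\<bar> \<le> M" if "\<bar>r\<bar> \<le> \<bar>t\<bar>" for r y
    using bound[of "s + r" y] monoD[OF B, of "\<bar>s + r\<bar>" "\<bar>s\<bar> + \<bar>t\<bar>"] that unfolding M_def by linarith
  have rem: "\<bar>F (s + t) x - (\<Sum>m<n. iterated_sum (F s) m x * t^m / fact m)\<bar> \<le> M * ((2 * real CARD('d) * \<bar>t\<bar>)^n / fact n)" for n
  proof -
    obtain r where r: "\<bar>r\<bar> \<le> \<bar>t\<bar>" and
      eq: "F (s + t) x = (\<Sum>m<n. (diff m 0 / fact m) * t ^ m) + (diff n r / fact n) * t ^ n"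
      using Maclaurin_all_le[of diff "\<lambda>r. F (s + r) x" t n, OF _ D] by (auto simp: diff_def fun_eq_iff)
    have "\<bar>diff n r / fact n * t ^ n\<bar> = \<bar>diff n r\<bar> * \<bar>t\<bar>^n / fact n" by (simp add: abs_mult power_abs)
    also have "\<dots> \<le> (2 * real CARD('d))^n * M * \<bar>t\<bar>^n / fact n"
      unfolding diff_def by (intro divide_right_mono mult_right_mono iterated_sum_bound Mb r) auto
    finally show ?thesis unfolding eq by (simp add: diff_def power_mult_distrib mult_ac)
  qed
  have L: "(\<lambda>n. M * ((2 * real CARD('d) * \<bar>t\<bar>)^n / fact n)) \<longlonglongrightarrow> M * 0"
    by (intro tendsto_intros) (use summable_LIMSEQ_zero[OF summable_exp] in \<open>simp add: divide_inverse mult.commute\<close>)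
  have "(\<lambda>n. F (s + t) x - (\<Sum>m<n. iterated_sum (F s) m x * t^m / fact m)) \<longlonglongrightarrow> 0"
  proof (rule Lim_null_comparison[OF always_eventually[OF allI]])
    show "norm (F (s + t) x - (\<Sum>m<n. iterated_sum (F s) m x * t^m / fact m)) \<le> M * ((2 * real CARD('d) * \<bar>t\<bar>)^n / fact n)" for n
      unfolding real_norm_def by (rule rem)
    show "(\<lambda>n. M * ((2 * real CARD('d) * \<bar>t\<bar>)^n / fact n)) \<longlonglongrightarrow> 0" using L by simp
  qed
  then have "(\<lambda>n. F (s + t) x - (F (s + t) x - (\<Sum>m<n. iterated_sum (F s) m x * t^m / fact m))) \<longlonglongrightarrow> F (s + t) x - 0"
    by (intro tendsto_intros)
  then show ?thesis by (simp add: sums_def)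
qed

section \<open>Fourier representation of the heat kernel\<close>

lemma one_minus_cos_ge:
  assumes "\<bar>\<theta>\<bar> \<le> pi" shows "\<theta>^2 / 18 \<le> 1 - cos \<theta>"
proof -
  \<comment> \<open>Use 1 - cos \<theta> = 2 (sin y)^2. As y \<le> 2, sin y \<ge> y - y^3/6 \<ge>
    y/3, and 2 (\<theta>/6)^2 = \<theta>^2/18.\<close>
  define y where "y = \<bar>\<theta>\<bar> / 2"
  have y: "0 \<le> y" "y \<le> 2" using assms pi_less_4 by (auto simp: y_def)
  have "\<bar>sin y - (\<Sum>m<3. sin_coeff m * y ^ m)\<bar> \<le> inverse (fact 3) * \<bar>y\<bar> ^ 3"
    by (rule Maclaurin_sin_bound)
  moreover have "(\<Sum>m<3. sin_coeff m * y ^ m) = y"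
    by (simp add: numeral_3_eq_3 sin_coeff_def)
  moreover have "inverse (fact 3) * \<bar>y\<bar>^3 = y^3 / 6"
    using y by (simp add: fact_numeral)
  ultimately have "y - y^3 / 6 \<le> sin y" by linarith
  moreover have "y * y^2 \<le> y * 2^2" using y by (intro mult_left_mono power_mono) auto
  then have "y / 3 \<le> y - y^3 / 6" by (simp add: power3_eq_cube power2_eq_square)
  ultimately have "y / 3 \<le> sin y" by linarith
  then have "(y / 3)^2 \<le> (sin y)^2" using y by (intro power_mono) auto
  moreover have "1 - cos (2 * y) = 2 * (sin y)^2" by (simp add: cos_double_sin)
  moreover have "cos (2 * y) = cos \<theta>" by (simp add: y_def)
  moreover have "y^2 = \<theta>^2 / 4" by (simp add: y_def power_divide)
  ultimately show ?thesis by (simp add: power_divide)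
qed

text \<open>The heat kernel of the integers as a Fourier coefficient: 2 (1 - cos \<theta>) is the
  symbol of the Laplacian, and evenness leaves only the cosine.\<close>

definition heat1 :: "real \<Rightarrow> int \<Rightarrow> real" where
  "heat1 t k = integral {-pi..pi} (\<lambda>\<theta>. exp (- 2 * t * (1 - cos \<theta>)) * cos (real_of_int k * \<theta>)) / (2 * pi)"

lemma heat1_integrable:
  "(\<lambda>\<theta>. exp (- 2 * t * (1 - cos \<theta>)) * cos (r * \<theta>)) integrable_on {-pi..pi}"
  by (intro integrable_continuous_real continuous_intros)

lemma heat1_uminus: "heat1 t (- k) = heat1 t k"
  by (simp add: heat1_def)

lemma heat1_0: "heat1 0 k = (if k = 0 then 1 else 0)"
proof (cases "k = 0")
  case False
  have "((\<lambda>\<theta>. cos (real_of_int k * \<theta>)) has_integral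
      sin (real_of_int k * pi) / real_of_int k - sin (real_of_int k * - pi) / real_of_int k) {-pi..pi}"
    by (rule fundamental_theorem_of_calculus)
       (use False in \<open>auto intro!: derivative_eq_intros simp flip: has_real_derivative_iff_has_vector_derivative\<close>)
  then have "integral {-pi..pi} (\<lambda>\<theta>. cos (real_of_int k * \<theta>)) = 0"
    by (simp add: integral_unique sin_integer_2pi mult.commute)
  then show ?thesis using False by (simp add: heat1_def)
qed (simp add: heat1_def)

lemma heat1_deriv:
  "((\<lambda>t. heat1 t k) has_real_derivative heat1 t (k + 1) + heat1 t (k - 1) - 2 * heat1 t k) (at t)"
proof -
  let ?f = "\<lambda>t \<theta>. exp (- 2 * t * (1 - cos \<theta>)) * cos (real_of_int k * \<theta>)"
  let ?f' = "\<lambda>t \<theta>. - 2 * (1 - cos \<theta>) * exp (- 2 * t * (1 - cos \<theta>)) * cos (real_of_int k * \<theta>)"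
  have D: "((\<lambda>t. integral (cbox (-pi) pi) (?f t)) has_field_derivative integral (cbox (-pi) pi) (?f' t)) (at t within UNIV)"
  proof (rule leibniz_rule_field_derivative)
    show "?f t integrable_on cbox (-pi) pi" for t using heat1_integrable by (simp add: box_real)
    show "continuous_on (UNIV \<times> cbox (-pi) pi) (\<lambda>(t, \<theta>). ?f' t \<theta>)"
      by (auto intro!: continuous_intros simp: case_prod_unfold)
  qed (auto intro!: derivative_eq_intros)
  \<comment> \<open>The addition theorem for cos ((k \<plusminus> 1) \<theta>) turns multiplication
    by the symbol into a second difference in k.\<close>
  have "?f' t = (\<lambda>\<theta>. exp (- 2 * t * (1 - cos \<theta>)) * cos (real_of_int (k + 1) * \<theta>)
      + exp (- 2 * t * (1 - cos \<theta>)) * cos (real_of_int (k - 1) * \<theta>)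
      - 2 * (exp (- 2 * t * (1 - cos \<theta>)) * cos (real_of_int k * \<theta>)))"
  proof
    fix \<theta> :: real
    have "cos (real_of_int (k + 1) * \<theta>) + cos (real_of_int (k - 1) * \<theta>) = 2 * cos \<theta> * cos (real_of_int k * \<theta>)"
      by (simp add: distrib_right left_diff_distrib cos_add cos_diff)
    then show "?f' t \<theta> = exp (- 2 * t * (1 - cos \<theta>)) * cos (real_of_int (k + 1) * \<theta>)
      + exp (- 2 * t * (1 - cos \<theta>)) * cos (real_of_int (k - 1) * \<theta>)
      - 2 * (exp (- 2 * t * (1 - cos \<theta>)) * cos (real_of_int k * \<theta>))"
      by (simp only: distrib_left[symmetric]) (simp add: algebra_simps)
  qed
  then have "integral (cbox (-pi) pi) (?f' t) = 2 * pi * (heat1 t (k + 1) + heat1 t (k - 1) - 2 * heat1 t k)"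
    using heat1_integrable[of t]
    by (simp only: box_real Henstock_Kurzweil_Integration.integral_diff Henstock_Kurzweil_Integration.integral_add
      integrable_add integrable_diff integrable_cmul integral_mult_right integrable_on_mult_right)
      (simp add: heat1_def algebra_simps)
  then have "((\<lambda>t. integral (cbox (-pi) pi) (?f t) / (2 * pi)) has_field_derivative
      2 * pi * (heat1 t (k + 1) + heat1 t (k - 1) - 2 * heat1 t k) / (2 * pi)) (at t)"
    using D by (intro DERIV_cdivide) simp
  then show ?thesis by (simp add: heat1_def box_real)
qed

lemma heat1_exp_bound: "\<bar>exp (2 * t) * heat1 t k\<bar> \<le> exp (2 * \<bar>t\<bar>)"
proof -
  let ?f = "\<lambda>\<theta>. exp (2 * t * cos \<theta>) * cos (real_of_int k * \<theta>)"
  have "norm (integral (cbox (-pi) pi) ?f) \<le> exp (2 * \<bar>t\<bar>) * measure lborel (cbox (-pi) pi)"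
  proof (rule integrable_bound)
    show "?f integrable_on cbox (-pi) pi"
      by (intro integrable_continuous continuous_intros)
    show "norm (?f \<theta>) \<le> exp (2 * \<bar>t\<bar>)" for \<theta>
    proof -
      have "2 * t * cos \<theta> \<le> \<bar>2 * t * cos \<theta>\<bar>" by (rule abs_ge_self)
      also have "\<dots> = 2 * \<bar>t\<bar> * \<bar>cos \<theta>\<bar>" by (simp add: abs_mult)
      also have "\<dots> \<le> 2 * \<bar>t\<bar> * 1" by (intro mult_left_mono) auto
      finally have "exp (2 * t * cos \<theta>) * \<bar>cos (real_of_int k * \<theta>)\<bar> \<le> exp (2 * \<bar>t\<bar>) * 1"
        by (intro mult_mono) auto
      then show ?thesis by (simp add: abs_mult)
    qed
  qed simp
  then have "\<bar>integral {-pi..pi} ?f\<bar> / (2 * pi) \<le> exp (2 * \<bar>t\<bar>)"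
    by (simp add: box_real field_simps)
  moreover have "exp (2 * t) * heat1 t k = integral {-pi..pi} ?f / (2 * pi)"
  proof -
    have "?f = (\<lambda>\<theta>. exp (2 * t) * (exp (- 2 * t * (1 - cos \<theta>)) * cos (real_of_int k * \<theta>)))"
      by (auto simp: fun_eq_iff algebra_simps simp flip: exp_add)
    then show ?thesis by (simp only: integral_mult_right heat1_def) simp
  qed
  ultimately show ?thesis by simp
qed

text \<open>This is e^{tA} 1_0. The adjacency operator is a sum of commuting one-dimensional ones,
  whence the product; the factor e^{2t} undoes the diagonal of the one-dimensional
  Laplacian.\<close>

definition flow :: "real \<Rightarrow> int ^ 'd::finite \<Rightarrow> real" where
  "flow t x = (\<Prod>i\<in>UNIV. exp (2 * t) * heat1 t (x $ i))"

lemma flow_0: "flow 0 x = (if x = 0 then 1 else 0)"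
proof (cases "x = 0")
  case False
  then obtain i where "x $ i \<noteq> 0" by (auto simp: vec_eq_iff)
  then show ?thesis using False by (auto simp: flow_def heat1_0 intro!: prod_zero bexI[of _ i])
qed (simp add: flow_def heat1_0)

lemma flow_deriv:
  fixes x :: "int ^ 'd::finite"
  shows "((\<lambda>t. flow t x) has_real_derivative (\<Sum>y\<in>{y. lnorm (y - x) = 1}. flow t y)) (at t)"
proof -
  let ?g = "\<lambda>t k. exp (2 * t) * heat1 t k"
  have g: "((\<lambda>t. ?g t k) has_real_derivative ?g t (k + 1) + ?g t (k - 1)) (at t)" for k t
    by (rule derivative_eq_intros heat1_deriv refl | simp)+ (simp add: algebra_simps)
  have D: "((\<lambda>t. flow t x) has_real_derivative
      (\<Sum>i\<in>UNIV. (?g t (x $ i + 1) + ?g t (x $ i - 1)) * (\<Prod>j\<in>UNIV - {i}. ?g t (x $ j)))) (at t)"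
    unfolding flow_def by (rule has_field_derivative_prod) (rule g)
  have up: "flow t (x + axis i a) = ?g t (x $ i + a) * (\<Prod>j\<in>UNIV - {i}. ?g t (x $ j))" for i a
    unfolding flow_def by (subst prod.remove[of UNIV i]) (auto simp: axis_def intro!: prod.cong)
  have down: "flow t (x - axis i 1) = ?g t (x $ i - 1) * (\<Prod>j\<in>UNIV - {i}. ?g t (x $ j))" for i
    unfolding flow_def by (subst prod.remove[of UNIV i]) (auto simp: axis_def intro!: prod.cong)
  show ?thesis
    using D unfolding sum_neighbours up down by (simp add: distrib_right)
qed

lemma flow_bound: "\<bar>flow t (x :: int ^ 'd::finite)\<bar> \<le> exp (2 * \<bar>t\<bar>) ^ CARD('d)"
  unfolding flow_def abs_prod
  by (rule order_trans[OF prod_mono[where g = "\<lambda>_. exp (2 * \<bar>t\<bar>)"]]) (auto simp: heat1_exp_bound)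

lemma flow_sums:
  "(\<lambda>n. iterated_sum (flow s) n x * t ^ n / fact n) sums flow (s + t) (x :: int ^ 'd::finite)"
  by (rule adjacency_flow_sums[OF flow_deriv flow_bound[of _ _]])
     (auto simp: mono_def intro!: power_mono)

lemma flow_walks_sums: "(\<lambda>n. walks n x * t ^ n / fact n) sums flow t (x :: int ^ 'd::finite)"
proof -
  have "iterated_sum (flow 0) n x = walks n x" for n
    unfolding iterated_sum_delta[symmetric] by (rule arg_cong[where f = "\<lambda>g. iterated_sum g n x"]) (auto simp: flow_0)
  then show ?thesis using flow_sums[of 0 x t] by simp
qed

text \<open>Two descriptions of one kernel: positivity is read off the walk series, regularity and
  decay off the Fourier integrals.\<close>

lemma heat_eq_flow: "heat t (x :: int ^ 'd::finite) = exp (- 2 * real CARD('d) * t) * flow t x"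
  using sums_mult[OF flow_walks_sums, of "exp (- 2 * real CARD('d) * t)" x t]
  by (simp add: heat_def sums_iff mult_ac)

lemma heat_prod: "heat t (x :: int ^ 'd::finite) = (\<Prod>i\<in>UNIV. heat1 t (x $ i))"
  by (simp add: heat_eq_flow flow_def prod.distrib mult_ac flip: exp_of_nat_mult exp_add)

lemma heat_deriv:
  fixes x :: "int ^ 'd::finite"
  shows "((\<lambda>t. heat t x) has_real_derivative
    (\<Sum>y\<in>{y. lnorm (y - x) = 1}. heat t y) - 2 * real CARD('d) * heat t x) (at t)"
  unfolding heat_eq_flow[abs_def]
  by (rule derivative_eq_intros flow_deriv refl | simp)+ (simp add: sum_distrib_left sum_distrib_right algebra_simps)

lemma heat_continuous [continuous_intros]: "continuous_on A (\<lambda>t. heat t (x :: int ^ 'd::finite))"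
  using DERIV_continuous_on[OF has_field_derivative_at_within[OF heat_deriv]] .

lemma heat_measurable [measurable]: "(\<lambda>t. heat t (x :: int ^ 'd::finite)) \<in> borel_measurable borel"
  by (intro borel_measurable_continuous_onI heat_continuous)

lemma heat_uminus [simp]: "heat t (- x :: int ^ 'd::finite) = heat t x"
  by (simp add: heat_prod heat1_uminus)

lemma heat_walks_sums:
  "(\<lambda>n. exp (- 2 * real CARD('d) * t) * (walks n x * t ^ n / fact n)) sums heat t (x :: int ^ 'd::finite)"
  unfolding heat_eq_flow by (intro sums_mult flow_walks_sums)

lemma heat_nonneg: "0 \<le> t \<Longrightarrow> 0 \<le> heat t (x :: int ^ 'd::finite)"
  using heat_walks_sums[of t x] by (rule sums_le[OF _ sums_zero, rotated]) (auto simp: walks_nonneg)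

lemma heat_pos:
  assumes "0 < t" shows "0 < heat t (x :: int ^ 'd::finite)"
proof -
  obtain n where n: "0 < walks n x" using walks_pos_ex by blast
  let ?a = "\<lambda>n. exp (- 2 * real CARD('d) * t) * (walks n x * t ^ n / fact n)"
  have "0 < ?a n" using n assms by simp
  also have "\<dots> = sum ?a {n}" by simp
  also have "\<dots> \<le> suminf ?a"
    using assms sums_summable[OF heat_walks_sums[of t x]] by (intro sum_le_suminf) (auto simp: walks_nonneg)
  finally show ?thesis using heat_walks_sums[of t x] by (simp add: sums_iff)
qed

lemma flow_nonneg: "0 \<le> t \<Longrightarrow> 0 \<le> flow t (x :: int ^ 'd::finite)"
  using heat_nonneg[of t x] by (simp add: heat_eq_flow zero_le_mult_iff)

section \<open>Exponential moments, mass and semigroup law\<close>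

lemma has_sum_translate:
  fixes f :: "'a::ab_group_add \<Rightarrow> real"
  shows "((\<lambda>x. f (x + v)) has_sum s) UNIV \<longleftrightarrow> (f has_sum s) UNIV"
  by (rule has_sum_reindex_bij_betw) (rule bij_betwI[where g = "\<lambda>x. x - v"], auto)

lemma has_sum_reflect:
  fixes f :: "'a::ab_group_add \<Rightarrow> real"
  shows "((\<lambda>x. f (v - x)) has_sum s) UNIV \<longleftrightarrow> (f has_sum s) UNIV"
  by (rule has_sum_reindex_bij_betw) (rule bij_betwI[where g = "\<lambda>x. v - x"], auto)

lemma has_sum_sum:
  fixes f :: "'i \<Rightarrow> 'a \<Rightarrow> real"
  assumes "finite I" "\<And>i. i \<in> I \<Longrightarrow> (f i has_sum s i) A"
  shows "((\<lambda>x. \<Sum>i\<in>I. f i x) has_sum (\<Sum>i\<in>I. s i)) A"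
  using assms by (induction I rule: finite_induct) (auto intro: has_sum_add)

lemma has_sum_single:
  fixes f :: "'a \<Rightarrow> real"
  assumes "\<And>x. x \<noteq> a \<Longrightarrow> f x = 0"
  shows "(f has_sum f a) UNIV"
  using assms by (intro has_sum_finite_neutralI[of "{a}"]) auto

text \<open>The function e^{\<theta> x_i} is an eigenfunction of the adjacency operator: the two
  steps along axis i contribute 2 cosh \<theta>, the other 2d - 2 steps contribute 1 each. Every
  further step multiplies the moment by this eigenvalue.\<close>

lemma walks_exp_moment:
  "((\<lambda>x::int ^ 'd::finite. walks n x * exp (\<theta> * real_of_int (x $ i))) has_sum
    (2 * real CARD('d) - 2 + 2 * cosh \<theta>) ^ n) UNIV"
proof (induction n)
  case 0
  show ?case
    using has_sum_single[of 0 "\<lambda>x::int ^ 'd. walks 0 x * exp (\<theta> * real_of_int (x $ i))"] by simp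
next
  case (Suc n)
  let ?S = "(2 * real CARD('d) - 2 + 2 * cosh \<theta>) ^ n"
  let ?f = "\<lambda>x::int ^ 'd. walks n x * exp (\<theta> * real_of_int (x $ i))"
  have shift: "((\<lambda>x. walks n (x + v) * exp (\<theta> * real_of_int (x $ i))) has_sum exp (- \<theta> * real_of_int (v $ i)) * ?S) UNIV" for v :: "int ^ 'd"
  proof -
    have "((\<lambda>x. exp (- \<theta> * real_of_int (v $ i)) * ?f (x + v)) has_sum exp (- \<theta> * real_of_int (v $ i)) * ?S) UNIV"
      using Suc.IH by (intro has_sum_cmult_right) (simp only: has_sum_translate[of ?f])
    moreover have "exp (- \<theta> * real_of_int (v $ i)) * ?f (x + v) = walks n (x + v) * exp (\<theta> * real_of_int (x $ i))" for x
      by (simp add: exp_add[symmetric] algebra_simps)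
    ultimately show ?thesis by (simp only:)
  qed
  have "((\<lambda>x. \<Sum>j\<in>UNIV. walks n (x + axis j 1) * exp (\<theta> * real_of_int (x $ i))
        + walks n (x + - axis j 1) * exp (\<theta> * real_of_int (x $ i))) has_sum
      (\<Sum>j\<in>UNIV. exp (- \<theta> * real_of_int ((axis j 1 :: int ^ 'd) $ i)) * ?S
        + exp (- \<theta> * real_of_int ((- axis j 1 :: int ^ 'd) $ i)) * ?S)) UNIV"
    by (intro has_sum_sum has_sum_add shift) simp
  moreover have "(\<Sum>j\<in>UNIV. exp (- \<theta> * real_of_int ((axis j 1 :: int ^ 'd) $ i)) * ?S
        + exp (- \<theta> * real_of_int ((- axis j 1 :: int ^ 'd) $ i)) * ?S) = (2 * real CARD('d) - 2 + 2 * cosh \<theta>) * ?S"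
  proof -
    have "exp (- \<theta> * real_of_int ((axis j 1 :: int ^ 'd) $ i)) * ?S
        + exp (- \<theta> * real_of_int ((- axis j 1 :: int ^ 'd) $ i)) * ?S = (if j = i then 2 * cosh \<theta> * ?S else 2 * ?S)" for j
      by (auto simp: axis_def cosh_field_def algebra_simps)
    then have "(\<Sum>j\<in>UNIV. exp (- \<theta> * real_of_int ((axis j 1 :: int ^ 'd) $ i)) * ?S
        + exp (- \<theta> * real_of_int ((- axis j 1 :: int ^ 'd) $ i)) * ?S) = (\<Sum>j\<in>UNIV. if j = i then 2 * cosh \<theta> * ?S else 2 * ?S)"
      by simp
    also have "\<dots> = 2 * cosh \<theta> * ?S + (\<Sum>j\<in>UNIV - {i}. 2 * ?S)"
      by (subst sum.remove[of UNIV i]) (auto intro!: sum.cong)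
    also have "(\<Sum>j\<in>UNIV - {i}. 2 * ?S) = (2 * real CARD('d) - 2) * ?S"
      by (simp add: card_Diff_singleton of_nat_diff algebra_simps)
    finally show ?thesis by (simp add: algebra_simps)
  qed
  ultimately show ?case
    by (simp add: sum_neighbours sum_distrib_right distrib_right)
qed

lemma heat_exp_moment:
  assumes "0 \<le> t"
  shows "((\<lambda>x::int ^ 'd::finite. heat t x * exp (\<theta> * real_of_int (x $ i))) has_sum exp (2 * t * (cosh \<theta> - 1))) UNIV"
proof (rule nn_integral_imp_has_sum)
  let ?M = "2 * real CARD('d) - 2 + 2 * cosh \<theta>" and ?c = "exp (- 2 * real CARD('d) * t)"
  let ?e = "\<lambda>x::int ^ 'd. exp (\<theta> * real_of_int (x $ i))"
  have "ennreal (heat t x * ?e x) = (\<Sum>n. ennreal (?c * (t^n / fact n) * (walks n x * ?e x)))" for x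
  proof -
    have "(\<lambda>n. ?c * (t^n / fact n) * (walks n x * ?e x)) sums (heat t x * ?e x)"
      using sums_mult2[OF heat_walks_sums[of t x], of "?e x"] by (simp add: mult_ac)
    then show ?thesis
      using assms by (subst suminf_ennreal2) (auto simp: sums_iff walks_nonneg)
  qed
  then have "(\<integral>\<^sup>+x. ennreal (heat t x * ?e x) \<partial>count_space UNIV)
      = (\<Sum>n. (\<integral>\<^sup>+x. ennreal (?c * (t^n / fact n) * (walks n x * ?e x)) \<partial>count_space UNIV))"
    by (simp only:) (rule nn_integral_suminf, simp)
  also have "\<dots> = (\<Sum>n. ennreal (?c * ((t * ?M)^n / fact n)))"
  proof (intro suminf_cong)
    fix n
    have "((\<lambda>x. ?c * (t^n / fact n) * (walks n x * ?e x)) has_sum ?c * (t^n / fact n) * ?M^n) UNIV"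
      by (intro has_sum_cmult_right walks_exp_moment)
    from has_sum_imp_nn_integral[OF this]
    show "(\<integral>\<^sup>+x. ennreal (?c * (t^n / fact n) * (walks n x * ?e x)) \<partial>count_space UNIV) = ennreal (?c * ((t * ?M)^n / fact n))"
      using assms by (simp add: walks_nonneg power_mult_distrib)
  qed
  also have "\<dots> = ennreal (?c * exp (t * ?M))"
  proof -
    have M: "0 \<le> ?M" using cosh_real_ge_1[of \<theta>] by (simp add: add_nonneg_nonneg)
    have "(\<lambda>n. ?c * ((t * ?M)^n / fact n)) sums (?c * exp (t * ?M))"
      using exp_converges[of "t * ?M"] by (intro sums_mult) (simp add: divide_inverse mult.commute)
    then show ?thesis using assms M by (subst suminf_ennreal2) (auto simp: sums_iff)
  qed
  also have "?c * exp (t * ?M) = exp (2 * t * (cosh \<theta> - 1))"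
    by (simp add: exp_add[symmetric] algebra_simps)
  finally show "(\<integral>\<^sup>+x. ennreal (heat t x * ?e x) \<partial>count_space UNIV) = ennreal (exp (2 * t * (cosh \<theta> - 1)))" .
  show "0 \<le> heat t x * ?e x" for x using heat_nonneg[OF assms, of x] by simp
qed simp

lemma heat_mass: "0 \<le> t \<Longrightarrow> ((\<lambda>x::int ^ 'd::finite. heat t x) has_sum 1) UNIV"
  using heat_exp_moment[of t 0] by simp

lemma heat_le_1: 
  assumes "0 \<le> t" shows "heat t (x::int ^ 'd::finite) \<le> 1"
proof -
  have "((\<lambda>y::int ^ 'd. if y = x then heat t x else 0) has_sum heat t x) UNIV"
    using has_sum_single[of x "\<lambda>y. if y = x then heat t x else 0"] by simp
  then show ?thesis
    by (rule has_sum_mono[OF _ heat_mass[OF assms]]) (simp add: heat_nonneg[OF assms])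
qed

lemma iterated_sum_convolution:
  fixes g :: "int ^ 'd::finite \<Rightarrow> real"
  shows "((\<lambda>y. g (x - y) * walks n y) has_sum iterated_sum g n x) UNIV"
proof (induction n arbitrary: x)
  case 0
  show ?case using has_sum_single[of 0 "\<lambda>y. g (x - y) * walks 0 y"] by simp
next
  case (Suc n)
  have shift: "((\<lambda>y. g (x - y) * walks n (y + v)) has_sum iterated_sum g n (x + v)) UNIV" for v
    using Suc.IH[of "x + v"] has_sum_translate[of "\<lambda>y. g (x + v - y) * walks n y" v] by (simp add: add_diff_add)
  have "((\<lambda>y. \<Sum>j\<in>UNIV. g (x - y) * walks n (y + axis j 1) + g (x - y) * walks n (y + - axis j 1)) has_sum
      (\<Sum>j\<in>UNIV. iterated_sum g n (x + axis j 1) + iterated_sum g n (x + - axis j 1))) UNIV"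
    by (intro has_sum_sum has_sum_add shift) simp
  then show ?case by (simp add: sum_neighbours sum_distrib_left distrib_left)
qed

text \<open>Expand the second factor in walks: convolution with \<open>walks n\<close> applies A^n
  to the first factor, and the resulting series is the Taylor expansion of the flow around time
  s.\<close>

lemma heat_semigroup:
  assumes "0 \<le> s" "0 \<le> t"
  shows "((\<lambda>y. heat s (x - y) * heat t y) has_sum heat (s + t) (x::int ^ 'd::finite)) UNIV"
proof (rule nn_integral_imp_has_sum)
  let ?c = "exp (- 2 * real CARD('d) * t)"
  have "ennreal (heat s (x - y) * heat t y) = (\<Sum>n. ennreal (?c * (t^n / fact n) * (heat s (x - y) * walks n y)))" for y
  proof -
    have "(\<lambda>n. ?c * (t^n / fact n) * (heat s (x - y) * walks n y)) sums (heat s (x - y) * heat t y)"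
      using sums_mult2[OF heat_walks_sums[of t y], of "heat s (x - y)"] by (simp add: mult_ac)
    then show ?thesis
      using assms by (subst suminf_ennreal2) (auto simp: sums_iff walks_nonneg heat_nonneg)
  qed
  then have "(\<integral>\<^sup>+y. ennreal (heat s (x - y) * heat t y) \<partial>count_space UNIV)
      = (\<Sum>n. (\<integral>\<^sup>+y. ennreal (?c * (t^n / fact n) * (heat s (x - y) * walks n y)) \<partial>count_space UNIV))"
    by (simp only:) (rule nn_integral_suminf, simp)
  also have "\<dots> = (\<Sum>n. ennreal (exp (- 2 * real CARD('d) * (s + t)) * (iterated_sum (flow s) n x * t^n / fact n)))"
  proof (intro suminf_cong)
    fix n
    let ?a = "?c * (t^n / fact n) * exp (- 2 * real CARD('d) * s)"
    have "((\<lambda>y. ?a * (flow s (x - y) * walks n y)) has_sum ?a * iterated_sum (flow s) n x) UNIV"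
      by (intro has_sum_cmult_right iterated_sum_convolution)
    then have "((\<lambda>y. ?c * (t^n / fact n) * (heat s (x - y) * walks n y)) has_sum ?a * iterated_sum (flow s) n x) UNIV"
      by (simp add: heat_eq_flow mult_ac)
    from has_sum_imp_nn_integral[OF this]
    have "(\<integral>\<^sup>+y. ennreal (?c * (t^n / fact n) * (heat s (x - y) * walks n y)) \<partial>count_space UNIV) = ennreal (?a * iterated_sum (flow s) n x)"
      using assms by (simp add: walks_nonneg heat_nonneg)
    also have "?a * iterated_sum (flow s) n x = exp (- 2 * real CARD('d) * (s + t)) * (iterated_sum (flow s) n x * t^n / fact n)"
    proof -
      have "exp (- 2 * real CARD('d) * (s + t)) = ?c * exp (- 2 * real CARD('d) * s)"
        by (simp add: exp_add[symmetric] algebra_simps)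
      then show ?thesis by (simp only: mult_ac times_divide_eq_left times_divide_eq_right)
    qed
    finally show "(\<integral>\<^sup>+y. ennreal (?c * (t^n / fact n) * (heat s (x - y) * walks n y)) \<partial>count_space UNIV)
      = ennreal (exp (- 2 * real CARD('d) * (s + t)) * (iterated_sum (flow s) n x * t^n / fact n))" .
  qed
  also have "\<dots> = ennreal (heat (s + t) x)"
  proof -
    have "0 \<le> iterated_sum (flow s) n z" for n z
      by (induction n arbitrary: z) (auto intro!: sum_nonneg flow_nonneg assms)
    then show ?thesis
      using sums_mult[OF flow_sums[of s x t], of "exp (- 2 * real CARD('d) * (s + t))"] assms
      by (subst suminf_ennreal2) (auto simp: sums_iff heat_eq_flow simp del: times_divide_eq_right
        intro!: mult_nonneg_nonneg divide_nonneg_nonneg)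
  qed
  finally show "(\<integral>\<^sup>+y. ennreal (heat s (x - y) * heat t y) \<partial>count_space UNIV) = ennreal (heat (s + t) x)" .
  show "0 \<le> heat s (x - y) * heat t y" for y
    by (intro mult_nonneg_nonneg heat_nonneg assms)
  show "0 \<le> heat (s + t) x" using assms by (simp add: heat_nonneg)
qed

section \<open>Local central limit theorem and on-diagonal bounds\<close>

lemma integrable_gauss: "0 < a \<Longrightarrow> integrable lborel (\<lambda>x::real. exp (- a * x^2))"
proof -
  assume a: "0 < a"
  define s where "s = sqrt (1 / (2 * a))"
  have s: "0 < s" "s^2 = 1 / (2 * a)" using a by (simp_all add: s_def)
  have "integrable lborel (\<lambda>x. sqrt (2 * pi * s^2) * normal_density 0 s x)"
    using s by (intro integrable_mult_right integrable_normal_density)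
  also have "(\<lambda>x. sqrt (2 * pi * s^2) * normal_density 0 s x) = (\<lambda>x. exp (- a * x^2))"
    using s a by (auto simp: normal_density_def fun_eq_iff)
  finally show ?thesis .
qed

text \<open>The real part of the characteristic function of the standard normal law, rescaled by
  sqrt 2.\<close>

lemma gauss_cos: "(\<integral>x. exp (- (x^2)) * cos (z * x) \<partial>lborel) = sqrt pi * exp (- (z^2) / 4)"
proof -
  have "char std_normal_distribution (z / sqrt 2) = complex_of_real (exp (- ((z / sqrt 2)^2) / 2))"
    by (simp add: char_std_normal_distribution)
  then have "Re (char std_normal_distribution (z / sqrt 2)) = exp (- (z^2) / 4)"
    by (simp add: power_divide)
  also have "Re (char std_normal_distribution (z / sqrt 2)) = (\<integral>x. Re (iexp (z / sqrt 2 * x)) \<partial>std_normal_distribution)"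
  proof -
    interpret real_distribution std_normal_distribution by (rule real_dist_normal_dist)
    show ?thesis unfolding char_def by (intro integral_Re[symmetric] integrable_iexp) simp_all
  qed
  also have "\<dots> = (\<integral>x. std_normal_density x * cos (z / sqrt 2 * x) \<partial>lborel)"
    by (subst integral_density) (auto simp: Re_exp)
  also have "\<dots> = sqrt 2 * (\<integral>x. std_normal_density (sqrt 2 * x) * cos (z / sqrt 2 * (sqrt 2 * x)) \<partial>lborel)"
    using lborel_integral_real_affine[of "sqrt 2" "\<lambda>x. std_normal_density x * cos (z / sqrt 2 * x)" 0] by simp
  also have "\<dots> = (\<integral>x. 1 / sqrt pi * (exp (- (x^2)) * cos (z * x)) \<partial>lborel)"
    by (subst integral_mult_right_zero[symmetric], rule Bochner_Integration.integral_cong)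
       (auto simp: normal_density_def power_mult_distrib real_sqrt_mult)
  finally show ?thesis by (simp add: field_simps)
qed

text \<open>The Fourier multiplier of \<open>heat1\<close> after the substitution \<theta> = \<xi> /
  sqrt t, at which scale it converges to a Gaussian.\<close>

definition heat1_profile :: "real \<Rightarrow> real \<Rightarrow> real" where
  "heat1_profile t \<xi> = indicator {- pi * sqrt t..pi * sqrt t} \<xi> * exp (- 2 * t * (1 - cos (\<xi> / sqrt t)))"

lemma heat1_profile_measurable [measurable]: "heat1_profile t \<in> borel_measurable borel"
  unfolding heat1_profile_def[abs_def] by measurable

lemma heat1_scaled:
  assumes "0 < t"
  shows "sqrt t * heat1 t k = (\<integral>\<xi>. heat1_profile t \<xi> * cos (real_of_int k / sqrt t * \<xi>) \<partial>lborel) / (2 * pi)"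
proof -
  let ?f = "\<lambda>\<theta>. exp (- 2 * t * (1 - cos \<theta>)) * cos (real_of_int k * \<theta>)"
  have "set_integrable lborel {-pi..pi} ?f"
    unfolding set_integrable_def
    by (intro borel_integrable_compact continuous_intros) auto
  then have "integral {-pi..pi} ?f = (\<integral>\<theta>. indicator {-pi..pi} \<theta> * ?f \<theta> \<partial>lborel)"
    using set_borel_integral_eq_integral(2)[of "{-pi..pi}" ?f] by (simp add: set_lebesgue_integral_def)
  also have "\<dots> = 1 / sqrt t * (\<integral>\<xi>. indicator {-pi..pi} (\<xi> / sqrt t) * ?f (\<xi> / sqrt t) \<partial>lborel)"
    using lborel_integral_real_affine[of "1 / sqrt t" "\<lambda>\<theta>. indicator {-pi..pi} \<theta> * ?f \<theta>" 0] assms by simp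
  also have "(\<integral>\<xi>. indicator {-pi..pi} (\<xi> / sqrt t) * ?f (\<xi> / sqrt t) \<partial>lborel)
      = (\<integral>\<xi>. heat1_profile t \<xi> * cos (real_of_int k / sqrt t * \<xi>) \<partial>lborel)"
  proof (rule Bochner_Integration.integral_cong)
    fix \<xi> :: real
    have "\<xi> / sqrt t \<in> {-pi..pi} \<longleftrightarrow> \<xi> \<in> {- pi * sqrt t..pi * sqrt t}" using assms by (simp add: field_simps)
    then have "indicator {-pi..pi} (\<xi> / sqrt t) = (indicator {- pi * sqrt t..pi * sqrt t} \<xi> :: real)"
      by (simp add: indicator_def)
    then show "indicator {-pi..pi} (\<xi> / sqrt t) * ?f (\<xi> / sqrt t) = heat1_profile t \<xi> * cos (real_of_int k / sqrt t * \<xi>)"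
      by (simp add: heat1_profile_def)
  qed simp
  finally show ?thesis using assms unfolding heat1_def by (simp add: field_simps)
qed

lemma heat1_profile_bounds:
  assumes "0 < t" shows "0 \<le> heat1_profile t \<xi>" "heat1_profile t \<xi> \<le> exp (- (1/9) * \<xi>^2)"
proof -
  show "0 \<le> heat1_profile t \<xi>" by (simp add: heat1_profile_def)
  show "heat1_profile t \<xi> \<le> exp (- (1/9) * \<xi>^2)"
  proof (cases "\<xi> \<in> {- pi * sqrt t..pi * sqrt t}")
    case True
    then have "\<bar>\<xi> / sqrt t\<bar> \<le> pi" using assms by (auto simp: abs_le_iff field_simps)
    then have "(\<xi> / sqrt t)^2 / 18 \<le> 1 - cos (\<xi> / sqrt t)" by (rule one_minus_cos_ge)
    then have "2 * t * ((\<xi> / sqrt t)^2 / 18) \<le> 2 * t * (1 - cos (\<xi> / sqrt t))"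
      using assms by (intro mult_left_mono) auto
    moreover have "2 * t * ((\<xi> / sqrt t)^2 / 18) = (1/9) * \<xi>^2" using assms by (simp add: power_divide)
    ultimately show ?thesis using True by (simp add: heat1_profile_def)
  qed (simp add: heat1_profile_def)
qed

lemma heat1_profile_cos_le:
  assumes "0 < t" shows "\<bar>heat1_profile t \<xi> * cos y\<bar> \<le> exp (- (1/9) * \<xi>^2)"
  using mult_mono[of "heat1_profile t \<xi>" "exp (- (1/9) * \<xi>^2)" "\<bar>cos y\<bar>" 1]
    heat1_profile_bounds[OF assms, of \<xi>] by (simp add: abs_mult)

lemma heat1_profile_tendsto: "((\<lambda>t. heat1_profile t \<xi>) \<longlongrightarrow> exp (- (\<xi>^2))) at_top"
proof -
  have "((\<lambda>t. - 2 * t * (1 - cos (\<xi> / sqrt t))) \<longlongrightarrow> - (\<xi>^2)) at_top"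
    unfolding power2_eq_square by real_asymp
  then have "((\<lambda>t. exp (- 2 * t * (1 - cos (\<xi> / sqrt t)))) \<longlongrightarrow> exp (- (\<xi>^2))) at_top"
    by (intro tendsto_intros)
  moreover have "\<forall>\<^sub>F t in at_top. exp (- 2 * t * (1 - cos (\<xi> / sqrt t))) = heat1_profile t \<xi>"
  proof -
    have "\<forall>\<^sub>F t in at_top. (\<bar>\<xi>\<bar> / pi)^2 \<le> t" by (rule eventually_ge_at_top)
    then show ?thesis
    proof eventually_elim
      case (elim t)
      then have "\<bar>\<xi>\<bar> / pi \<le> sqrt t" by (rule real_le_rsqrt)
      then have "\<xi> \<in> {- pi * sqrt t..pi * sqrt t}" by (auto simp: field_simps abs_le_iff)
      then show ?case by (simp add: heat1_profile_def)
    qed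
  qed
  ultimately show ?thesis by (rule Lim_transform_eventually)
qed

lemma heat1_profile_integrable: "0 < t \<Longrightarrow> integrable lborel (\<lambda>\<xi>. heat1_profile t \<xi> * cos (z * \<xi>))"
  by (rule Bochner_Integration.integrable_bound[OF integrable_gauss[of "1/9"]])
     (use heat1_profile_cos_le in \<open>auto simp del: abs_mult\<close>)

text \<open>Convergence in L1 of the multipliers; since the cosine is bounded by 1, this controls
  the heat kernel at all lattice points at once.\<close>

lemma heat1_local_clt:
  "((\<lambda>t. \<integral>\<xi>. \<bar>heat1_profile t \<xi> - exp (- (\<xi>^2))\<bar> \<partial>lborel) \<longlongrightarrow> 0) at_top"
proof -
  have "((\<lambda>t. \<integral>\<xi>. \<bar>heat1_profile t \<xi> - exp (- (\<xi>^2))\<bar> \<partial>lborel) \<longlongrightarrow> (\<integral>\<xi>. 0 \<partial>(lborel :: real measure))) at_top"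
  proof (rule integral_dominated_convergence_at_top[where w = "\<lambda>\<xi>. 2 * exp (- (1/9) * \<xi>^2)"])
    show "integrable lborel (\<lambda>\<xi>::real. 2 * exp (- (1/9) * \<xi>^2))" using integrable_gauss[of "1/9"] by simp
    show "\<forall>\<^sub>F t in at_top. AE \<xi> in lborel. norm \<bar>heat1_profile t \<xi> - exp (- (\<xi>^2))\<bar> \<le> 2 * exp (- (1/9) * \<xi>^2)"
      using eventually_gt_at_top[of 0]
    proof eventually_elim
      case (elim t)
      have "norm \<bar>heat1_profile t \<xi> - exp (- (\<xi>^2))\<bar> \<le> 2 * exp (- (1/9) * \<xi>^2)" for \<xi>
      proof -
        have "exp (- (\<xi>^2)) \<le> exp (- (1/9) * \<xi>^2)" by simp
        then show ?thesis using heat1_profile_bounds[OF elim, of \<xi>] exp_ge_zero[of "- (\<xi>^2)"]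
          unfolding real_norm_def abs_abs abs_le_iff by linarith
      qed
      then show ?case by simp
    qed
    show "AE \<xi> in lborel. ((\<lambda>t. \<bar>heat1_profile t \<xi> - exp (- (\<xi>^2))\<bar>) \<longlongrightarrow> 0) at_top"
      using heat1_profile_tendsto by (intro AE_I2 tendsto_rabs_zero) (simp add: LIM_zero_iff)
  qed auto
  then show ?thesis by simp
qed

lemma heat1_gauss_error:
  assumes "0 < t"
  shows "\<bar>sqrt t * heat1 t k - exp (- ((real_of_int k)^2) / (4 * t)) / (2 * sqrt pi)\<bar>
    \<le> (\<integral>\<xi>. \<bar>heat1_profile t \<xi> - exp (- (\<xi>^2))\<bar> \<partial>lborel)"
proof -
  let ?z = "real_of_int k / sqrt t"
  have int1: "integrable lborel (\<lambda>\<xi>. heat1_profile t \<xi> * cos (?z * \<xi>))" for z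
    by (rule heat1_profile_integrable[OF assms])
  have int0: "integrable lborel (heat1_profile t)"
    using heat1_profile_integrable[OF assms, of 0] by simp
  have g0: "integrable lborel (\<lambda>\<xi>::real. exp (- (\<xi>^2)))" using integrable_gauss[of 1] by simp
  have int2: "integrable lborel (\<lambda>\<xi>. exp (- (\<xi>^2)) * cos (?z * \<xi>))"
    by (rule Bochner_Integration.integrable_bound[OF g0]) (auto simp: abs_mult intro!: AE_I2 mult_left_le)
  have "exp (- ((real_of_int k)^2) / (4 * t)) / (2 * sqrt pi) = (\<integral>\<xi>. exp (- (\<xi>^2)) * cos (?z * \<xi>) \<partial>lborel) / (2 * pi)"
  proof -
    have "- (?z^2) / 4 = - ((real_of_int k)^2) / (4 * t)" using assms by (simp add: power_divide)
    moreover have "sqrt pi * E / (2 * pi) = E / (2 * sqrt pi)" for E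
      by (simp add: field_simps)
    ultimately show ?thesis unfolding gauss_cos by simp
  qed
  then have "sqrt t * heat1 t k - exp (- ((real_of_int k)^2) / (4 * t)) / (2 * sqrt pi)
      = (\<integral>\<xi>. (heat1_profile t \<xi> - exp (- (\<xi>^2))) * cos (?z * \<xi>) \<partial>lborel) / (2 * pi)"
    unfolding heat1_scaled[OF assms] using int1 int2 by (simp add: left_diff_distrib diff_divide_distrib)
  also have "\<bar>\<dots>\<bar> \<le> \<bar>\<integral>\<xi>. (heat1_profile t \<xi> - exp (- (\<xi>^2))) * cos (?z * \<xi>) \<partial>lborel\<bar>"
  proof -
    let ?I = "\<integral>\<xi>. (heat1_profile t \<xi> - exp (- (\<xi>^2))) * cos (?z * \<xi>) \<partial>lborel"
    have "\<bar>?I\<bar> / (2 * pi) \<le> \<bar>?I\<bar> / 1" using pi_gt3 by (intro divide_left_mono) auto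
    then show ?thesis by simp
  qed
  also have "\<dots> \<le> (\<integral>\<xi>. \<bar>(heat1_profile t \<xi> - exp (- (\<xi>^2))) * cos (?z * \<xi>)\<bar> \<partial>lborel)"
    by (rule integral_abs_bound)
  also have "\<dots> \<le> (\<integral>\<xi>. \<bar>heat1_profile t \<xi> - exp (- (\<xi>^2))\<bar> \<partial>lborel)"
  proof (intro integral_mono integrable_abs)
    show "integrable lborel (\<lambda>\<xi>. (heat1_profile t \<xi> - exp (- (\<xi>^2))) * cos (?z * \<xi>))"
      using int1 int2 by (simp add: left_diff_distrib)
    show "integrable lborel (\<lambda>\<xi>. heat1_profile t \<xi> - exp (- (\<xi>^2)))" using int0 g0 by simp
    show "\<bar>(heat1_profile t \<xi> - exp (- (\<xi>^2))) * cos (?z * \<xi>)\<bar> \<le> \<bar>heat1_profile t \<xi> - exp (- (\<xi>^2))\<bar>" for \<xi>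
      unfolding abs_mult by (intro mult_left_le) auto
  qed
  finally show ?thesis .
qed

lemma heat1_upper: "\<exists>C>0. \<forall>t>0. \<forall>k. \<bar>heat1 t k\<bar> \<le> C / sqrt t"
proof -
  define C where "C = (\<integral>\<xi>. exp (- (1/9) * \<xi>^2) \<partial>(lborel :: real measure)) + 1"
  have g: "integrable lborel (\<lambda>\<xi>::real. exp (- (1/9) * \<xi>^2))" using integrable_gauss[of "1/9"] by simp
  have "0 \<le> (\<integral>\<xi>. exp (- (1/9) * \<xi>^2) \<partial>(lborel :: real measure))"
    by (rule Bochner_Integration.integral_nonneg) simp
  then have C: "0 < C" unfolding C_def by linarith
  moreover have "\<bar>heat1 t k\<bar> \<le> C / sqrt t" if t: "0 < t" for t k
  proof -
    let ?I = "\<integral>\<xi>. heat1_profile t \<xi> * cos (real_of_int k / sqrt t * \<xi>) \<partial>lborel"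
    have "\<bar>?I\<bar> \<le> (\<integral>\<xi>. \<bar>heat1_profile t \<xi> * cos (real_of_int k / sqrt t * \<xi>)\<bar> \<partial>lborel)"
      by (rule integral_abs_bound)
    also have "\<dots> \<le> (\<integral>\<xi>. exp (- (1/9) * \<xi>^2) \<partial>lborel)"
    proof (intro integral_mono integrable_abs heat1_profile_integrable t g)
    qed (rule heat1_profile_cos_le[OF t])
    finally have "\<bar>?I\<bar> \<le> C" by (simp add: C_def)
    have "sqrt t * \<bar>heat1 t k\<bar> = \<bar>sqrt t * heat1 t k\<bar>" using t by (simp add: abs_mult)
    also have "\<dots> = \<bar>?I\<bar> / (2 * pi)" unfolding heat1_scaled[OF t] by simp
    also have "\<dots> \<le> \<bar>?I\<bar> / 1" using pi_gt3 by (intro divide_left_mono) auto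
    finally have "sqrt t * \<bar>heat1 t k\<bar> \<le> C" using \<open>\<bar>?I\<bar> \<le> C\<close> by simp
    then show ?thesis using t by (simp add: field_simps)
  qed
  ultimately show ?thesis by blast
qed

lemma sqrt_power_eq_powr: "0 < t \<Longrightarrow> sqrt t ^ n = t powr (real n / 2)"
  by (simp add: powr_half_sqrt[symmetric] powr_realpow[symmetric] powr_powr)

lemma heat_scaled: "0 < t \<Longrightarrow> t powr (real CARD('d) / 2) * heat t (x :: int ^ 'd::finite) = (\<Prod>i\<in>UNIV. sqrt t * heat1 t (x $ i))"
  by (simp add: heat_prod prod.distrib sqrt_power_eq_powr)

lemma heat_upper: "\<exists>C>0. \<forall>t>0. \<forall>x::int ^ 'd::finite. heat t x \<le> C * t powr (- real CARD('d) / 2)"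
proof -
  obtain C where C: "0 < C" "\<And>t k. 0 < t \<Longrightarrow> \<bar>heat1 t k\<bar> \<le> C / sqrt t" using heat1_upper by blast
  have "heat t x \<le> C ^ CARD('d) * t powr (- real CARD('d) / 2)" if t: "0 < t" for t and x :: "int ^ 'd"
  proof -
    have "heat t x \<le> \<bar>heat t x\<bar>" by simp
    also have "\<dots> \<le> (\<Prod>i\<in>(UNIV :: 'd set). C / sqrt t)"
      unfolding heat_prod abs_prod by (intro prod_mono) (use C t in auto)
    also have "\<dots> = C ^ CARD('d) * t powr (- real CARD('d) / 2)"
      using powr_minus_divide[of t "real CARD('d) / 2"] by (simp add: power_divide sqrt_power_eq_powr[OF t])
    finally show ?thesis .
  qed
  then show ?thesis using C(1) by (intro exI[of _ "C ^ CARD('d)"]) auto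
qed

text \<open>Compare the products over coordinates factor by factor. The error E depends on t alone,
  which is what allows x to grow together with sqrt t.\<close>

lemma heat_local_clt:
  "\<exists>E. (E \<longlongrightarrow> 0) at_top \<and> (\<forall>t>0. \<forall>x::int ^ 'd::finite.
    \<bar>t powr (real CARD('d) / 2) * heat t x - exp (- ((lnorm x)^2) / (4 * t)) / (4 * pi) powr (real CARD('d) / 2)\<bar> \<le> E t)"
proof -
  obtain C where C: "0 < C" "\<And>t k. 0 < t \<Longrightarrow> \<bar>heat1 t k\<bar> \<le> C / sqrt t" using heat1_upper by blast
  \<comment> \<open>After division by M all factors have modulus at most 1, and a difference of
    products is then bounded by the sum of the differences; the 1 covers the Gaussian
    factors.\<close>
  define M where "M = max C 1"
  define e where "e t = (\<integral>\<xi>. \<bar>heat1_profile t \<xi> - exp (- (\<xi>^2))\<bar> \<partial>lborel)" for t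
  define E where "E t = M ^ CARD('d) * (\<Sum>i\<in>(UNIV :: 'd set). e t / M)" for t
  have M: "0 < M" "1 \<le> M" by (simp_all add: M_def)
  have "(E \<longlongrightarrow> M ^ CARD('d) * (\<Sum>i\<in>(UNIV :: 'd set). 0 / M)) at_top"
    unfolding E_def e_def by (intro tendsto_intros heat1_local_clt) (use M in auto)
  then have "(E \<longlongrightarrow> 0) at_top" by simp
  moreover have "\<bar>t powr (real CARD('d) / 2) * heat t x - exp (- ((lnorm x)^2) / (4 * t)) / (4 * pi) powr (real CARD('d) / 2)\<bar> \<le> E t"
    if t: "0 < t" for t and x :: "int ^ 'd"
  proof -
    define a b where "a i = sqrt t * heat1 t (x $ i)"
      and "b i = exp (- ((real_of_int (x $ i))^2) / (4 * t)) / (2 * sqrt pi)" for i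
    have a: "\<bar>a i\<bar> \<le> M" for i
    proof -
      have "sqrt t * \<bar>heat1 t (x $ i)\<bar> \<le> sqrt t * (C / sqrt t)" using t C by (intro mult_left_mono) auto
      then show ?thesis using t by (simp add: a_def abs_mult M_def)
    qed
    have b: "\<bar>b i\<bar> \<le> M" for i
    proof -
      have "1 \<le> sqrt pi" using pi_gt3 by simp
      then have "1 \<le> 2 * sqrt pi" by linarith
      moreover have "exp (- ((real_of_int (x $ i))^2) / (4 * t)) \<le> 1" using t by simp
      ultimately have "b i \<le> 1 / 1" unfolding b_def by (intro frac_le) auto
      moreover have "0 \<le> b i" by (simp add: b_def)
      ultimately show ?thesis using M by simp
    qed
    have "(\<Prod>i\<in>UNIV. b i) = exp (\<Sum>i\<in>UNIV. - ((real_of_int (x $ i))^2) / (4 * t)) / (2 * sqrt pi) ^ CARD('d)"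
      by (simp add: b_def prod_dividef exp_sum)
    also have "(\<Sum>i\<in>UNIV. - ((real_of_int (x $ i))^2) / (4 * t)) = - ((lnorm x)^2) / (4 * t)"
      unfolding lnorm_def by (simp add: sum_nonneg sum_divide_distrib[symmetric] sum_negf)
    also have "(2 * sqrt pi) ^ CARD('d) = (4 * pi) powr (real CARD('d) / 2)"
      using sqrt_power_eq_powr[of "4 * pi" "CARD('d)"] by (simp add: real_sqrt_mult)
    finally have bp: "(\<Prod>i\<in>UNIV. b i) = exp (- ((lnorm x)^2) / (4 * t)) / (4 * pi) powr (real CARD('d) / 2)" .
    have sc: "(\<Prod>i\<in>UNIV. f i) = M ^ CARD('d) * (\<Prod>i\<in>(UNIV::'d set). f i / M)" for f :: "'d \<Rightarrow> real"
      using M by (simp add: prod_dividef)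
    have "norm ((\<Prod>i\<in>UNIV. a i / M) - (\<Prod>i\<in>UNIV. b i / M)) \<le> (\<Sum>i\<in>(UNIV :: 'd set). norm (a i / M - b i / M))"
      by (rule norm_prod_diff) (use a b M in \<open>auto simp: divide_le_eq abs_divide\<close>)
    also have "\<dots> \<le> (\<Sum>i\<in>(UNIV :: 'd set). e t / M)"
    proof (rule sum_mono)
      fix i
      have "\<bar>a i - b i\<bar> \<le> e t" unfolding e_def a_def b_def by (rule heat1_gauss_error[OF t])
      then have "\<bar>a i - b i\<bar> / M \<le> e t / M" using M by (intro divide_right_mono) auto
      then show "norm (a i / M - b i / M) \<le> e t / M" using M by (simp add: diff_divide_distrib[symmetric] abs_divide)
    qed
    finally have "M ^ CARD('d) * \<bar>(\<Prod>i\<in>UNIV. a i / M) - (\<Prod>i\<in>UNIV. b i / M)\<bar> \<le> E t"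
      unfolding E_def using M by (intro mult_left_mono) auto
    also have "M ^ CARD('d) * \<bar>(\<Prod>i\<in>UNIV. a i / M) - (\<Prod>i\<in>UNIV. b i / M)\<bar> = \<bar>(\<Prod>i\<in>UNIV. a i) - (\<Prod>i\<in>UNIV. b i)\<bar>"
      unfolding sc[of a] sc[of b] using M by (simp only: right_diff_distrib[symmetric] abs_mult) simp
    finally show ?thesis unfolding heat_scaled[OF t] bp a_def .
  qed
  ultimately show ?thesis by blast
qed

lemma heat_lower: "\<exists>c>0. \<exists>T>0. \<forall>t\<ge>T. c * t powr (- real CARD('d) / 2) \<le> heat t (0 :: int ^ 'd::finite)"
proof -
  let ?p = "real CARD('d) / 2"
  obtain E where E: "(E \<longlongrightarrow> 0) at_top" and
    le: "\<And>t x. 0 < t \<Longrightarrow> \<bar>t powr ?p * heat t (x :: int ^ 'd) - exp (- ((lnorm x)^2) / (4 * t)) / (4 * pi) powr ?p\<bar> \<le> E t"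
    using heat_local_clt by blast
  \<comment> \<open>Half of the limit of t^{d/2} times the kernel at 0.\<close>
  define c where "c = 1 / (4 * pi) powr ?p / 2"
  have c: "0 < c" by (simp add: c_def)
  have "\<forall>\<^sub>F t in at_top. E t < c" using E c by (rule order_tendstoD)
  then obtain T where T: "\<And>t. T \<le> t \<Longrightarrow> E t < c" by (auto simp: eventually_at_top_linorder)
  have "c * t powr (- real CARD('d) / 2) \<le> heat t (0 :: int ^ 'd)" if "max T 1 \<le> t" for t
  proof -
    have t: "0 < t" "E t < c" using that T by auto
    have "\<bar>t powr ?p * heat t (0 :: int ^ 'd) - 2 * c\<bar> \<le> E t"
      using le[OF t(1), of 0] by (simp add: lnorm_def c_def)
    then have "c \<le> t powr ?p * heat t (0 :: int ^ 'd)" using t(2) by linarith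
    then show ?thesis using t(1) by (simp add: powr_minus field_simps)
  qed
  then show ?thesis using c by (intro exI[of _ c] conjI exI[of _ "max T 1"]) auto
qed

section \<open>Off-diagonal decay of the heat kernel\<close>

text \<open>In the convolution of two heat kernels, one of \<open>y\<close> and \<open>x - y\<close> carries at least half of \<open>x $ i\<close>;
  the exponential moment controls that factor and the uniform bound the other one.\<close>

lemma heat_tilt:
  assumes "0 \<le> t" "\<And>y::int ^ 'd::finite. heat t y \<le> B" "0 \<le> \<theta> * real_of_int (x $ i)"
  shows "heat (t + t) (x :: int ^ 'd) \<le> 2 * B * (exp (- (\<theta> * real_of_int (x $ i)) / 2) * exp (2 * t * (cosh \<theta> - 1)))"
proof -
  let ?z = "exp (- (\<theta> * real_of_int (x $ i)) / 2)"
  let ?f = "\<lambda>y::int ^ 'd. heat t y * exp (\<theta> * real_of_int (y $ i))"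
  have B: "0 \<le> B" using assms(2)[of 0] heat_nonneg[OF assms(1), of "0 :: int ^ 'd"] by linarith
  have m: "(?f has_sum exp (2 * t * (cosh \<theta> - 1))) UNIV" by (rule heat_exp_moment[OF assms(1)])
  then have m': "((\<lambda>y. ?f (x - y)) has_sum exp (2 * t * (cosh \<theta> - 1))) UNIV" by (simp only: has_sum_reflect[of ?f])
  have "((\<lambda>y. B * ?z * ?f y + B * ?z * ?f (x - y)) has_sum
      B * ?z * exp (2 * t * (cosh \<theta> - 1)) + B * ?z * exp (2 * t * (cosh \<theta> - 1))) UNIV"
    by (intro has_sum_add has_sum_cmult_right m m')
  with heat_semigroup[OF assms(1) assms(1), of x]
  have "heat (t + t) x \<le> B * ?z * exp (2 * t * (cosh \<theta> - 1)) + B * ?z * exp (2 * t * (cosh \<theta> - 1))"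
  proof (rule has_sum_mono)
    fix y :: "int ^ 'd"
    have n: "0 \<le> heat t y" "0 \<le> heat t (x - y)" using heat_nonneg assms(1) by auto
    have split: "\<theta> * real_of_int (y $ i) + \<theta> * real_of_int ((x - y) $ i) = \<theta> * real_of_int (x $ i)"
      by (simp add: algebra_simps)
    show "heat t (x - y) * heat t y \<le> B * ?z * ?f y + B * ?z * ?f (x - y)"
    proof (cases "\<theta> * real_of_int (x $ i) / 2 \<le> \<theta> * real_of_int (y $ i)")
      case True
      then have "1 \<le> ?z * exp (\<theta> * real_of_int (y $ i))" by (simp flip: exp_add)
      then have "heat t (x - y) * heat t y * 1 \<le> B * heat t y * (?z * exp (\<theta> * real_of_int (y $ i)))"
        using n B assms(2) by (intro mult_mono) auto
      moreover have "0 \<le> B * ?z * ?f (x - y)" using n B by simp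
      ultimately show ?thesis by (simp add: mult_ac)
    next
      case False
      then have "1 \<le> ?z * exp (\<theta> * real_of_int ((x - y) $ i))" using split by (simp flip: exp_add)
      then have "heat t (x - y) * heat t y * 1 \<le> heat t (x - y) * B * (?z * exp (\<theta> * real_of_int ((x - y) $ i)))"
        using n B assms(2) by (intro mult_mono) auto
      moreover have "0 \<le> B * ?z * ?f y" using n B by simp
      ultimately show ?thesis by (simp add: mult_ac)
    qed
  qed
  then show ?thesis by (simp add: mult_ac)
qed

lemma power_mult_exp_minus_le_fact: "0 \<le> (z::real) \<Longrightarrow> z ^ n * exp (- z) \<le> fact n"
proof -
  assume z: "0 \<le> z"
  have "(\<lambda>k. z ^ k / fact k) sums exp z"
    using exp_converges[of z] by (simp add: divide_inverse mult.commute)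
  then have "z ^ n / fact n \<le> exp z"
    using sum_le_suminf[of "\<lambda>k. z ^ k / fact k" "{n}"] z by (simp add: sums_iff)
  then show ?thesis by (simp add: exp_minus field_simps)
qed

lemma lnorm_le_coordinate: "\<exists>i. lnorm (x :: int ^ 'd::finite) \<le> sqrt (real CARD('d)) * \<bar>real_of_int (x $ i)\<bar>"
proof -
  define m where "m = Max (range (\<lambda>i. \<bar>real_of_int (x $ i)\<bar>))"
  have "m \<in> range (\<lambda>i. \<bar>real_of_int (x $ i)\<bar>)" unfolding m_def by (rule Max_in) auto
  then obtain i where i: "m = \<bar>real_of_int (x $ i)\<bar>" by blast
  have "(\<Sum>j\<in>UNIV. (real_of_int (x $ j))^2) \<le> (\<Sum>j\<in>(UNIV :: 'd set). m^2)"
  proof (rule sum_mono)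
    fix j
    have "\<bar>real_of_int (x $ j)\<bar> \<le> m" unfolding m_def by (intro Max_ge) auto
    then show "(real_of_int (x $ j))^2 \<le> m^2" by (metis abs_ge_zero power2_abs power_mono)
  qed
  then have "lnorm x \<le> sqrt (real CARD('d) * m^2)" unfolding lnorm_def by (intro real_sqrt_le_mono) simp
  then show ?thesis using i by (auto simp: real_sqrt_mult)
qed

text \<open>A bound uniform in t, for times below |x|^2, where the bound by t^{-d/2} is too weak.
  For t \<ge> 1, tilting yields t^{-d/2} e^{-z} with z of order |x| / sqrt t, and z^d e^{-z} \<le>
  d! trades the exponential for |x|^{-d}; small times are treated in the same way.\<close>

lemma heat_off_diagonal:
  "\<exists>C>0. \<forall>t>0. \<forall>x::int ^ 'd::finite. x \<noteq> 0 \<longrightarrow> heat t x \<le> C / lnorm x powr real CARD('d)"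
proof -
  let ?d = "CARD('d)"
  obtain C0 where C0: "0 < C0" "\<And>t x. 0 < t \<Longrightarrow> heat t (x :: int ^ 'd) \<le> C0 * t powr (- real ?d / 2)"
    using heat_upper by blast
  \<comment> \<open>For a tilt of size a \<le> 1 the growth of the moment is thus at most e^{t
    a^2}.\<close>
  have cosh1: "cosh \<theta> - 1 \<le> \<theta>^2" if "\<bar>\<theta>\<bar> \<le> 1" for \<theta> :: real
  proof -
    have "cosh \<theta> = (exp \<bar>\<theta>\<bar> + exp (- \<bar>\<theta>\<bar>)) / 2" by (simp add: cosh_field_def abs_if)
    moreover have "exp \<bar>\<theta>\<bar> \<le> 1 + \<bar>\<theta>\<bar> + \<bar>\<theta>\<bar>^2" using that by (intro exp_bound) auto
    moreover have "exp (- \<bar>\<theta>\<bar>) \<le> 1 - \<bar>\<theta>\<bar> + \<theta>^2"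
    proof -
      have "(1 + \<bar>\<theta>\<bar>) * exp (- \<bar>\<theta>\<bar>) \<le> exp \<bar>\<theta>\<bar> * exp (- \<bar>\<theta>\<bar>)"
        by (intro mult_right_mono exp_ge_add_one_self) auto
      then have "(1 + \<bar>\<theta>\<bar>) * exp (- \<bar>\<theta>\<bar>) \<le> 1" by (simp flip: exp_add)
      also have "1 \<le> 1 + \<theta>^2 * \<bar>\<theta>\<bar>" by simp
      also have "\<dots> = (1 + \<bar>\<theta>\<bar>) * (1 - \<bar>\<theta>\<bar> + \<theta>^2)" by (simp add: algebra_simps power2_eq_square)
      finally show ?thesis by (simp add: mult_le_cancel_left)
    qed
    ultimately show ?thesis by simp
  qed
  \<comment> \<open>One constant for both regimes: the first summand serves t \<ge> 1, the second t
    < 1.\<close>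
  define K where "K = 2 * C0 * 2 powr (real ?d / 2) + 2"
  define C where "C = K * exp 1 * fact ?d * (2 * sqrt (real ?d)) ^ ?d"
  have K: "0 < K" "2 * C0 * 2 powr (real ?d / 2) \<le> K" "2 \<le> K" using C0(1) by (auto simp: K_def add_pos_pos)
  have C: "0 < C" using K by (simp add: C_def)
  have "heat t x \<le> C / lnorm x powr real ?d" if t: "0 < t" and x: "x \<noteq> 0" for t and x :: "int ^ 'd"
  proof -
    obtain i where i: "lnorm x \<le> sqrt (real ?d) * \<bar>real_of_int (x $ i)\<bar>" using lnorm_le_coordinate by blast
    define r where "r = \<bar>real_of_int (x $ i)\<bar>"
    obtain j where "x $ j \<noteq> 0" using x by (auto simp: vec_eq_iff)
    then have "0 < (\<Sum>j\<in>UNIV. (real_of_int (x $ j))^2)" by (intro sum_pos2[of _ j]) auto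
    then have l: "0 < lnorm x" by (simp add: lnorm_def)
    with i have "0 < sqrt (real ?d) * r" unfolding r_def by linarith
    then have r: "0 < r" by (simp add: zero_less_mult_iff)
    \<comment> \<open>The tilt carries the sign of x $ i, so only its size a remains to be chosen; B
      bounds the kernel at half the time.\<close>
    have key: "heat t x \<le> 2 * B * (exp (- (a * r) / 2) * exp (t * a^2))"
      if a: "0 \<le> a" "a \<le> 1" and B: "\<And>y::int ^ 'd. heat (t / 2) y \<le> B" for a B
    proof -
      let ?\<theta> = "a * sgn (real_of_int (x $ i))"
      have \<theta>: "?\<theta> * real_of_int (x $ i) = a * r" by (simp add: r_def abs_sgn mult.commute)
      have "0 \<le> B" using B[of 0] heat_nonneg[of "t / 2" "0 :: int ^ 'd"] t by linarith
      have "cosh ?\<theta> - 1 \<le> ?\<theta>^2" using a by (intro cosh1) (auto simp: abs_mult sgn_if)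
      also have "?\<theta>^2 \<le> a^2" by (auto simp: power_mult_distrib sgn_if)
      finally have "t * (cosh ?\<theta> - 1) \<le> t * a^2" using t by (intro mult_left_mono) auto
      then have "2 * B * (exp (- (a * r) / 2) * exp (2 * (t / 2) * (cosh ?\<theta> - 1))) \<le> 2 * B * (exp (- (a * r) / 2) * exp (t * a^2))"
        using \<open>0 \<le> B\<close> by (intro mult_left_mono) auto
      moreover have "heat (t / 2 + t / 2) x \<le> 2 * B * (exp (- (?\<theta> * real_of_int (x $ i)) / 2) * exp (2 * (t / 2) * (cosh ?\<theta> - 1)))"
      proof (rule heat_tilt)
        show "0 \<le> ?\<theta> * real_of_int (x $ i)" unfolding \<theta> using a r by simp
      qed (use t B in auto)
      ultimately show ?thesis unfolding \<theta> by simp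
    qed
    have "heat t x \<le> K * exp 1 * fact ?d * (2 / r) ^ ?d"
    \<comment> \<open>The choice must satisfy a \<le> 1 and t a^2 \<le> 1: a = 1 / sqrt t in the
      first case, a = 1 in the second.\<close>
    proof (cases "1 \<le> t")
      case True
      define z where "z = r / (2 * sqrt t)"
      have z: "0 \<le> z" using r t by (simp add: z_def)
      have "heat t x \<le> 2 * (C0 * (t / 2) powr (- real ?d / 2)) * (exp (- (1 / sqrt t * r) / 2) * exp (t * (1 / sqrt t)^2))"
        by (rule key) (use True C0(2)[of "t / 2"] in auto)
      also have "(t / 2) powr (- real ?d / 2) = 2 powr (real ?d / 2) * (2 * z / r) ^ ?d"
      proof -
        have "(t / 2) powr (- real ?d / 2) = 1 / (t powr (real ?d / 2) / 2 powr (real ?d / 2))"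
          using t powr_minus_divide[of "t / 2" "real ?d / 2"] by (simp add: powr_divide)
        moreover have "2 * z / r = 1 / sqrt t" using r by (simp add: z_def)
        ultimately show ?thesis using sqrt_power_eq_powr[OF t, of ?d] by (simp add: power_divide)
      qed
      also have "exp (- (1 / sqrt t * r) / 2) = exp (- z)" by (simp add: z_def)
      also have "t * (1 / sqrt t)^2 = 1" using t by (simp add: power_divide)
      also have "2 * (C0 * (2 powr (real ?d / 2) * (2 * z / r) ^ ?d)) * (exp (- z) * exp 1)
          = (2 * C0 * 2 powr (real ?d / 2)) * exp 1 * (z ^ ?d * exp (- z)) * (2 / r) ^ ?d"
        by (simp add: power_mult_distrib power_divide mult_ac)
      also have "\<dots> \<le> K * exp 1 * fact ?d * (2 / r) ^ ?d"
        using K r z power_mult_exp_minus_le_fact[OF z] C0(1) by (intro mult_mono) auto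
      finally show ?thesis .
    next
      case False
      define z where "z = r / 2"
      have z: "0 \<le> z" using r by (simp add: z_def)
      have "heat t x \<le> 2 * 1 * (exp (- (1 * r) / 2) * exp (t * 1^2))"
        by (rule key) (use t in \<open>auto intro: heat_le_1\<close>)
      also have "\<dots> \<le> 2 * (exp (- z) * exp 1)" using False by (simp add: z_def)
      also have "\<dots> = 2 * exp 1 * (z ^ ?d * exp (- z)) * (2 / r) ^ ?d"
        using r by (simp add: z_def power_divide)
      also have "\<dots> \<le> K * exp 1 * fact ?d * (2 / r) ^ ?d"
        using K r z power_mult_exp_minus_le_fact[OF z] by (intro mult_mono) auto
      finally show ?thesis .
    qed
    also have "\<dots> \<le> K * exp 1 * fact ?d * (2 * sqrt (real ?d) / lnorm x) ^ ?d"
    proof (intro mult_left_mono power_mono)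
      show "2 / r \<le> 2 * sqrt (real ?d) / lnorm x" using i l r unfolding r_def by (simp add: field_simps)
    qed (use K r in auto)
    also have "\<dots> = C / lnorm x powr real ?d"
      using l by (simp add: C_def power_divide powr_realpow)
    finally show ?thesis .
  qed
  then show ?thesis using C by blast
qed

section \<open>Riesz potentials\<close>

lemma has_integral_nonneg_lborel:
  fixes f :: "real \<Rightarrow> real"
  assumes [measurable]: "f \<in> borel_measurable borel" "S \<in> sets borel"
    and nonneg: "\<And>x. x \<in> S \<Longrightarrow> 0 \<le> f x" and I: "(f has_integral I) S"
  shows "set_integrable lborel S f" "(LINT x:S|lborel. f x) = I"
proof -
  let ?f = "\<lambda>x. indicator S x * f x"
  have "0 \<le> I" using has_integral_nonneg[OF I nonneg] .
  have "(?f has_integral I) UNIV"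
  proof -
    have "(\<lambda>x. if x \<in> S then f x else 0) = ?f" by (auto simp: indicator_def)
    then show ?thesis using I has_integral_restrict_UNIV[of S f I] by simp
  qed
  then have nn: "integral\<^sup>N lborel ?f = ennreal I"
    by (intro nn_integral_has_integral_lborel) (auto simp: indicator_def nonneg)
  show int: "set_integrable lborel S f"
    unfolding set_integrable_def
    by (rule integrableI_nn_integral_finite[where x = I]) (use nn \<open>0 \<le> I\<close> nonneg in \<open>auto simp: indicator_def\<close>)
  show "(LINT x:S|lborel. f x) = I"
    unfolding set_lebesgue_integral_def
    using nn \<open>0 \<le> I\<close> nonneg by (subst integral_eq_nn_integral) (auto simp: indicator_def)
qed

lemma set_integral_powr_from_0:
  assumes "0 < a" "0 \<le> T"
  shows "set_integrable lborel {0<..T} (\<lambda>t::real. t powr (a - 1))" "(LINT t:{0<..T}|lborel. t powr (a - 1)) = T powr a / a"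
proof -
  have "((\<lambda>t::real. t powr (a - 1)) has_integral T powr a / a) {0..T}"
    using has_integral_powr_from_0[of "a - 1" T] assms by simp
  then have "((\<lambda>t::real. t powr (a - 1)) has_integral T powr a / a) {0<..T}"
    by (subst (asm) has_integral_spike_set_eq[where T = "{0<..T}"]) (auto intro: negligible_subset[of "{0}"])
  from has_integral_nonneg_lborel[OF _ _ _ this]
  show "set_integrable lborel {0<..T} (\<lambda>t::real. t powr (a - 1))" "(LINT t:{0<..T}|lborel. t powr (a - 1)) = T powr a / a"
    by auto
qed

lemma set_integral_powr_to_inf:
  assumes "0 < p" "0 < T"
  shows "set_integrable lborel {T<..} (\<lambda>t::real. t powr (- p - 1))" "(LINT t:{T<..}|lborel. t powr (- p - 1)) = T powr (- p) / p"
proof -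
  have "((\<lambda>t::real. t powr (- p - 1)) has_integral T powr (- p) / p) {T..}"
    using has_integral_powr_to_inf[of "- p - 1" T] assms by simp
  then have "((\<lambda>t::real. t powr (- p - 1)) has_integral T powr (- p) / p) {T<..}"
    by (subst (asm) has_integral_spike_set_eq[where T = "{T<..}"]) (auto intro: negligible_subset[of "{T}"])
  from has_integral_nonneg_lborel[OF _ _ _ this]
  show "set_integrable lborel {T<..} (\<lambda>t::real. t powr (- p - 1))" "(LINT t:{T<..}|lborel. t powr (- p - 1)) = T powr (- p) / p"
    by auto
qed

lemma set_integrable_comparison:
  fixes f g :: "real \<Rightarrow> real"
  assumes "set_integrable lborel S g" "f \<in> borel_measurable borel" "S \<in> sets borel"
    and "\<And>t. t \<in> S \<Longrightarrow> \<bar>f t\<bar> \<le> g t"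
  shows "set_integrable lborel S f"
proof (rule set_integrable_bound[OF assms(1)])
  show "set_borel_measurable lborel S f" unfolding set_borel_measurable_def using assms(2,3) by measurable
  show "AE x in lborel. x \<in> S \<longrightarrow> norm (f x) \<le> norm (g x)"
    using assms(4) by (auto intro!: AE_I2 intro: order_trans[OF _ abs_ge_self])
qed

lemma set_integral_nonneg':
  fixes f :: "real \<Rightarrow> real"
  assumes "\<And>t. t \<in> S \<Longrightarrow> 0 \<le> f t" shows "0 \<le> (LINT t:S|lborel. f t)"
  unfolding set_lebesgue_integral_def by (rule Bochner_Integration.integral_nonneg) (use assms in \<open>auto simp: indicator_def\<close>)

lemma set_integral_pos:
  fixes f :: "real \<Rightarrow> real"
  assumes "set_integrable lborel S f" "\<And>t. t \<in> S \<Longrightarrow> 0 < f t" "{a<..<b} \<subseteq> S" "a < b"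
  shows "0 < (LINT t:S|lborel. f t)"
proof -
  have "0 \<le> (LINT t:S|lborel. f t)" by (rule set_integral_nonneg') (use assms(2) in \<open>auto intro: less_imp_le\<close>)
  moreover have "(LINT t:S|lborel. f t) \<noteq> 0"
  proof
    assume z: "(LINT t:S|lborel. f t) = 0"
    have "AE t in lborel. indicator S t *\<^sub>R f t = 0"
      using z assms(1) unfolding set_lebesgue_integral_def set_integrable_def
      by (subst (asm) integral_nonneg_eq_0_iff_AE) (use assms(2) in \<open>auto simp: indicator_def intro: less_imp_le\<close>)
    then have "AE t in lborel. t \<notin> {a<..<b}"
      by (rule AE_mp) (use assms(2,3) in \<open>auto intro!: AE_I2 simp: indicator_def split: if_splits\<close>, force)
    then have "emeasure lborel {a<..<b} = 0" by (subst (asm) AE_iff_measurable[of "{a<..<b}"]) auto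
    then show False using assms(4) by simp
  qed
  ultimately show ?thesis by linarith
qed

text \<open>Tonelli between the lattice and time: the summands are nonnegative and lie below g, so
  integrability of g is enough for all of them.\<close>

lemma has_sum_set_integral:
  fixes f :: "real \<Rightarrow> 'a::countable \<Rightarrow> real"
  assumes S[measurable]: "S \<in> sets borel" and [measurable]: "\<And>y. (\<lambda>t. f t y) \<in> borel_measurable borel"
    and nonneg: "\<And>t y. t \<in> S \<Longrightarrow> 0 \<le> f t y"
    and sum: "\<And>t. t \<in> S \<Longrightarrow> (f t has_sum g t) UNIV"
    and g: "set_integrable lborel S g"
  shows "set_integrable lborel S (\<lambda>t. f t y)"
    and "((\<lambda>y. LINT t:S|lborel. f t y) has_sum (LINT t:S|lborel. g t)) UNIV"
proof -
  have le: "f t y \<le> g t" if "t \<in> S" for t y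
  proof -
    have "((\<lambda>z. if z = y then f t y else 0) has_sum f t y) UNIV"
      using has_sum_single[of y "\<lambda>z. if z = y then f t y else 0"] by simp
    then show ?thesis by (rule has_sum_mono[OF _ sum[OF that]]) (use nonneg[OF that] in auto)
  qed
  have g0: "0 \<le> g t" if "t \<in> S" for t using nonneg[OF that, of undefined] le[OF that, of undefined] by linarith
  show int: "set_integrable lborel S (\<lambda>t. f t y)" for y
    by (rule set_integrable_comparison[OF g]) (use nonneg le in auto)
  have nn: "(\<integral>\<^sup>+t. ennreal (indicator S t * f t y) \<partial>lborel) = ennreal (LINT t:S|lborel. f t y)" for y
    using int[of y] nonneg unfolding set_lebesgue_integral_def set_integrable_def
    by (subst nn_integral_eq_integral) (auto simp: indicator_def)
  show "((\<lambda>y. LINT t:S|lborel. f t y) has_sum (LINT t:S|lborel. g t)) UNIV"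
  proof (rule nn_integral_imp_has_sum)
    have "(\<integral>\<^sup>+y. ennreal (LINT t:S|lborel. f t y) \<partial>count_space UNIV) =
        (\<integral>\<^sup>+y. \<integral>\<^sup>+t. ennreal (indicator S t * f t y) \<partial>lborel \<partial>count_space UNIV)"
      by (simp only: nn)
    also have "\<dots> = (\<integral>\<^sup>+t. \<integral>\<^sup>+y. ennreal (indicator S t * f t y) \<partial>count_space UNIV \<partial>lborel)"
      by (rule nn_integral_count_space_nn_integral[symmetric]) auto
    also have "\<dots> = (\<integral>\<^sup>+t. ennreal (indicator S t * g t) \<partial>lborel)"
    proof (rule nn_integral_cong)
      fix t show "(\<integral>\<^sup>+y. ennreal (indicator S t * f t y) \<partial>count_space UNIV) = ennreal (indicator S t * g t)"
        using has_sum_imp_nn_integral[OF sum nonneg, of t] by (cases "t \<in> S") auto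
    qed
    also have "\<dots> = ennreal (LINT t:S|lborel. g t)"
      using g g0 unfolding set_lebesgue_integral_def set_integrable_def
      by (subst nn_integral_eq_integral) (auto simp: indicator_def)
    finally show "(\<integral>\<^sup>+y. ennreal (LINT t:S|lborel. f t y) \<partial>count_space UNIV) = ennreal (LINT t:S|lborel. g t)" .
  qed (auto intro!: set_integral_nonneg' nonneg g0)
qed

text \<open>The set S of times covers three cases: {0<..} gives the Riesz kernel of order -a,
  {0<..T} its truncation, {T<..} the tail.\<close>

definition pot :: "real set \<Rightarrow> real \<Rightarrow> int ^ 'd::finite \<Rightarrow> real" where
  "pot S a x = (LINT t:S|lborel. heat t x * t powr (a - 1)) / Gamma a"

lemma kappa_neg_eq_pot: "0 < a \<Longrightarrow> kappa (- a) (x :: int ^ 'd::finite) = pot {0<..} a x"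
proof -
  assume a: "0 < a"
  have "heat t x / t powr (1 + - a) = heat t x * t powr (a - 1)" for t
    using powr_minus_divide[of t "1 - a"] by simp
  then show ?thesis using a by (simp add: kappa_def pot_def abs_of_pos Gamma_real_pos)
qed

lemma heat_abs_le_1: "0 \<le> t \<Longrightarrow> \<bar>heat t (x :: int ^ 'd::finite)\<bar> \<le> 1"
  using heat_nonneg[of t x] heat_le_1[of t x] by simp

text \<open>Small times are integrable by a > 0 and the bound 1, large times by a < d/2 and the
  decay t^{-d/2}.\<close>

lemma heat_mult_powr_integrable:
  assumes "0 < a" "a < real CARD('d) / 2" and S[measurable]: "S \<in> sets borel" and "S \<subseteq> {0<..}"
  shows "set_integrable lborel S (\<lambda>t. heat t (x :: int ^ 'd::finite) * t powr (a - 1))"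
proof -
  obtain C where C: "0 < C" "\<And>t x. 0 < t \<Longrightarrow> heat t (x :: int ^ 'd) \<le> C * t powr (- real CARD('d) / 2)"
    using heat_upper by blast
  have "set_integrable lborel {0<..1} (\<lambda>t. heat t x * t powr (a - 1))"
    by (rule set_integrable_comparison[OF set_integral_powr_from_0(1)[of a 1]])
       (use assms heat_abs_le_1[of _ x] in \<open>auto simp: abs_mult intro!: mult_left_le_one_le\<close>)
  moreover have "set_integrable lborel {1<..} (\<lambda>t. heat t x * t powr (a - 1))"
  proof (rule set_integrable_comparison[where g = "\<lambda>t. C * t powr (- (real CARD('d) / 2 - a) - 1)"])
    show "set_integrable lborel {1<..} (\<lambda>t. C * t powr (- (real CARD('d) / 2 - a) - 1))"
      using assms by (intro set_integrable_mult_right set_integral_powr_to_inf) auto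
    fix t :: real assume t: "t \<in> {1<..}"
    have "heat t x * t powr (a - 1) \<le> C * t powr (- real CARD('d) / 2) * t powr (a - 1)"
      using C(2)[of t x] t by (intro mult_right_mono) auto
    also have "\<dots> = C * t powr (- (real CARD('d) / 2 - a) - 1)"
      using t by (simp add: mult.assoc powr_add[symmetric] algebra_simps)
    finally show "\<bar>heat t x * t powr (a - 1)\<bar> \<le> C * t powr (- (real CARD('d) / 2 - a) - 1)"
      using t heat_nonneg[of t x] by simp
  qed auto
  ultimately have "set_integrable lborel ({0<..1} \<union> {1<..}) (\<lambda>t. heat t x * t powr (a - 1))"
    by (rule set_integrable_Un) auto
  then show ?thesis by (rule set_integrable_subset) (use assms in auto)
qed

lemma pot_nonneg: 
  assumes "0 < a" "S \<subseteq> {0<..}" shows "0 \<le> pot S a (x :: int ^ 'd::finite)"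
proof -
  have "0 \<le> (LINT t:S|lborel. heat t x * t powr (a - 1))"
    using assms heat_nonneg[of _ x] by (intro set_integral_nonneg') (auto simp: less_imp_le subset_eq)
  then show ?thesis unfolding pot_def using Gamma_real_pos[OF assms(1)] by (intro divide_nonneg_pos)
qed

lemma pot_pos:
  assumes "0 < a" "a < real CARD('d) / 2" "S \<in> sets borel" "S \<subseteq> {0<..}" "{0<..<b} \<subseteq> S" "0 < b"
  shows "0 < pot S a (x :: int ^ 'd::finite)"
proof -
  have "0 < (LINT t:S|lborel. heat t x * t powr (a - 1))"
    by (rule set_integral_pos[where a = 0 and b = b])
       (use assms in \<open>auto intro!: heat_mult_powr_integrable mult_pos_pos heat_pos\<close>)
  then show ?thesis unfolding pot_def by (rule divide_pos_pos) (use assms Gamma_real_pos in auto)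
qed

lemma pot_split:
  assumes "0 < a" "a < real CARD('d) / 2" "0 \<le> T"
  shows "pot {0<..} a (x :: int ^ 'd::finite) = pot {0<..T} a x + pot {T<..} a x"
proof -
  have "{0<..} = {0<..T} \<union> {T<..}" using assms by auto
  moreover have "(LINT t:{0<..T} \<union> {T<..}|lborel. heat t x * t powr (a - 1))
      = (LINT t:{0<..T}|lborel. heat t x * t powr (a - 1)) + (LINT t:{T<..}|lborel. heat t x * t powr (a - 1))"
    by (rule set_integral_Un) (use assms in \<open>auto intro!: heat_mult_powr_integrable\<close>)
  ultimately show ?thesis by (simp add: pot_def add_divide_distrib)
qed

lemma pot_tail_le:
  assumes "0 < a" "a < real CARD('d) / 2"
  shows "\<exists>C>0. \<forall>T>0. \<forall>x::int ^ 'd::finite. pot {T<..} a x \<le> C * T powr (a - real CARD('d) / 2)"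
proof -
  let ?p = "real CARD('d) / 2 - a"
  obtain C where C: "0 < C" "\<And>t x. 0 < t \<Longrightarrow> heat t (x :: int ^ 'd) \<le> C * t powr (- real CARD('d) / 2)"
    using heat_upper by blast
  have "pot {T<..} a x \<le> C / (?p * Gamma a) * T powr (a - real CARD('d) / 2)" if T: "0 < T" for T and x :: "int ^ 'd"
  proof -
    have "(LINT t:{T<..}|lborel. heat t x * t powr (a - 1)) \<le> (LINT t:{T<..}|lborel. C * t powr (- ?p - 1))"
    proof (rule set_integral_mono)
      show "set_integrable lborel {T<..} (\<lambda>t. heat t x * t powr (a - 1))"
        by (rule heat_mult_powr_integrable) (use assms T in auto)
      show "set_integrable lborel {T<..} (\<lambda>t. C * t powr (- ?p - 1))"
        using assms T by (intro set_integrable_mult_right set_integral_powr_to_inf) auto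
      fix t assume t: "t \<in> {T<..}"
      have "heat t x * t powr (a - 1) \<le> C * t powr (- real CARD('d) / 2) * t powr (a - 1)"
        using C(2)[of t x] t T by (intro mult_right_mono) auto
      also have "\<dots> = C * t powr (- ?p - 1)"
        using t T by (simp add: mult.assoc powr_add[symmetric] algebra_simps)
      finally show "heat t x * t powr (a - 1) \<le> C * t powr (- ?p - 1)" .
    qed
    also have "\<dots> = C * (T powr (- ?p) / ?p)"
      using set_integral_powr_to_inf(2)[of ?p T] assms T by simp
    finally have "pot {T<..} a x \<le> C * (T powr (- ?p) / ?p) / Gamma a"
      unfolding pot_def using assms Gamma_real_pos[of a] by (intro divide_right_mono) auto
    then show ?thesis by (simp add: mult_ac)
  qed
  moreover have "0 < C / (?p * Gamma a)" using C assms Gamma_real_pos[of a] by simp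
  ultimately show ?thesis by blast
qed

text \<open>The heat kernel has mass 1 at every time, so the mass of early times is a power of T.
  Together with the uniform tail bound this produces all exponents of T below.\<close>

lemma pot_has_sum:
  assumes "0 < a" "0 \<le> T"
  shows "((\<lambda>x::int ^ 'd::finite. pot {0<..T} a x) has_sum T powr a / (a * Gamma a)) UNIV"
proof -
  have "((\<lambda>x::int ^ 'd. LINT t:{0<..T}|lborel. heat t x * t powr (a - 1)) has_sum (LINT t:{0<..T}|lborel. t powr (a - 1))) UNIV"
  proof (rule has_sum_set_integral)
    fix t assume t: "t \<in> {0<..T}"
    then show "((\<lambda>x::int ^ 'd. heat t x * t powr (a - 1)) has_sum t powr (a - 1)) UNIV"
      using has_sum_cmult_left[OF heat_mass[of t], of "t powr (a - 1)"] by simp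
    show "0 \<le> heat t x * t powr (a - 1)" for x :: "int ^ 'd" using t heat_nonneg[of t x] by simp
  qed (use assms in \<open>auto intro!: set_integral_powr_from_0\<close>)
  then have "((\<lambda>x::int ^ 'd. (LINT t:{0<..T}|lborel. heat t x * t powr (a - 1)) * (1 / Gamma a)) has_sum
      (LINT t:{0<..T}|lborel. t powr (a - 1)) * (1 / Gamma a)) UNIV"
    by (rule has_sum_cmult_left)
  then show ?thesis using assms by (simp add: pot_def set_integral_powr_from_0(2))
qed

lemma pot_bounded:
  assumes "0 < a" "a < real CARD('d) / 2" "S \<in> sets borel" "S \<subseteq> {0<..}"
  shows "\<exists>M>0. \<forall>x::int ^ 'd::finite. pot S a x \<le> M"
proof -
  obtain C where C: "0 < C" "\<And>T x. 0 < T \<Longrightarrow> pot {T<..} a (x :: int ^ 'd) \<le> C * T powr (a - real CARD('d) / 2)"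
    using pot_tail_le[OF assms(1,2)] by blast
  have "pot S a x \<le> 1 / (a * Gamma a) + C" for x :: "int ^ 'd"
  proof -
    have "(LINT t:S|lborel. heat t x * t powr (a - 1)) \<le> (LINT t:{0<..}|lborel. heat t x * t powr (a - 1))"
    proof -
      have "integrable lborel (\<lambda>t. indicator S t * (heat t x * t powr (a - 1)))"
        "integrable lborel (\<lambda>t. indicator {0<..} t * (heat t x * t powr (a - 1)))"
        using heat_mult_powr_integrable[OF assms, of x] heat_mult_powr_integrable[OF assms(1,2), of "{0<..}" x]
        by (simp_all add: set_integrable_def)
      then show ?thesis
        unfolding set_lebesgue_integral_def real_scaleR_def
        by (rule integral_mono) (use assms(4) heat_nonneg[of _ x] in \<open>auto simp: indicator_def\<close>)
    qed
    then have "pot S a x \<le> pot {0<..} a x"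
      unfolding pot_def using assms(1) by (intro divide_right_mono) (auto intro: less_imp_le Gamma_real_pos)
    also have "\<dots> = pot {0<..1} a x + pot {1<..} a x" by (rule pot_split) (use assms in auto)
    also have "pot {0<..1} a x \<le> 1 / (a * Gamma a)"
    proof -
      have "((\<lambda>y. if y = x then pot {0<..1} a x else 0) has_sum pot {0<..1} a x) UNIV"
        using has_sum_single[of x "\<lambda>y. if y = x then pot {0<..1} a x else 0"] by simp
      moreover have "((\<lambda>y::int ^ 'd. pot {0<..1} a y) has_sum 1 / (a * Gamma a)) UNIV"
        using pot_has_sum[OF assms(1), of 1] by simp
      ultimately show ?thesis
        by (rule has_sum_mono) (use pot_nonneg[OF assms(1), of "{0<..1}", where 'd = 'd] in \<open>auto simp: subset_eq\<close>)
    qed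
    also have "pot {1<..} a x \<le> C" using C(2)[of 1 x] by simp
    finally show ?thesis by simp
  qed
  moreover have "0 < 1 / (a * Gamma a) + C" using C assms Gamma_real_pos[of a] by (auto intro!: add_nonneg_pos)
  ultimately show ?thesis by blast
qed

text \<open>Convolution with the heat kernel at time s shifts time by s inside the
  potential.\<close>

lemma pot_semigroup:
  assumes "0 < a" "a < real CARD('d) / 2" "S \<in> sets borel" "S \<subseteq> {0<..}" "0 \<le> s"
  shows "set_integrable lborel S (\<lambda>t. heat (s + t) (x :: int ^ 'd::finite) * t powr (a - 1))"
    and "((\<lambda>y. heat s (x - y) * pot S a y) has_sum
      (LINT t:S|lborel. heat (s + t) (x :: int ^ 'd::finite) * t powr (a - 1)) / Gamma a) UNIV"
proof -
  obtain C where C: "0 < C" "\<And>t x. 0 < t \<Longrightarrow> heat t (x :: int ^ 'd) \<le> C * t powr (- real CARD('d) / 2)"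
    using heat_upper by blast
  have [measurable]: "(\<lambda>t. heat (s + t) x) \<in> borel_measurable borel"
    by (rule measurable_compose[OF _ heat_measurable]) simp
  have "set_integrable lborel {0<..1} (\<lambda>t. heat (s + t) x * t powr (a - 1))"
    by (rule set_integrable_comparison[OF set_integral_powr_from_0(1)[of a 1]])
       (use assms heat_abs_le_1[of "s + _" x] in \<open>auto simp: abs_mult intro!: mult_left_le_one_le\<close>)
  moreover have "set_integrable lborel {1<..} (\<lambda>t. heat (s + t) x * t powr (a - 1))"
  proof (rule set_integrable_comparison[where g = "\<lambda>t. C * t powr (- (real CARD('d) / 2 - a) - 1)"])
    show "set_integrable lborel {1<..} (\<lambda>t. C * t powr (- (real CARD('d) / 2 - a) - 1))"
      using assms by (intro set_integrable_mult_right set_integral_powr_to_inf) auto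
    fix t :: real assume t: "t \<in> {1<..}"
    have "heat (s + t) x \<le> C * (s + t) powr (- real CARD('d) / 2)" using C(2)[of "s + t" x] t assms by simp
    also have "\<dots> \<le> C * t powr (- real CARD('d) / 2)"
      using C(1) t assms by (intro mult_left_mono powr_mono2') auto
    finally have "heat (s + t) x * t powr (a - 1) \<le> C * t powr (- real CARD('d) / 2) * t powr (a - 1)"
      by (intro mult_right_mono) auto
    also have "\<dots> = C * t powr (- (real CARD('d) / 2 - a) - 1)"
      using t by (simp add: mult.assoc powr_add[symmetric] algebra_simps)
    finally show "\<bar>heat (s + t) x * t powr (a - 1)\<bar> \<le> C * t powr (- (real CARD('d) / 2 - a) - 1)"
      using t assms heat_nonneg[of "s + t" x] by simp
  qed auto
  ultimately have "set_integrable lborel ({0<..1} \<union> {1<..}) (\<lambda>t. heat (s + t) x * t powr (a - 1))"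
    by (rule set_integrable_Un) auto
  then show int: "set_integrable lborel S (\<lambda>t. heat (s + t) x * t powr (a - 1))"
    by (rule set_integrable_subset) (use assms in auto)
  have "((\<lambda>y. LINT t:S|lborel. heat s (x - y) * heat t y * t powr (a - 1)) has_sum
      (LINT t:S|lborel. heat (s + t) x * t powr (a - 1))) UNIV"
  proof (rule has_sum_set_integral)
    fix t assume "t \<in> S"
    then have "0 \<le> t" using assms by auto
    then show "((\<lambda>y. heat s (x - y) * heat t y * t powr (a - 1)) has_sum heat (s + t) x * t powr (a - 1)) UNIV"
      by (intro has_sum_cmult_left heat_semigroup assms)
    show "0 \<le> heat s (x - y) * heat t y * t powr (a - 1)" for y
      using \<open>0 \<le> t\<close> assms by (intro mult_nonneg_nonneg heat_nonneg) auto
  qed (use assms int in auto)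
  then have "((\<lambda>y. (LINT t:S|lborel. heat s (x - y) * heat t y * t powr (a - 1)) * (1 / Gamma a)) has_sum
      (LINT t:S|lborel. heat (s + t) x * t powr (a - 1)) * (1 / Gamma a)) UNIV"
    by (rule has_sum_cmult_left)
  then show "((\<lambda>y. heat s (x - y) * pot S a y) has_sum (LINT t:S|lborel. heat (s + t) x * t powr (a - 1)) / Gamma a) UNIV"
    by (simp add: pot_def mult.assoc)
qed

lemma heat_measurable_raw [measurable (raw)]:
  assumes "f \<in> borel_measurable M"
  shows "(\<lambda>w. heat (f w) (x :: int ^ 'd::finite)) \<in> borel_measurable M"
  by (rule measurable_compose[OF assms heat_measurable])

section \<open>The fractional Laplacian of a potential\<close>

text \<open>The difference of r_+^{\<alpha>-1} and its translate by s. Integrated against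
  s^{-1-\<sigma>} it is, up to normalisation, the Marchaud fractional derivative of a power.\<close>

definition marchaud :: "real \<Rightarrow> real \<Rightarrow> real \<Rightarrow> real" where
  "marchaud \<alpha> r s = r powr (\<alpha> - 1) - (if s < r then (r - s) powr (\<alpha> - 1) else 0)"

text \<open>Against v^{-1-\<sigma>} the two terms are not separately integrable at 0. Writing
  (1-v)^{\<alpha>-1} as (1-v)^\<alpha> + v (1-v)^{\<alpha>-1} regroups them into ?f1 - ?f2 on the
  unit interval: ?f2 is a Beta integrand and ?f1 reduces to it by parts. Beyond v = 1 only
  v^{-1-\<sigma>} is left.\<close>

lemma marchaud_base:
  assumes "0 < \<sigma>" "\<sigma> < 1" "\<sigma> < \<alpha>"
  shows "set_integrable lborel {0<..} (\<lambda>v. v powr (- 1 - \<sigma>) * marchaud \<alpha> 1 v)" (is ?A)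
    and "(LINT v:{0<..}|lborel. v powr (- 1 - \<sigma>) * marchaud \<alpha> 1 v) = Gamma (1 - \<sigma>) / \<sigma> * Gamma \<alpha> / Gamma (\<alpha> - \<sigma>)" (is ?B)
proof -
  have \<alpha>: "0 < \<alpha>" using assms by simp
  let ?f1 = "\<lambda>v::real. v powr (- 1 - \<sigma>) * (1 - (1 - v) powr \<alpha>)"
  let ?f2 = "\<lambda>v::real. v powr (1 - \<sigma> - 1) * (1 - v) powr (\<alpha> - 1)"
  define b where "b = Beta (1 - \<sigma>) \<alpha>"
  have B: "(?f2 has_integral b) {0..1}"
    using has_integral_Beta_real[of "1 - \<sigma>" \<alpha>] assms \<alpha> unfolding b_def by simp
  \<comment> \<open>The boundary term of the integration by parts; it is of order v^{1-\<sigma>} at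
    0 and so vanishes there.\<close>
  define F where "F v = v powr (- \<sigma>) * ((1 - v) powr \<alpha> - 1) / \<sigma>" for v :: real
  have "((\<lambda>v. ?f1 v - \<alpha> / \<sigma> * ?f2 v) has_integral F 1 - F 0) {0..1}"
  proof (rule fundamental_theorem_of_calculus_interior)
    show "continuous_on {0..1} F"
      unfolding continuous_on_def
    proof
      fix v :: real assume v: "v \<in> {0..1}"
      show "(F \<longlongrightarrow> F v) (at v within {0..1})"
      proof (cases "v = 0")
        case True
        have "((\<lambda>v::real. v powr (- \<sigma>) * ((1 - v) powr \<alpha> - 1) / \<sigma>) \<longlongrightarrow> 0) (at_right 0)"
          using assms \<alpha> by real_asymp
        then have "(F \<longlongrightarrow> 0) (at_right 0)" unfolding F_def .
        then have "(F \<longlongrightarrow> 0) (at 0 within {0..1})"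
          using at_within_Icc_at_right[of 0 "1::real"] by simp
        then show ?thesis using True by (simp add: F_def)
      next
        case False
        then show ?thesis
          using v assms \<alpha> unfolding F_def
          by (intro tendsto_intros tendsto_powr' tendsto_powr) (auto simp: eventually_at_filter)
      qed
    qed
    fix v :: real assume v: "v \<in> {0<..<1}"
    have "(F has_real_derivative ?f1 v - \<alpha> / \<sigma> * ?f2 v) (at v)"
      unfolding F_def using v assms
      by (auto intro!: derivative_eq_intros simp: powr_diff field_simps powr_minus)
    then show "(F has_vector_derivative ?f1 v - \<alpha> / \<sigma> * ?f2 v) (at v)"
      by (simp only: has_real_derivative_iff_has_vector_derivative)
  qed simp
  then have "((\<lambda>v. ?f1 v - \<alpha> / \<sigma> * ?f2 v + \<alpha> / \<sigma> * ?f2 v) has_integral F 1 - F 0 + \<alpha> / \<sigma> * b) {0..1}"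
    using B by (intro has_integral_add has_integral_mult_right)
  then have f1: "(?f1 has_integral - 1 / \<sigma> + \<alpha> / \<sigma> * b) {0..1}" by (simp add: F_def)
  have i1: "set_integrable lborel {0..1} ?f1" "(LINT v:{0..1}|lborel. ?f1 v) = - 1 / \<sigma> + \<alpha> / \<sigma> * b"
  proof -
    have "0 \<le> ?f1 v" if "v \<in> {0..1}" for v
      using that \<alpha> powr_le1[of \<alpha> "1 - v"] by simp
    from has_integral_nonneg_lborel[OF _ _ this f1]
    show "set_integrable lborel {0..1} ?f1" "(LINT v:{0..1}|lborel. ?f1 v) = - 1 / \<sigma> + \<alpha> / \<sigma> * b" by auto
  qed
  have i2: "set_integrable lborel {0..1} ?f2" "(LINT v:{0..1}|lborel. ?f2 v) = b"
    using has_integral_nonneg_lborel[OF _ _ _ B] by auto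
  let ?J = "\<lambda>v. v powr (- 1 - \<sigma>) * marchaud \<alpha> 1 v"
  have J: "?J v = ?f1 v - ?f2 v" if "v \<in> {0..1}" for v
  proof (cases "0 < v \<and> v < 1")
    case True
    have "(1 - v) powr \<alpha> = (1 - v) * (1 - v) powr (\<alpha> - 1)"
      using True powr_mult_base[of "1 - v" "\<alpha> - 1"] by simp
    moreover have "v powr (1 - \<sigma> - 1) = v * v powr (- 1 - \<sigma>)"
      using True powr_mult_base[of v "- 1 - \<sigma>"] by simp
    ultimately have "?f1 v - ?f2 v = v powr (- 1 - \<sigma>) * (1 - ((1 - v) * (1 - v) powr (\<alpha> - 1)) - v * (1 - v) powr (\<alpha> - 1))"
      by (simp only:) (simp add: right_diff_distrib mult_ac)
    also have "\<dots> = v powr (- 1 - \<sigma>) * (1 - (1 - v) powr (\<alpha> - 1))"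
      by (simp add: left_diff_distrib)
    finally show ?thesis using True by (simp add: marchaud_def)
  next
    case False
    \<comment> \<open>At the endpoints the identity rests on the convention that powers of 0 are
      0.\<close>
    then have "v = 0 \<or> v = 1" using that by auto
    then show ?thesis using assms \<alpha> by (auto simp: marchaud_def)
  qed
  have i01: "set_integrable lborel {0..1} ?J" "(LINT v:{0..1}|lborel. ?J v) = - 1 / \<sigma> + \<alpha> / \<sigma> * b - b"
  proof -
    have "set_integrable lborel {0..1} (\<lambda>v. ?f1 v - ?f2 v)" by (intro set_integral_diff i1 i2)
    then show "set_integrable lborel {0..1} ?J"
      by (rule iffD1[OF set_integrable_cong[OF refl refl], rotated]) (simp add: J)
    have "(LINT v:{0..1}|lborel. ?J v) = (LINT v:{0..1}|lborel. ?f1 v - ?f2 v)"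
      by (rule set_lebesgue_integral_cong) (simp_all add: J)
    then show "(LINT v:{0..1}|lborel. ?J v) = - 1 / \<sigma> + \<alpha> / \<sigma> * b - b"
      using set_integral_diff(2)[OF i1(1) i2(1)] i1(2) i2(2) by (simp only:)
  qed
  have p: "- 1 - \<sigma> = - \<sigma> - 1" by simp
  have J1: "?J v = v powr (- \<sigma> - 1)" if "v \<in> {1<..}" for v
    using that by (simp add: marchaud_def p)
  have i1inf: "set_integrable lborel {1<..} ?J" "(LINT v:{1<..}|lborel. ?J v) = 1 / \<sigma>"
  proof -
    show "set_integrable lborel {1<..} ?J"
      using set_integral_powr_to_inf(1)[of \<sigma> 1] assms
      by (subst set_integrable_cong[OF refl refl J1]) auto
    have "(LINT v:{1<..}|lborel. ?J v) = (LINT v:{1<..}|lborel. v powr (- \<sigma> - 1))"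
      by (rule set_lebesgue_integral_cong) (simp_all add: J1)
    then show "(LINT v:{1<..}|lborel. ?J v) = 1 / \<sigma>"
      using set_integral_powr_to_inf(2)[of \<sigma> 1] assms by simp
  qed
  have U: "{0..1} \<union> {1<..} = {0::real..}" by auto
  have iU: "set_integrable lborel {0..} ?J"
    unfolding U[symmetric] by (intro set_integrable_Un i01 i1inf) auto
  then show ?A by (rule set_integrable_subset) auto
  have "(LINT v:{0<..}|lborel. ?J v) = (LINT v:{0..}|lborel. ?J v)"
    by (rule set_integral_discrete_difference[where X = "{0}"]) auto
  also have "\<dots> = - 1 / \<sigma> + \<alpha> / \<sigma> * b - b + 1 / \<sigma>"
    unfolding U[symmetric] using i01 i1inf by (subst set_integral_Un) auto
  also have "\<dots> = (\<alpha> - \<sigma>) / \<sigma> * b" using assms by (simp add: field_simps)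
  also have "b = Gamma (1 - \<sigma>) * Gamma \<alpha> / ((\<alpha> - \<sigma>) * Gamma (\<alpha> - \<sigma>))"
  proof -
    have "Gamma (\<alpha> - \<sigma> + 1) = (\<alpha> - \<sigma>) * Gamma (\<alpha> - \<sigma>)"
      by (rule Gamma_plus1) (use assms in \<open>auto elim!: nonpos_Ints_cases\<close>)
    moreover have "1 - \<sigma> + \<alpha> = \<alpha> - \<sigma> + 1" by simp
    ultimately show ?thesis unfolding b_def Beta_def by (simp only:)
  qed
  finally show ?B using assms by simp
qed

lemma marchaud_scale:
  assumes "0 < r" "0 < v" shows "marchaud \<alpha> r (r * v) = r powr (\<alpha> - 1) * marchaud \<alpha> 1 v"
proof -
  have "(r - r * v) powr (\<alpha> - 1) = r powr (\<alpha> - 1) * (1 - v) powr (\<alpha> - 1)" if "v < 1"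
    using assms that powr_mult[of r "1 - v" "\<alpha> - 1"] by (simp add: algebra_simps)
  moreover have "r * v < r \<longleftrightarrow> v < 1" using assms by simp
  ultimately show ?thesis by (simp add: marchaud_def right_diff_distrib)
qed

lemma marchaud_measurable [measurable (raw)]:
  assumes [measurable]: "f \<in> borel_measurable M" "g \<in> borel_measurable M"
  shows "(\<lambda>w. marchaud \<alpha> (f w) (g w)) \<in> borel_measurable M"
  unfolding marchaud_def by measurable

text \<open>Scaling s = r v reduces to r = 1. The case h = abs supplies the absolute integrability
  for Fubini, the identity supplies the value.\<close>

lemma marchaud_integral:
  fixes h :: "real \<Rightarrow> real"
  assumes r: "0 < r" and h: "h = (\<lambda>x. x) \<or> h = abs"
    and \<sigma>: "0 < \<sigma>" "\<sigma> < 1" "\<sigma> < \<alpha>"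
  shows "set_integrable lborel {0<..} (\<lambda>s. h (s powr (- 1 - \<sigma>) * marchaud \<alpha> r s))"
    and "(LINT s:{0<..}|lborel. h (s powr (- 1 - \<sigma>) * marchaud \<alpha> r s))
      = r powr (\<alpha> - \<sigma> - 1) * (LINT s:{0<..}|lborel. h (s powr (- 1 - \<sigma>) * marchaud \<alpha> 1 s))"
proof -
  let ?f = "\<lambda>r s. indicator {0<..} s * h (s powr (- 1 - \<sigma>) * marchaud \<alpha> r s)"
  have eq: "?f r (0 + r * v) = r powr (\<alpha> - \<sigma> - 2) * ?f 1 v" for v
  proof (cases "0 < v")
    case True
    have e: "r powr (- 1 - \<sigma>) * r powr (\<alpha> - 1) = r powr (\<alpha> - \<sigma> - 2)"
      by (simp add: powr_add[symmetric])
    have "(r * v) powr (- 1 - \<sigma>) * marchaud \<alpha> r (r * v) = r powr (\<alpha> - \<sigma> - 2) * (v powr (- 1 - \<sigma>) * marchaud \<alpha> 1 v)"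
      unfolding e[symmetric] using r True by (simp add: marchaud_scale powr_mult)
    then show ?thesis using r True h by (auto simp: abs_mult zero_less_mult_iff)
  qed (use r in \<open>auto simp: zero_less_mult_iff\<close>)
  have base: "set_integrable lborel {0<..} (\<lambda>s. h (s powr (- 1 - \<sigma>) * marchaud \<alpha> 1 s))"
    using marchaud_base(1)[OF \<sigma>] h by (auto intro: set_integrable_abs)
  then have "integrable lborel (\<lambda>v. r powr (\<alpha> - \<sigma> - 2) * ?f 1 v)"
    unfolding set_integrable_def by simp
  then have "integrable lborel (\<lambda>v. ?f r (0 + r * v))" unfolding eq .
  then have "integrable lborel (?f r)"
    using lborel_integrable_real_affine_iff[of r "?f r" 0] r by simp
  then show "set_integrable lborel {0<..} (\<lambda>s. h (s powr (- 1 - \<sigma>) * marchaud \<alpha> r s))"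
    by (simp add: set_integrable_def)
  have "(\<integral>s. ?f r s \<partial>lborel) = \<bar>r\<bar> *\<^sub>R (\<integral>v. ?f r (0 + r * v) \<partial>lborel)"
    by (rule lborel_integral_real_affine) (use r in auto)
  also have "\<dots> = r * r powr (\<alpha> - \<sigma> - 2) * (\<integral>v. ?f 1 v \<partial>lborel)"
    unfolding eq using r by simp
  also have "r * r powr (\<alpha> - \<sigma> - 2) = r powr (\<alpha> - \<sigma> - 1)"
    using powr_mult_base[of r "\<alpha> - \<sigma> - 2"] r by simp
  finally show "(LINT s:{0<..}|lborel. h (s powr (- 1 - \<sigma>) * marchaud \<alpha> r s))
      = r powr (\<alpha> - \<sigma> - 1) * (LINT s:{0<..}|lborel. h (s powr (- 1 - \<sigma>) * marchaud \<alpha> 1 s))"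
    by (simp add: set_lebesgue_integral_def)
qed

text \<open>\<open>S\<close> is either \<open>{0<..}\<close> or \<open>{0<..T}\<close>; shifting time by \<open>s\<close> pushes part of the mass of the truncated
  potential beyond \<open>T\<close>, whence the inequality.\<close>

lemma pot_minus_shift_le:
  fixes x :: "int ^ 'd::finite"
  assumes a: "0 < \<alpha>" "\<alpha> < real CARD('d) / 2" and S[measurable]: "S \<in> sets borel" and sub: "S \<subseteq> {0<..}"
    and down: "\<And>r s. r \<in> S \<Longrightarrow> 0 < s \<Longrightarrow> s < r \<Longrightarrow> r - s \<in> S" and s: "0 < s"
  defines "P \<equiv> (LINT t:S|lborel. heat (s + t) x * t powr (\<alpha> - 1))"
  defines "R \<equiv> (LINT r:S|lborel. heat r x * marchaud \<alpha> r s)"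
  shows "(LINT t:S|lborel. heat t x * t powr (\<alpha> - 1)) - P \<le> R"
    and "S = {0<..} \<Longrightarrow> (LINT t:S|lborel. heat t x * t powr (\<alpha> - 1)) - P = R"
proof -
  let ?h = "\<lambda>t. indicator S t * (heat (s + t) x * t powr (\<alpha> - 1))"
  let ?g = "\<lambda>r. indicator S r * (heat r x * (if s < r then (r - s) powr (\<alpha> - 1) else 0))"
  have ih: "integrable lborel ?h"
    using pot_semigroup(1)[OF a S sub, of s x] s by (simp add: set_integrable_def)
  then have ih': "integrable lborel (\<lambda>r. ?h (- s + 1 * r))"
    by (intro lborel_integrable_real_affine) auto
  have Ph: "P = (\<integral>r. ?h (- s + 1 * r) \<partial>lborel)"
    unfolding P_def set_lebesgue_integral_def using lborel_integral_real_affine[of 1 ?h "- s"] by simp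
  have le: "?g r \<le> ?h (- s + 1 * r)" and g0: "0 \<le> ?g r" for r
  proof -
    show "?g r \<le> ?h (- s + 1 * r)"
    proof (cases "r \<in> S \<and> s < r")
      case True
      then have "r - s \<in> S" using down s by blast
      then show ?thesis using True by (simp add: indicator_def)
    next
      case False
      have "0 \<le> ?h (- s + 1 * r)"
        using sub s heat_nonneg[of r x] by (auto simp: indicator_def)
      then show ?thesis using False by (auto simp: indicator_def)
    qed
    show "0 \<le> ?g r" using sub s heat_nonneg[of r x] by (auto simp: indicator_def)
  qed
  have ig: "integrable lborel ?g"
  proof (rule Bochner_Integration.integrable_bound[OF ih'])
    show "AE r in lborel. norm (?g r) \<le> norm (?h (- s + 1 * r))"
    proof (intro AE_I2)
      fix r show "norm (?g r) \<le> norm (?h (- s + 1 * r))"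
        using order_trans[OF le[of r] abs_ge_self] abs_of_nonneg[OF g0[of r]] by (simp only: real_norm_def)
    qed
  qed measurable
  have iS: "set_integrable lborel S (\<lambda>t. heat t x * t powr (\<alpha> - 1))"
    by (rule heat_mult_powr_integrable[OF a S sub])
  have R: "R = (LINT t:S|lborel. heat t x * t powr (\<alpha> - 1)) - (\<integral>r. ?g r \<partial>lborel)"
  proof -
    have "R = (LINT r:S|lborel. heat r x * r powr (\<alpha> - 1) - heat r x * (if s < r then (r - s) powr (\<alpha> - 1) else 0))"
      unfolding R_def marchaud_def by (simp add: right_diff_distrib)
    also have "\<dots> = (LINT t:S|lborel. heat t x * t powr (\<alpha> - 1)) - (LINT r:S|lborel. heat r x * (if s < r then (r - s) powr (\<alpha> - 1) else 0))"
      using iS ig by (intro set_integral_diff) (auto simp: set_integrable_def)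
    finally show ?thesis by (simp add: set_lebesgue_integral_def)
  qed
  have "(\<integral>r. ?g r \<partial>lborel) \<le> P"
    unfolding Ph by (rule integral_mono[OF ig ih' le])
  then show "(LINT t:S|lborel. heat t x * t powr (\<alpha> - 1)) - P \<le> R" using R by simp
  assume full: "S = {0<..}"
  have "?g r = ?h (- s + 1 * r)" for r
    using s by (auto simp: full indicator_def)
  then have "(\<integral>r. ?g r \<partial>lborel) = P" unfolding Ph by (intro Bochner_Integration.integral_cong refl)
  then show "(LINT t:S|lborel. heat t x * t powr (\<alpha> - 1)) - P = R" using R by simp
qed

text \<open>Integrating over s first leaves a constant times r^{\<alpha>-\<sigma>-1}, the time
  density of the potential of order \<alpha> - \<sigma>.\<close>

lemma marchaud_Fubini:
  assumes \<sigma>: "0 < \<sigma>" "\<sigma> < 1" "\<sigma> < \<alpha>" and \<alpha>: "\<alpha> < real CARD('d) / 2"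
    and S[measurable]: "S \<in> sets borel" and sub: "S \<subseteq> {0<..}"
  shows "set_integrable lborel {0<..} (\<lambda>s. s powr (- 1 - \<sigma>) * (LINT r:S|lborel. heat r (x :: int ^ 'd::finite) * marchaud \<alpha> r s))"
    and "(LINT s:{0<..}|lborel. s powr (- 1 - \<sigma>) * (LINT r:S|lborel. heat r x * marchaud \<alpha> r s))
      = Gamma (1 - \<sigma>) / \<sigma> * Gamma \<alpha> * pot S (\<alpha> - \<sigma>) x"
proof -
  let ?F = "\<lambda>r s. indicator S r * heat r x * (indicator {0<..} s * (s powr (- 1 - \<sigma>) * marchaud \<alpha> r s))"
  define c where "c = (LINT s:{0<..}|lborel. \<bar>s powr (- 1 - \<sigma>) * marchaud \<alpha> 1 s\<bar>)"
  have iS: "set_integrable lborel S (\<lambda>r. heat r x * r powr (\<alpha> - \<sigma> - 1))"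
    by (rule heat_mult_powr_integrable) (use \<sigma> \<alpha> S sub in auto)
  have row: "integrable lborel (?F r)" for r
  proof (cases "r \<in> S")
    case True
    then show ?thesis using marchaud_integral(1)[of r "\<lambda>x. x" \<sigma> \<alpha>] \<sigma> sub
      by (auto simp: set_integrable_def)
  qed simp
  have "integrable (lborel \<Otimes>\<^sub>M lborel) (\<lambda>(r, s). ?F r s)"
  proof (rule lborel_pair.Fubini_integrable)
    have "(\<integral>s. norm (?F r s) \<partial>lborel) = c * (indicator S r * (heat r x * r powr (\<alpha> - \<sigma> - 1)))" for r
    proof (cases "r \<in> S")
      case True
      then have r: "0 < r" using sub by auto
      have "(\<integral>s. norm (?F r s) \<partial>lborel) = (\<integral>s. heat r x * (indicator {0<..} s * \<bar>s powr (- 1 - \<sigma>) * marchaud \<alpha> r s\<bar>) \<partial>lborel)"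
        using True r heat_nonneg[of r x] by (intro Bochner_Integration.integral_cong) (auto simp: abs_mult)
      also have "\<dots> = heat r x * (r powr (\<alpha> - \<sigma> - 1) * c)"
        using marchaud_integral(2)[of r abs \<sigma> \<alpha>] r \<sigma> by (simp add: set_lebesgue_integral_def c_def)
      finally show ?thesis using True by simp
    qed simp
    then show "integrable lborel (\<lambda>r. \<integral>s. norm (case (r, s) of (r, s) \<Rightarrow> ?F r s) \<partial>lborel)"
      using iS by (simp add: set_integrable_def)
    show "AE r in lborel. integrable lborel (\<lambda>s. case (r, s) of (r, s) \<Rightarrow> ?F r s)"
      using row by simp
  qed measurable
  note I = this
  have inner: "(\<integral>r. ?F r s \<partial>lborel) = indicator {0<..} s * (s powr (- 1 - \<sigma>) * (LINT r:S|lborel. heat r x * marchaud \<alpha> r s))" for s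
  proof -
    have "(\<integral>r. ?F r s \<partial>lborel) = (\<integral>r. (indicator {0<..} s * s powr (- 1 - \<sigma>)) * (indicator S r * (heat r x * marchaud \<alpha> r s)) \<partial>lborel)"
      by (intro Bochner_Integration.integral_cong) (auto simp: mult_ac)
    then show ?thesis by (simp add: set_lebesgue_integral_def)
  qed
  show "set_integrable lborel {0<..} (\<lambda>s. s powr (- 1 - \<sigma>) * (LINT r:S|lborel. heat r x * marchaud \<alpha> r s))"
    using lborel_pair.integrable_snd[OF I] unfolding inner by (simp add: set_integrable_def)
  have "(LINT s:{0<..}|lborel. s powr (- 1 - \<sigma>) * (LINT r:S|lborel. heat r x * marchaud \<alpha> r s)) = (\<integral>s. \<integral>r. ?F r s \<partial>lborel \<partial>lborel)"
    unfolding inner by (simp add: set_lebesgue_integral_def)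
  also have "\<dots> = (\<integral>r. \<integral>s. ?F r s \<partial>lborel \<partial>lborel)"
    by (rule lborel_pair.Fubini_integral[OF I])
  also have "\<dots> = (\<integral>r. (Gamma (1 - \<sigma>) / \<sigma> * Gamma \<alpha> / Gamma (\<alpha> - \<sigma>)) * (indicator S r * (heat r x * r powr (\<alpha> - \<sigma> - 1))) \<partial>lborel)"
  proof (rule Bochner_Integration.integral_cong[OF refl])
    fix r
    show "(\<integral>s. ?F r s \<partial>lborel) = (Gamma (1 - \<sigma>) / \<sigma> * Gamma \<alpha> / Gamma (\<alpha> - \<sigma>)) * (indicator S r * (heat r x * r powr (\<alpha> - \<sigma> - 1)))"
    proof (cases "r \<in> S")
      case True
      then have r: "0 < r" using sub by auto
      show ?thesis
        using marchaud_integral(2)[of r "\<lambda>x. x" \<sigma> \<alpha>] marchaud_base(2)[OF \<sigma>] r \<sigma> True by (simp add: set_lebesgue_integral_def)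
    qed simp
  qed
  also have "\<dots> = Gamma (1 - \<sigma>) / \<sigma> * Gamma \<alpha> * pot S (\<alpha> - \<sigma>) x"
    by (simp add: pot_def set_lebesgue_integral_def)
  finally show "(LINT s:{0<..}|lborel. s powr (- 1 - \<sigma>) * (LINT r:S|lborel. heat r x * marchaud \<alpha> r s))
      = Gamma (1 - \<sigma>) / \<sigma> * Gamma \<alpha> * pot S (\<alpha> - \<sigma>) x" .
qed

section \<open>The convolution kernel for \<sigma> < 1\<close>

lemma one_minus_heat_0_le: "0 \<le> s \<Longrightarrow> 1 - heat s (0 :: int ^ 'd::finite) \<le> 2 * real CARD('d) * s"
proof -
  assume s: "0 \<le> s"
  let ?a = "\<lambda>n. exp (- 2 * real CARD('d) * s) * (walks n (0 :: int ^ 'd) * s ^ n / fact n)"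
  \<comment> \<open>The term n = 0 is the probability that the walk has not moved by time s.\<close>
  have "?a 0 \<le> heat s (0 :: int ^ 'd)"
    using sum_le_suminf[of ?a "{0}"] heat_walks_sums[of s "0 :: int ^ 'd"] s by (simp add: sums_iff walks_nonneg)
  moreover have "1 + (- 2 * real CARD('d) * s) \<le> exp (- 2 * real CARD('d) * s)" by (rule exp_ge_add_one_self)
  ultimately show ?thesis by simp
qed

lemma abs_Gamma_neg: "0 < \<sigma> \<Longrightarrow> \<sigma> < 1 \<Longrightarrow> \<bar>Gamma (- \<sigma>)\<bar> = Gamma (1 - \<sigma>) / \<sigma>" for \<sigma> :: real
proof -
  assume \<sigma>: "0 < \<sigma>" "\<sigma> < 1"
  have "- \<sigma> \<notin> \<int>\<^sub>\<le>\<^sub>0"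
  proof
    assume "- \<sigma> \<in> \<int>\<^sub>\<le>\<^sub>0"
    then obtain n where "- \<sigma> = real_of_int n" by (auto elim!: nonpos_Ints_cases)
    then have "n < 0" "- 1 < n" using \<sigma> by linarith+
    then show False by simp
  qed
  then have "Gamma (- \<sigma> + 1) = - \<sigma> * Gamma (- \<sigma>)" by (rule Gamma_plus1)
  then have "Gamma (- \<sigma>) = - (Gamma (1 - \<sigma>) / \<sigma>)" using \<sigma> by (simp add: field_simps)
  moreover have "0 < Gamma (1 - \<sigma>)" using \<sigma> by (intro Gamma_real_pos) simp
  ultimately show ?thesis using \<sigma> by simp
qed

lemma kappa_frac_eq:
  assumes "0 < \<sigma>" "\<sigma> < 1"
  shows "kappa \<sigma> (x :: int ^ 'd::finite) =
    (LINT s:{0<..}|lborel. (if x = 0 then 0 else heat s x) * s powr (- 1 - \<sigma>)) / \<bar>Gamma (- \<sigma>)\<bar>"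
proof -
  have "heat s x / s powr (1 + \<sigma>) = heat s x * s powr (- 1 - \<sigma>)" for s
    using powr_minus_divide[of s "1 + \<sigma>"] by simp
  then show ?thesis using assms by (simp add: kappa_def)
qed

lemma heat_defect_integrable:
  assumes "0 < \<sigma>" "\<sigma> < 1"
  shows "set_integrable lborel {0<..} (\<lambda>s. (1 - heat s (0 :: int ^ 'd::finite)) * s powr (- 1 - \<sigma>))"
proof -
  have "set_integrable lborel {0<..1} (\<lambda>s. (1 - heat s (0 :: int ^ 'd)) * s powr (- 1 - \<sigma>))"
  proof (rule set_integrable_comparison[where g = "\<lambda>s. 2 * real CARD('d) * s powr ((1 - \<sigma>) - 1)"])
    show "set_integrable lborel {0<..1} (\<lambda>s. 2 * real CARD('d) * s powr ((1 - \<sigma>) - 1))"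
      using assms by (intro set_integrable_mult_right set_integral_powr_from_0) auto
    fix s :: real assume s: "s \<in> {0<..1}"
    have "(1 - heat s (0 :: int ^ 'd)) * s powr (- 1 - \<sigma>) \<le> 2 * real CARD('d) * s * s powr (- 1 - \<sigma>)"
      using s by (intro mult_right_mono one_minus_heat_0_le) auto
    also have "\<dots> = 2 * real CARD('d) * s powr ((1 - \<sigma>) - 1)"
      using powr_mult_base[of s "- 1 - \<sigma>"] s by simp
    finally show "\<bar>(1 - heat s (0 :: int ^ 'd)) * s powr (- 1 - \<sigma>)\<bar> \<le> 2 * real CARD('d) * s powr ((1 - \<sigma>) - 1)"
      using s heat_le_1[of s "0 :: int ^ 'd"] by simp
  qed auto
  moreover have "set_integrable lborel {1<..} (\<lambda>s. (1 - heat s (0 :: int ^ 'd)) * s powr (- 1 - \<sigma>))"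
  proof (rule set_integrable_comparison[where g = "\<lambda>s. s powr (- \<sigma> - 1)"])
    show "set_integrable lborel {1<..} (\<lambda>s. s powr (- \<sigma> - 1))"
      using assms by (intro set_integral_powr_to_inf) auto
    fix s :: real assume s: "s \<in> {1<..}"
    have "(1 - heat s (0 :: int ^ 'd)) * s powr (- 1 - \<sigma>) \<le> 1 * s powr (- 1 - \<sigma>)"
      using s heat_nonneg[of s "0 :: int ^ 'd"] by (intro mult_right_mono) auto
    moreover have p: "- 1 - \<sigma> = - \<sigma> - 1" by simp
    moreover have "0 \<le> (1 - heat s (0 :: int ^ 'd)) * s powr (- 1 - \<sigma>)"
      using s heat_le_1[of s "0 :: int ^ 'd"] by simp
    ultimately show "\<bar>(1 - heat s (0 :: int ^ 'd)) * s powr (- 1 - \<sigma>)\<bar> \<le> s powr (- \<sigma> - 1)"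
      unfolding p by simp
  qed auto
  ultimately have "set_integrable lborel ({0<..1} \<union> {1<..}) (\<lambda>s. (1 - heat s (0 :: int ^ 'd)) * s powr (- 1 - \<sigma>))"
    by (rule set_integrable_Un) auto
  moreover have "{0<..1} \<union> {1<..} = {0::real<..}" by auto
  ultimately show ?thesis by simp
qed

text \<open>The value 0 at the origin removes the part of the heat kernel that s^{-1-\<sigma>}
  cannot absorb; the remaining mass 1 - \<open>heat s 0\<close> is of order s for small s.\<close>

lemma kappa_frac_sum:
  assumes "0 < \<sigma>" "\<sigma> < 1"
  shows "((\<lambda>x :: int ^ 'd::finite. kappa \<sigma> x) has_sum
    (LINT s:{0<..}|lborel. (1 - heat s (0 :: int ^ 'd)) * s powr (- 1 - \<sigma>)) / \<bar>Gamma (- \<sigma>)\<bar>) UNIV"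
    and "x \<noteq> 0 \<Longrightarrow> 0 < kappa \<sigma> (x :: int ^ 'd::finite)"
proof -
  have g: "0 < \<bar>Gamma (- \<sigma>)\<bar>" using abs_Gamma_neg[OF assms] Gamma_real_pos[of "1 - \<sigma>"] assms by simp
  have sum: "((\<lambda>x :: int ^ 'd. (if x = 0 then 0 else heat s x) * s powr (- 1 - \<sigma>)) has_sum (1 - heat s (0 :: int ^ 'd)) * s powr (- 1 - \<sigma>)) UNIV"
    if "s \<in> {0<..}" for s
  proof -
    have "((\<lambda>x :: int ^ 'd. heat s x + - (if x = 0 then heat s x else 0)) has_sum 1 + - heat s (0 :: int ^ 'd)) UNIV"
      using that has_sum_single[of "0 :: int ^ 'd" "\<lambda>x. if x = 0 then heat s x else 0"]
      by (intro has_sum_add heat_mass iffD2[OF has_sum_uminus]) auto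
    moreover have "heat s x + - (if x = 0 then heat s x else 0) = (if x = 0 then 0 else heat s x)" for x :: "int ^ 'd" by simp
    ultimately have "((\<lambda>x :: int ^ 'd. if x = 0 then 0 else heat s x) has_sum 1 - heat s (0 :: int ^ 'd)) UNIV" by simp
    then show ?thesis by (rule has_sum_cmult_left)
  qed
  have m: "(\<lambda>s. (if x = 0 then 0 else heat s x) * s powr (- 1 - \<sigma>)) \<in> borel_measurable borel" for x :: "int ^ 'd"
    by (cases "x = 0") auto
  have n: "0 \<le> (if x = 0 then 0 else heat s x) * s powr (- 1 - \<sigma>)" if "s \<in> {0<..}" for s and x :: "int ^ 'd"
    using that heat_nonneg[of s x] by simp
  have S: "{0::real<..} \<in> sets borel" by simp
  note * = has_sum_set_integral[where f = "\<lambda>s (x :: int ^ 'd). (if x = 0 then 0 else heat s x) * s powr (- 1 - \<sigma>)",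
      OF S m n sum heat_defect_integrable[OF assms]]
  show "((\<lambda>x :: int ^ 'd. kappa \<sigma> x) has_sum
    (LINT s:{0<..}|lborel. (1 - heat s (0 :: int ^ 'd)) * s powr (- 1 - \<sigma>)) / \<bar>Gamma (- \<sigma>)\<bar>) UNIV"
    using has_sum_cmult_left[OF *(2), of "1 / \<bar>Gamma (- \<sigma>)\<bar>"] by (simp add: kappa_frac_eq[OF assms])
  assume x: "x \<noteq> 0"
  have "0 < (LINT s:{0<..}|lborel. (if x = 0 then 0 else heat s x) * s powr (- 1 - \<sigma>))"
    by (rule set_integral_pos[where a = 0 and b = 1]) (use *(1)[of x] x heat_pos[of _ x] in auto)
  then show "0 < kappa \<sigma> x" unfolding kappa_frac_eq[OF assms] using g by simp
qed

lemma has_sum_neg: "(f has_sum s) A \<Longrightarrow> ((\<lambda>x. - f x) has_sum - (s :: real)) A"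
  by (simp add: has_sum_uminus)

text \<open>Off the diagonal the kernel is a time average of heat kernels, so the left side is the
  integral of v - e^{-s\<Delta>} v against s^{-1-\<sigma>} / |\<Gamma>(-\<sigma>)|, for v the
  potential. The semigroup shifts the time in v, the shift is at worst a Marchaud difference, and
  its integral over s lowers the order from \<alpha> to \<alpha> - \<sigma>.\<close>

lemma pot_operator_frac:
  fixes x :: "int ^ 'd::finite"
  assumes \<sigma>: "0 < \<sigma>" "\<sigma> < 1" "\<sigma> < \<alpha>" and \<alpha>: "\<alpha> < real CARD('d) / 2"
    and S[measurable]: "S \<in> sets borel" and sub: "S \<subseteq> {0<..}"
    and down: "\<And>r s. r \<in> S \<Longrightarrow> 0 < s \<Longrightarrow> s < r \<Longrightarrow> r - s \<in> S"
    and k: "((\<lambda>x :: int ^ 'd. kappa \<sigma> x) has_sum k) UNIV"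
  shows "\<exists>g. ((\<lambda>y. kappa \<sigma> (x - y) * pot S \<alpha> y) has_sum g) UNIV \<and> k * pot S \<alpha> x - g \<le> pot S (\<alpha> - \<sigma>) x
    \<and> (S = {0<..} \<longrightarrow> k * pot S \<alpha> x - g = pot S (\<alpha> - \<sigma>) x)"
proof -
  have \<alpha>0: "0 < \<alpha>" using \<sigma> by simp
  let ?\<Gamma> = "\<bar>Gamma (- \<sigma>)\<bar>"
  let ?h0 = "\<lambda>s. heat s (0 :: int ^ 'd)"
  have \<Gamma>: "0 < ?\<Gamma>" "0 < Gamma \<alpha>"
    using abs_Gamma_neg[OF \<sigma>(1,2)] Gamma_real_pos[of "1 - \<sigma>"] Gamma_real_pos[OF \<alpha>0] \<sigma> by simp_all
  define P where "P s = (LINT t:S|lborel. heat (s + t) x * t powr (\<alpha> - 1))" for s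
  define Q where "Q = (LINT t:S|lborel. heat t x * t powr (\<alpha> - 1))"
  have [measurable]: "P \<in> borel_measurable borel"
    unfolding P_def[abs_def] set_lebesgue_integral_def by measurable
  have potx: "pot S \<alpha> x = Q / Gamma \<alpha>" by (simp add: pot_def Q_def)
  obtain M where M: "0 < M" "\<And>y :: int ^ 'd. pot S \<alpha> y \<le> M" using pot_bounded[OF \<alpha>0 \<alpha> S sub] by blast
  have pn: "0 \<le> pot S \<alpha> y" for y :: "int ^ 'd" by (rule pot_nonneg[OF \<alpha>0 sub])
  \<comment> \<open>The heat kernel without its diagonal, to match the value 0 of the kernel at the
    origin.\<close>
  define hz where "hz s y = (if x - y = 0 then 0 else heat s (x - y))" for s y
  have hz0: "0 \<le> hz s y" if "0 < s" for s y using that heat_nonneg[of s "x - y"] by (simp add: hz_def)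
  have [measurable]: "(\<lambda>s. hz s y) \<in> borel_measurable borel" for y unfolding hz_def by (cases "x - y = 0") auto
  have hz_sum: "((\<lambda>y. hz s y) has_sum 1 - ?h0 s) UNIV"
    and hz_pot: "((\<lambda>y. hz s y * pot S \<alpha> y) has_sum P s / Gamma \<alpha> - ?h0 s * pot S \<alpha> x) UNIV" if s: "0 < s" for s
  proof -
    have sing: "((\<lambda>y. if y = x then ?h0 s * f x else 0) has_sum ?h0 s * f x) UNIV" for f :: "int ^ 'd \<Rightarrow> real"
      using has_sum_single[of x "\<lambda>y. if y = x then ?h0 s * f x else 0"] by simp
    have eq: "heat s (x - y) * f y + - (if y = x then ?h0 s * f x else 0) = hz s y * f y" for f :: "int ^ 'd \<Rightarrow> real" and y
      by (auto simp: hz_def)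
    have "((\<lambda>y. heat s (x - y) * 1) has_sum 1) UNIV"
      using heat_mass[of s, where 'd = 'd] s has_sum_reflect[of "\<lambda>y :: int ^ 'd. heat s y" x 1] by simp
    from has_sum_add[OF this has_sum_neg[OF sing[of "\<lambda>_. 1"]]]
    have "((\<lambda>y. heat s (x - y) * 1 + - (if y = x then ?h0 s * 1 else 0)) has_sum 1 + - (?h0 s * 1)) UNIV" by simp
    then show "((\<lambda>y. hz s y) has_sum 1 - ?h0 s) UNIV" unfolding eq[where f = "\<lambda>_. 1"] by simp
    have "((\<lambda>y. heat s (x - y) * pot S \<alpha> y) has_sum P s / Gamma \<alpha>) UNIV"
      unfolding P_def using pot_semigroup(2)[OF \<alpha>0 \<alpha> S sub, of s x] s by simp
    from has_sum_add[OF this has_sum_neg[OF sing[of "pot S \<alpha>"]]]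
    show "((\<lambda>y. hz s y * pot S \<alpha> y) has_sum P s / Gamma \<alpha> - ?h0 s * pot S \<alpha> x) UNIV"
      unfolding eq[where f = "pot S \<alpha>"] by simp
  qed
  define g where "g s = (P s / Gamma \<alpha> - ?h0 s * pot S \<alpha> x) * s powr (- 1 - \<sigma>)" for s
  have def_int: "set_integrable lborel {0<..} (\<lambda>s. (1 - ?h0 s) * s powr (- 1 - \<sigma>))"
    by (rule heat_defect_integrable[OF \<sigma>(1,2)])
  have g_int: "set_integrable lborel {0<..} g"
  \<comment> \<open>Without the diagonal the heat kernel has mass \<open>1 - ?h0 s\<close>, and the
    potential is at most M.\<close>
  proof (rule set_integrable_comparison[where g = "\<lambda>s. M * ((1 - ?h0 s) * s powr (- 1 - \<sigma>))"])
    show "set_integrable lborel {0<..} (\<lambda>s. M * ((1 - ?h0 s) * s powr (- 1 - \<sigma>)))"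
      by (rule set_integrable_mult_right) (rule def_int)
    show "g \<in> borel_measurable borel" unfolding g_def[abs_def] by measurable
    fix s :: real assume "s \<in> {0<..}"
    then have s: "0 < s" by simp
    have "0 \<le> P s / Gamma \<alpha> - ?h0 s * pot S \<alpha> x"
      by (rule has_sum_nonneg[OF hz_pot[OF s]]) (use hz0[OF s] pn in simp)
    moreover have "P s / Gamma \<alpha> - ?h0 s * pot S \<alpha> x \<le> M * (1 - ?h0 s)"
      by (rule has_sum_mono[OF hz_pot[OF s] has_sum_cmult_right[OF hz_sum[OF s], of M]])
         (use mult_right_mono[OF M(2) hz0[OF s]] in \<open>simp add: mult.commute\<close>)
    ultimately show "\<bar>g s\<bar> \<le> M * ((1 - ?h0 s) * s powr (- 1 - \<sigma>))"
      unfolding g_def by (simp add: mult.assoc[symmetric] mult_right_mono)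
  qed simp
  have "((\<lambda>y. LINT s:{0<..}|lborel. hz s y * pot S \<alpha> y * s powr (- 1 - \<sigma>)) has_sum (LINT s:{0<..}|lborel. g s)) UNIV"
  proof (rule has_sum_set_integral[OF _ _ _ _ g_int])
    show "(\<lambda>s. hz s y * pot S \<alpha> y * s powr (- 1 - \<sigma>)) \<in> borel_measurable borel" for y by measurable
    show "0 \<le> hz s y * pot S \<alpha> y * s powr (- 1 - \<sigma>)" if "s \<in> {0<..}" for s y
      using that hz0[of s y] pn by simp
    show "((\<lambda>y. hz s y * pot S \<alpha> y * s powr (- 1 - \<sigma>)) has_sum g s) UNIV" if "s \<in> {0<..}" for s
      unfolding g_def using that by (intro has_sum_cmult_left hz_pot) auto
  qed simp
  then have "((\<lambda>y. (LINT s:{0<..}|lborel. hz s y * pot S \<alpha> y * s powr (- 1 - \<sigma>)) * (1 / ?\<Gamma>)) has_sum (LINT s:{0<..}|lborel. g s) * (1 / ?\<Gamma>)) UNIV"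
    by (rule has_sum_cmult_left)
  moreover have "(LINT s:{0<..}|lborel. hz s y * pot S \<alpha> y * s powr (- 1 - \<sigma>)) * (1 / ?\<Gamma>) = kappa \<sigma> (x - y) * pot S \<alpha> y" for y
  proof -
    have "(LINT s:{0<..}|lborel. hz s y * pot S \<alpha> y * s powr (- 1 - \<sigma>)) = (LINT s:{0<..}|lborel. pot S \<alpha> y * (hz s y * s powr (- 1 - \<sigma>)))"
      by (simp add: mult_ac)
    then show ?thesis unfolding kappa_frac_eq[OF \<sigma>(1,2)] hz_def by simp
  qed
  ultimately have sum: "((\<lambda>y. kappa \<sigma> (x - y) * pot S \<alpha> y) has_sum (LINT s:{0<..}|lborel. g s) / ?\<Gamma>) UNIV" by simp
  have k_eq: "k = (LINT s:{0<..}|lborel. (1 - ?h0 s) * s powr (- 1 - \<sigma>)) / ?\<Gamma>"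
    using has_sum_unique[OF k kappa_frac_sum(1)[OF \<sigma>(1,2)]] .
  define R where "R s = (LINT r:S|lborel. heat r x * marchaud \<alpha> r s)" for s
  have QP_int: "set_integrable lborel {0<..} (\<lambda>s. s powr (- 1 - \<sigma>) * (Q - P s))"
    and QP: "k * pot S \<alpha> x - (LINT s:{0<..}|lborel. g s) / ?\<Gamma> = (LINT s:{0<..}|lborel. s powr (- 1 - \<sigma>) * (Q - P s)) / (?\<Gamma> * Gamma \<alpha>)"
  proof -
    let ?D = "\<lambda>s. pot S \<alpha> x * ((1 - ?h0 s) * s powr (- 1 - \<sigma>)) - g s"
    have i: "set_integrable lborel {0<..} (\<lambda>s. pot S \<alpha> x * ((1 - ?h0 s) * s powr (- 1 - \<sigma>)))"
      by (rule set_integrable_mult_right) (rule def_int)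
    \<comment> \<open>The diagonal terms taken out of the mass and out of the convolution
      cancel.\<close>
    have D: "Gamma \<alpha> * ?D s = s powr (- 1 - \<sigma>) * (Q - P s)" for s
      unfolding g_def potx using \<Gamma> by (simp add: field_simps)
    have "set_integrable lborel {0<..} (\<lambda>s. Gamma \<alpha> * ?D s)"
      by (intro set_integrable_mult_right set_integral_diff i g_int)
    then show "set_integrable lborel {0<..} (\<lambda>s. s powr (- 1 - \<sigma>) * (Q - P s))" unfolding D .
    have "(LINT s:{0<..}|lborel. s powr (- 1 - \<sigma>) * (Q - P s)) = Gamma \<alpha> * (LINT s:{0<..}|lborel. ?D s)"
      unfolding D[symmetric] by simp
    also have "(LINT s:{0<..}|lborel. ?D s) = pot S \<alpha> x * (LINT s:{0<..}|lborel. (1 - ?h0 s) * s powr (- 1 - \<sigma>)) - (LINT s:{0<..}|lborel. g s)"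
      using set_integral_diff(2)[OF i g_int] by simp
    also have "\<dots> = ?\<Gamma> * (k * pot S \<alpha> x - (LINT s:{0<..}|lborel. g s) / ?\<Gamma>)"
      unfolding k_eq using \<Gamma> by (simp add: field_simps)
    finally show "k * pot S \<alpha> x - (LINT s:{0<..}|lborel. g s) / ?\<Gamma> = (LINT s:{0<..}|lborel. s powr (- 1 - \<sigma>) * (Q - P s)) / (?\<Gamma> * Gamma \<alpha>)"
      using \<Gamma> by simp
  qed
  have RR: "(LINT s:{0<..}|lborel. s powr (- 1 - \<sigma>) * R s) / (?\<Gamma> * Gamma \<alpha>) = pot S (\<alpha> - \<sigma>) x"
    unfolding R_def marchaud_Fubini(2)[OF \<sigma> \<alpha> S sub] using \<Gamma> by (simp add: abs_Gamma_neg[OF \<sigma>(1,2), symmetric])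
  have le: "(LINT s:{0<..}|lborel. s powr (- 1 - \<sigma>) * (Q - P s)) \<le> (LINT s:{0<..}|lborel. s powr (- 1 - \<sigma>) * R s)"
  proof (rule set_integral_mono[OF QP_int])
    show "set_integrable lborel {0<..} (\<lambda>s. s powr (- 1 - \<sigma>) * R s)"
      unfolding R_def by (rule marchaud_Fubini(1)[OF \<sigma> \<alpha> S sub])
    show "s powr (- 1 - \<sigma>) * (Q - P s) \<le> s powr (- 1 - \<sigma>) * R s" if "s \<in> {0<..}" for s
      using pot_minus_shift_le(1)[OF \<alpha>0 \<alpha> S sub down, of s x] that
      unfolding Q_def P_def R_def by (intro mult_left_mono) auto
  qed
  have eq: "(LINT s:{0<..}|lborel. s powr (- 1 - \<sigma>) * (Q - P s)) = (LINT s:{0<..}|lborel. s powr (- 1 - \<sigma>) * R s)" if "S = {0<..}"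
  proof (rule set_lebesgue_integral_cong)
    show "\<forall>s. s \<in> {0<..} \<longrightarrow> s powr (- 1 - \<sigma>) * (Q - P s) = s powr (- 1 - \<sigma>) * R s"
    proof (intro allI impI)
      fix s :: real assume "s \<in> {0<..}"
      then have "Q - P s = R s"
        unfolding Q_def P_def R_def by (intro pot_minus_shift_le(2)[OF \<alpha>0 \<alpha> S sub down _ that]) auto
      then show "s powr (- 1 - \<sigma>) * (Q - P s) = s powr (- 1 - \<sigma>) * R s" by simp
    qed
  qed simp
  show ?thesis
  proof (intro exI conjI impI)
    show "((\<lambda>y. kappa \<sigma> (x - y) * pot S \<alpha> y) has_sum (LINT s:{0<..}|lborel. g s) / ?\<Gamma>) UNIV" by (rule sum)
    show "k * pot S \<alpha> x - (LINT s:{0<..}|lborel. g s) / ?\<Gamma> \<le> pot S (\<alpha> - \<sigma>) x"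
      unfolding QP RR[symmetric] using le \<Gamma> by (intro divide_right_mono) auto
    show "k * pot S \<alpha> x - (LINT s:{0<..}|lborel. g s) / ?\<Gamma> = pot S (\<alpha> - \<sigma>) x" if "S = {0<..}"
      unfolding QP RR[symmetric] eq[OF that] ..
  qed
qed

section \<open>The case \<sigma> = 1\<close>

lemma kappa_1_sum: "((\<lambda>x :: int ^ 'd::finite. kappa 1 x) has_sum 2 * real CARD('d)) UNIV"
proof -
  let ?N = "{y :: int ^ 'd. lnorm (y - 0) = 1}"
  have "((\<lambda>x :: int ^ 'd. kappa 1 x) has_sum (\<Sum>y\<in>?N. kappa 1 y)) UNIV"
    by (rule has_sum_finite_neutralI) (use finite_neighbours[of "0 :: int ^ 'd"] in \<open>auto simp: kappa_def\<close>)
  also have "(\<Sum>y\<in>?N. kappa 1 y) = (\<Sum>y\<in>?N. 1)" by (rule sum.cong) (auto simp: kappa_def)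
  also have "\<dots> = 2 * real CARD('d)" using card_neighbours[of "0 :: int ^ 'd"] by simp
  finally show ?thesis .
qed

text \<open>Integrate the time derivative of heat times t^{\<alpha>-1} over {0<..T} and use the heat
  equation. The boundary term at 0 vanishes because \<alpha> > 1; the one at T has the sign that
  makes the truncation a subsolution for the truncated right side.\<close>

lemma pot_by_parts:
  fixes x :: "int ^ 'd::finite"
  assumes \<alpha>: "1 < \<alpha>" "\<alpha> < real CARD('d) / 2" and T: "0 < T"
  shows "2 * real CARD('d) * pot {0<..T} \<alpha> x - (\<Sum>y\<in>{y. lnorm (y - x) = 1}. pot {0<..T} \<alpha> y)
    = pot {0<..T} (\<alpha> - 1) x - heat T x * T powr (\<alpha> - 1) / Gamma \<alpha>"
proof -
  let ?N = "{y. lnorm (y - x) = 1}"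
  let ?p' = "\<lambda>t. (\<Sum>y\<in>?N. heat t y) - 2 * real CARD('d) * heat t x"
  have i: "set_integrable lborel {0<..T} (\<lambda>t. heat t y * t powr (\<beta> - 1))" if "0 < \<beta>" "\<beta> \<le> \<alpha>" for \<beta> and y :: "int ^ 'd"
    by (rule heat_mult_powr_integrable) (use that \<alpha> in auto)
  have i1: "set_integrable lborel {0<..T} (\<lambda>t. heat t x * t powr (\<alpha> - 1 - 1))"
    by (rule i) (use \<alpha> in auto)
  have i2: "set_integrable lborel {0<..T} (\<lambda>t. \<Sum>y\<in>?N. heat t y * t powr (\<alpha> - 1))"
    using i[of \<alpha>] \<alpha> unfolding set_integrable_def
    by (simp add: sum_distrib_left)
  have i3: "set_integrable lborel {0<..T} (\<lambda>t. 2 * real CARD('d) * (heat t x * t powr (\<alpha> - 1)))"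
    by (rule set_integrable_mult_right) (use i[of \<alpha> x] \<alpha> in auto)
  let ?F' = "\<lambda>t. (\<alpha> - 1) * (heat t x * t powr (\<alpha> - 1 - 1)) + ((\<Sum>y\<in>?N. heat t y * t powr (\<alpha> - 1)) - 2 * real CARD('d) * (heat t x * t powr (\<alpha> - 1)))"
  have iF: "set_integrable lborel {0<..T} ?F'"
    by (intro set_integral_add set_integral_diff set_integrable_mult_right i1 i2 i3)
  have "(?F' has_integral heat T x * T powr (\<alpha> - 1) - heat 0 x * 0 powr (\<alpha> - 1)) {0..T}"
  proof (rule fundamental_theorem_of_calculus_interior)
    show "continuous_on {0..T} (\<lambda>t. heat t x * t powr (\<alpha> - 1))"
      using \<alpha> by (intro continuous_intros continuous_on_powr') auto
    fix t assume t: "t \<in> {0<..<T}"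
    have "((\<lambda>t. heat t x * t powr (\<alpha> - 1)) has_real_derivative ?p' t * t powr (\<alpha> - 1) + (\<alpha> - 1) * t powr (\<alpha> - 1 - 1) * heat t x) (at t)"
      by (rule DERIV_cong[OF DERIV_mult[OF heat_deriv has_real_derivative_powr]]) (use t in auto)
    also have "?p' t * t powr (\<alpha> - 1) + (\<alpha> - 1) * t powr (\<alpha> - 1 - 1) * heat t x = ?F' t"
      by (simp add: sum_distrib_right[symmetric] algebra_simps)
    finally show "((\<lambda>t. heat t x * t powr (\<alpha> - 1)) has_vector_derivative ?F' t) (at t)"
      by (simp only: has_real_derivative_iff_has_vector_derivative)
  qed (use T in simp)
  then have "(?F' has_integral heat T x * T powr (\<alpha> - 1)) {0<..T}"
    using \<alpha> by (subst (asm) has_integral_spike_set_eq[where T = "{0<..T}"]) (auto intro: negligible_subset[of "{0}"])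
  then have "heat T x * T powr (\<alpha> - 1) = (LINT t:{0<..T}|lborel. ?F' t)"
    using set_borel_integral_eq_integral(2)[OF iF] by (simp add: integral_unique)
  also have "\<dots> = (LINT t:{0<..T}|lborel. (\<alpha> - 1) * (heat t x * t powr (\<alpha> - 1 - 1)))
    + ((LINT t:{0<..T}|lborel. (\<Sum>y\<in>?N. heat t y * t powr (\<alpha> - 1))) - (LINT t:{0<..T}|lborel. 2 * real CARD('d) * (heat t x * t powr (\<alpha> - 1))))"
    by (subst set_integral_add, intro set_integrable_mult_right i1, intro set_integral_diff i2 i3)
       (simp only: set_integral_diff(2)[OF i2 i3])
  also have "(LINT t:{0<..T}|lborel. (\<Sum>y\<in>?N. heat t y * t powr (\<alpha> - 1))) = (\<Sum>y\<in>?N. (LINT t:{0<..T}|lborel. heat t y * t powr (\<alpha> - 1)))"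
    unfolding set_lebesgue_integral_def scaleR_sum_right
    using i[of \<alpha>] \<alpha> by (subst Bochner_Integration.integral_sum) (auto simp: set_integrable_def)
  finally have main: "heat T x * T powr (\<alpha> - 1) = (\<alpha> - 1) * (LINT t:{0<..T}|lborel. heat t x * t powr (\<alpha> - 1 - 1))
    + (\<Sum>y\<in>?N. (LINT t:{0<..T}|lborel. heat t y * t powr (\<alpha> - 1))) - 2 * real CARD('d) * (LINT t:{0<..T}|lborel. heat t x * t powr (\<alpha> - 1))"
    by simp
  have "\<alpha> - 1 \<notin> \<int>\<^sub>\<le>\<^sub>0" using \<alpha> by (auto elim!: nonpos_Ints_cases)
  then have G: "Gamma \<alpha> = (\<alpha> - 1) * Gamma (\<alpha> - 1)" using Gamma_plus1[of "\<alpha> - 1"] by simp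
  have G0: "0 < Gamma \<alpha>" "0 < Gamma (\<alpha> - 1)" using \<alpha> by (simp_all add: Gamma_real_pos)
  have "Gamma \<alpha> * (2 * real CARD('d) * pot {0<..T} \<alpha> x - (\<Sum>y\<in>?N. pot {0<..T} \<alpha> y))
    = Gamma \<alpha> * (pot {0<..T} (\<alpha> - 1) x - heat T x * T powr (\<alpha> - 1) / Gamma \<alpha>)"
  proof -
    have "Gamma \<alpha> * pot {0<..T} (\<alpha> - 1) x = (\<alpha> - 1) * (LINT t:{0<..T}|lborel. heat t x * t powr (\<alpha> - 1 - 1))"
      using less_imp_neq[OF G0(2)] unfolding G pot_def by simp
    moreover have "Gamma \<alpha> * (\<Sum>y\<in>?N. pot {0<..T} \<alpha> y) = (\<Sum>y\<in>?N. (LINT t:{0<..T}|lborel. heat t y * t powr (\<alpha> - 1)))"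
      using G0 unfolding pot_def by (simp add: sum_divide_distrib[symmetric])
    moreover have "Gamma \<alpha> * pot {0<..T} \<alpha> x = (LINT t:{0<..T}|lborel. heat t x * t powr (\<alpha> - 1))"
      using G0 unfolding pot_def by simp
    moreover have "Gamma \<alpha> * (heat T x * T powr (\<alpha> - 1) / Gamma \<alpha>) = heat T x * T powr (\<alpha> - 1)" using G0 by simp
    ultimately show ?thesis using main by (simp add: right_diff_distrib mult.left_commute[of "Gamma \<alpha>"])
  qed
  then show ?thesis using G0 by simp
qed

lemma pot_tendsto_full:
  assumes "0 < a" "a < real CARD('d) / 2"
  shows "(\<lambda>n. pot {0<..real n} a (x :: int ^ 'd::finite)) \<longlonglongrightarrow> pot {0<..} a x"
proof -
  have U: "(\<Union>n. {0<..real n}) = {0<..}" by (auto intro: real_arch_simple)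
  have "(\<lambda>n. LINT t:{0<..real n}|lborel. heat t x * t powr (a - 1)) \<longlonglongrightarrow> (LINT t:(\<Union>n. {0<..real n})|lborel. heat t x * t powr (a - 1))"
    by (rule set_integral_cont_up) (use heat_mult_powr_integrable[OF assms, of "{0<..}" x] in \<open>auto simp: incseq_def U\<close>)
  then show ?thesis unfolding pot_def U by (intro tendsto_divide tendsto_const) (use less_imp_neq[OF Gamma_real_pos[OF assms(1)]] in auto)
qed

text \<open>For the full potential let T tend to infinity: the boundary term is of order
  T^{\<alpha>-1-d/2} and disappears.\<close>

lemma pot_operator_1:
  fixes x :: "int ^ 'd::finite"
  assumes \<alpha>: "1 < \<alpha>" "\<alpha> < real CARD('d) / 2" and S: "S = {0<..} \<or> (\<exists>T>0. S = {0<..T})"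
  shows "\<exists>g. ((\<lambda>y. kappa 1 (x - y) * pot S \<alpha> y) has_sum g) UNIV \<and> 2 * real CARD('d) * pot S \<alpha> x - g \<le> pot S (\<alpha> - 1) x
    \<and> (S = {0<..} \<longrightarrow> 2 * real CARD('d) * pot S \<alpha> x - g = pot S (\<alpha> - 1) x)"
proof -
  let ?N = "{y. lnorm (y - x) = 1}"
  have lsym: "lnorm (x - y) = lnorm (y - x)" for y
    unfolding lnorm_def by (rule arg_cong[where f = sqrt]) (auto intro!: sum.cong simp: power2_commute)
  have sum: "((\<lambda>y. kappa 1 (x - y) * pot S \<alpha> y) has_sum (\<Sum>y\<in>?N. pot S \<alpha> y)) UNIV"
    by (rule has_sum_finite_neutralI[of ?N]) (use finite_neighbours[of x] lsym in \<open>auto simp: kappa_def intro!: sum.cong\<close>)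
  have full: "2 * real CARD('d) * pot {0<..} \<alpha> x - (\<Sum>y\<in>?N. pot {0<..} \<alpha> y) = pot {0<..} (\<alpha> - 1) x"
  proof (rule LIMSEQ_unique)
    let ?f = "\<lambda>n. 2 * real CARD('d) * pot {0<..real n} \<alpha> x - (\<Sum>y\<in>?N. pot {0<..real n} \<alpha> y)"
    show "?f \<longlonglongrightarrow> 2 * real CARD('d) * pot {0<..} \<alpha> x - (\<Sum>y\<in>?N. pot {0<..} \<alpha> y)"
      by (intro tendsto_intros pot_tendsto_full) (use \<alpha> in auto)
    obtain C where C: "0 < C" "\<And>t x. 0 < t \<Longrightarrow> heat t (x :: int ^ 'd) \<le> C * t powr (- real CARD('d) / 2)"
      using heat_upper by blast
    have "(\<lambda>n. heat (real n) x * real n powr (\<alpha> - 1) / Gamma \<alpha>) \<longlonglongrightarrow> 0"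
    proof (rule tendsto_sandwich[OF _ _ tendsto_const])
      have "((\<lambda>n::nat. real n powr (\<alpha> - 1 - real CARD('d) / 2)) \<longlongrightarrow> 0) sequentially"
        using \<alpha> by (intro tendsto_neg_powr filterlim_real_sequentially) auto
      then have "(\<lambda>n. C / Gamma \<alpha> * real n powr (\<alpha> - 1 - real CARD('d) / 2)) \<longlonglongrightarrow> C / Gamma \<alpha> * 0"
        by (intro tendsto_intros)
      then show "(\<lambda>n. C / Gamma \<alpha> * real n powr (\<alpha> - 1 - real CARD('d) / 2)) \<longlonglongrightarrow> 0" by simp
      have G0: "0 < Gamma \<alpha>" using \<alpha> by (simp add: Gamma_real_pos)
      show "\<forall>\<^sub>F n in sequentially. 0 \<le> heat (real n) x * real n powr (\<alpha> - 1) / Gamma \<alpha>"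
        using G0 heat_nonneg[of "real _" x] by (intro always_eventually allI) simp
      show "\<forall>\<^sub>F n in sequentially. heat (real n) x * real n powr (\<alpha> - 1) / Gamma \<alpha> \<le> C / Gamma \<alpha> * real n powr (\<alpha> - 1 - real CARD('d) / 2)"
        using eventually_gt_at_top[of 0]
      proof eventually_elim
        case (elim n)
        have "heat (real n) x * real n powr (\<alpha> - 1) \<le> C * real n powr (- real CARD('d) / 2) * real n powr (\<alpha> - 1)"
          using C(2)[of "real n" x] elim by (intro mult_right_mono) auto
        also have "\<dots> = C * real n powr (\<alpha> - 1 - real CARD('d) / 2)"
          by (simp add: mult.assoc powr_add[symmetric])
        finally show ?case using G0 by (simp add: divide_right_mono)
      qed
    qed
    moreover have "(\<lambda>n. pot {0<..real n} (\<alpha> - 1) x) \<longlonglongrightarrow> pot {0<..} (\<alpha> - 1) x"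
      by (rule pot_tendsto_full) (use \<alpha> in auto)
    ultimately have "(\<lambda>n. pot {0<..real n} (\<alpha> - 1) x - heat (real n) x * real n powr (\<alpha> - 1) / Gamma \<alpha>) \<longlonglongrightarrow> pot {0<..} (\<alpha> - 1) x - 0"
      by (intro tendsto_diff)
    moreover have "\<forall>\<^sub>F n in sequentially. pot {0<..real n} (\<alpha> - 1) x - heat (real n) x * real n powr (\<alpha> - 1) / Gamma \<alpha> = ?f n"
      using eventually_gt_at_top[of 0] by eventually_elim (use pot_by_parts[OF \<alpha>] in simp)
    ultimately show "?f \<longlonglongrightarrow> pot {0<..} (\<alpha> - 1) x"
      by (auto dest: Lim_transform_eventually)
  qed
  show ?thesis
    using S
  proof (elim disjE exE conjE)
    assume "S = {0<..}"
    then show ?thesis using sum full by auto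
  next
    fix T :: real assume T: "0 < T" "S = {0<..T}"
    have "0 < Gamma \<alpha>" using \<alpha> by (simp add: Gamma_real_pos)
    then have "0 \<le> heat T x * T powr (\<alpha> - 1) / Gamma \<alpha>" using heat_nonneg[of T x] T by simp
    then have "2 * real CARD('d) * pot S \<alpha> x - (\<Sum>y\<in>?N. pot S \<alpha> y) \<le> pot S (\<alpha> - 1) x"
      unfolding T(2) pot_by_parts[OF \<alpha> T(1)] by linarith
    moreover have "S \<noteq> {0<..}"
    proof
      assume "S = {0<..}"
      then have "T + 1 \<in> S" using T by auto
      then show False using T by auto
    qed
    ultimately show ?thesis using sum by auto
  qed
qed

lemma kappa_basic:
  assumes "0 < \<sigma>" "\<sigma> \<le> 1"
  shows "0 \<le> kappa \<sigma> (x :: int ^ 'd::finite)" "kappa \<sigma> (- x) = kappa \<sigma> x"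
    "lnorm x = 1 \<Longrightarrow> 0 < kappa \<sigma> x" "\<exists>k. ((\<lambda>x :: int ^ 'd. kappa \<sigma> x) has_sum k) UNIV"
proof -
  have l: "lnorm (- x) = lnorm x" unfolding lnorm_def by simp
  show "kappa \<sigma> (- x) = kappa \<sigma> x" unfolding kappa_def l by simp
  have n0: "lnorm x = 1 \<Longrightarrow> x \<noteq> 0" by (auto simp: lnorm_def)
  show "lnorm x = 1 \<Longrightarrow> 0 < kappa \<sigma> x"
    using assms kappa_frac_sum(2)[of \<sigma> x] n0 by (cases "\<sigma> = 1") (auto simp: kappa_def[of 1])
  show "0 \<le> kappa \<sigma> x"
    using assms kappa_frac_sum(2)[of \<sigma> x] by (cases "\<sigma> = 1"; cases "x = 0") (auto simp: kappa_def[of 1] kappa_def[of _ 0] less_imp_le)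
  show "\<exists>k. ((\<lambda>x :: int ^ 'd. kappa \<sigma> x) has_sum k) UNIV"
    using assms kappa_frac_sum(1)[of \<sigma>] kappa_1_sum by (cases "\<sigma> = 1") auto
qed

section \<open>Truncated potentials as test functions\<close>

text \<open>The argument \<open>dim\<close> ties the locale to the lattice, whose type does not
  occur in the types of \<sigma>, \<alpha> and k.\<close>

locale riesz =
  fixes \<sigma> \<alpha> k :: real and dim :: "'d::finite itself"
  assumes \<sigma>: "0 < \<sigma>" "\<sigma> \<le> 1" and \<alpha>: "\<sigma> < \<alpha>" "\<alpha> < real CARD('d) / 2"
    and k: "((\<lambda>x :: int ^ 'd. kappa \<sigma> x) has_sum k) UNIV"
begin

abbreviation u :: "int ^ 'd \<Rightarrow> real" where "u \<equiv> pot {0<..} \<alpha>"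
abbreviation v :: "real \<Rightarrow> int ^ 'd \<Rightarrow> real" where "v T \<equiv> pot {0<..T} \<alpha>"
abbreviation \<rho> :: "int ^ 'd \<Rightarrow> real" where "\<rho> \<equiv> pot {0<..} (\<alpha> - \<sigma>)"
abbreviation \<rho>T :: "real \<Rightarrow> int ^ 'd \<Rightarrow> real" where "\<rho>T T \<equiv> pot {0<..T} (\<alpha> - \<sigma>)"

lemma ranges: "0 < \<alpha>" "0 < \<alpha> - \<sigma>" "\<alpha> - \<sigma> < real CARD('d) / 2"
  using \<sigma> \<alpha> by auto

lemma operator:
  assumes "S = {0<..} \<or> (\<exists>T>0. S = {0<..T})"
  shows "\<exists>g. ((\<lambda>y. kappa \<sigma> (x - y :: int ^ 'd) * pot S \<alpha> y) has_sum g) UNIV \<and> k * pot S \<alpha> x - g \<le> pot S (\<alpha> - \<sigma>) x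
    \<and> (S = {0<..} \<longrightarrow> k * pot S \<alpha> x - g = pot S (\<alpha> - \<sigma>) x)"
proof (cases "\<sigma> = 1")
  case True
  have "k = 2 * real CARD('d)" using k kappa_1_sum unfolding True by (rule has_sum_unique)
  then show ?thesis using pot_operator_1[where \<alpha> = \<alpha> and S = S and x = x] assms \<alpha> True by auto
next
  case False
  then have "\<sigma> < 1" using \<sigma> by simp
  show ?thesis
    by (rule pot_operator_frac[OF \<sigma>(1) \<open>\<sigma> < 1\<close> \<alpha> _ _ _ k]) (use assms in auto)
qed

lemma u_pos: "0 < u x" by (rule pot_pos[OF ranges(1) \<alpha>(2), where b = 1]) auto
lemma \<rho>_pos: "0 < \<rho> x" by (rule pot_pos[OF ranges(2,3), where b = 1]) auto

lemma hardy_w_eq: "hardy_w \<sigma> \<alpha> x = \<rho> x / u x"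
proof -
  have "kappa (\<sigma> - \<alpha>) x = \<rho> x" using kappa_neg_eq_pot[OF ranges(2), of x] by simp
  moreover have "kappa (- \<alpha>) x = u x" by (rule kappa_neg_eq_pot[OF ranges(1)])
  ultimately show ?thesis by (simp add: hardy_w_def)
qed

sublocale hp: hardy_pair \<sigma> k u "hardy_w \<sigma> \<alpha>"
proof
  fix x :: "int ^ 'd"
  show "0 \<le> kappa \<sigma> x" "kappa \<sigma> (- x) = kappa \<sigma> x" "lnorm x = 1 \<Longrightarrow> 0 < kappa \<sigma> x"
    using kappa_basic(1-3)[OF \<sigma>, of x] by auto
  show "0 < u x" by (rule u_pos)
  show "0 \<le> hardy_w \<sigma> \<alpha> x" unfolding hardy_w_eq using u_pos[of x] \<rho>_pos[of x] by simp
  obtain g where g: "((\<lambda>y. kappa \<sigma> (x - y) * u y) has_sum g) UNIV" "k * u x - g = \<rho> x"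
    using operator[of "{0<..}" x] by auto
  have "g = (k - hardy_w \<sigma> \<alpha> x) * u x"
    unfolding hardy_w_eq using u_pos[of x] g(2) by (simp add: field_simps)
  then show "((\<lambda>y. kappa \<sigma> (x - y) * u y) has_sum (k - hardy_w \<sigma> \<alpha> x) * u x) UNIV" using g(1) by simp
qed (rule k)

text \<open>With \<open>u = v T + r\<close> and \<open>L (v T) \<le> \<rho>T T\<close>, the form density is at most
  \<open>\<rho> * (v T) - \<rho> * (v T)\<^sup>2 / u = \<rho> * v T * r / u\<close>, which is bounded by pairing early times with late times.\<close>

lemma truncated_form_le:
  assumes T: "0 < T" and B: "finite B" and M: "\<And>x. v T x \<le> M"
  shows "hp.hf B (v T) (v T) \<le> (\<Sum>x\<in>B. \<rho>T T x * pot {T<..} \<alpha> x + pot {T<..} (\<alpha> - \<sigma>) x * v T x)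
    + M * k * (T powr \<alpha> / (\<alpha> * Gamma \<alpha>) - (\<Sum>x\<in>B. v T x))"
proof -
  have vn: "0 \<le> v T x" for x :: "int ^ 'd" by (rule pot_nonneg[OF ranges(1)]) auto
  have M0: "0 \<le> M" using M[of 0] vn[of 0] by simp
  have K: "0 \<le> kappa \<sigma> (x :: int ^ 'd)" for x by (rule kappa_basic[OF \<sigma>])
  have "\<exists>g. \<forall>x. ((\<lambda>y. kappa \<sigma> (x - y) * v T y) has_sum g x) UNIV \<and> k * v T x - g x \<le> \<rho>T T x"
    using operator[of "{0<..T}"] T by (intro choice allI) blast
  then obtain g where g: "\<And>x. ((\<lambda>y. kappa \<sigma> (x - y) * v T y) has_sum g x) UNIV" "\<And>x. k * v T x - g x \<le> \<rho>T T x"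
    by blast
  \<comment> \<open>Column y of the pairing over B. The columns outside B are the error of the
    cutoff, and \<open>c_le\<close> bounds them by the mass of \<open>v T\<close> outside B.\<close>
  define c where "c y = (\<Sum>x\<in>B. v T x * (kappa \<sigma> (x - y) * v T y))" for y
  have c: "(c has_sum (\<Sum>x\<in>B. v T x * g x)) UNIV"
    unfolding c_def by (intro has_sum_sum has_sum_cmult_right g B)
  have c_le: "c y \<le> M * k * v T y" for y
  proof -
    have "(\<Sum>x\<in>B. kappa \<sigma> (x - y)) \<le> k"
    proof (rule finite_sum_le_has_sum[OF _ B])
      show "((\<lambda>x. kappa \<sigma> (x - y)) has_sum k) UNIV" using hp.rows[of y] hp.K_sym'[of y] by simp
    qed (use K in auto)
    then have "(\<Sum>x\<in>B. M * (kappa \<sigma> (x - y) * v T y)) \<le> M * (k * v T y)"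
      using M0 vn[of y] by (simp add: sum_distrib_left[symmetric] sum_distrib_right[symmetric] mult_left_mono mult_right_mono)
    moreover have "c y \<le> (\<Sum>x\<in>B. M * (kappa \<sigma> (x - y) * v T y))"
      unfolding c_def by (intro sum_mono mult_right_mono M) (simp add: K vn)
    ultimately show ?thesis by (simp add: mult.assoc)
  qed
  have fin: "((\<lambda>y. if y \<in> B then f y else 0) has_sum (\<Sum>y\<in>B. f y)) UNIV" for f :: "int ^ 'd \<Rightarrow> real"
    by (rule has_sum_finite_neutralI[OF B]) auto
  have V: "(v T has_sum T powr \<alpha> / (\<alpha> * Gamma \<alpha>)) UNIV"
    by (rule pot_has_sum) (use ranges T in auto)
  have tail: "(\<Sum>x\<in>B. v T x * g x) + - (\<Sum>y\<in>B. c y)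
      \<le> M * k * (T powr \<alpha> / (\<alpha> * Gamma \<alpha>)) + - (\<Sum>y\<in>B. M * k * v T y)"
  proof (rule has_sum_mono)
    show "((\<lambda>y. c y + - (if y \<in> B then c y else 0)) has_sum (\<Sum>x\<in>B. v T x * g x) + - (\<Sum>y\<in>B. c y)) UNIV"
      by (intro has_sum_add has_sum_neg fin c)
    show "((\<lambda>y. M * k * v T y + - (if y \<in> B then M * k * v T y else 0)) has_sum
      M * k * (T powr \<alpha> / (\<alpha> * Gamma \<alpha>)) + - (\<Sum>y\<in>B. M * k * v T y)) UNIV"
      by (intro has_sum_add has_sum_neg fin has_sum_cmult_right V)
  qed (use c_le in auto)
  have csum: "(\<Sum>y\<in>B. c y) = (\<Sum>x\<in>B. v T x * (\<Sum>y\<in>B. kappa \<sigma> (x - y) * v T y))"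
    unfolding c_def by (subst sum.swap) (simp add: sum_distrib_left)
  have "hp.hf B (v T) (v T) = (\<Sum>x\<in>B. v T x * ((k - hardy_w \<sigma> \<alpha> x) * v T x) - v T x * (\<Sum>y\<in>B. kappa \<sigma> (x - y) * v T y))"
    unfolding form_alt by (simp only: right_diff_distrib)
  also have "\<dots> = (\<Sum>x\<in>B. v T x * (k * v T x - g x - hardy_w \<sigma> \<alpha> x * v T x)) + ((\<Sum>x\<in>B. v T x * g x) + - (\<Sum>y\<in>B. c y))"
    unfolding csum by (simp add: sum_subtractf sum.distrib algebra_simps)
  also have "\<dots> \<le> (\<Sum>x\<in>B. \<rho>T T x * pot {T<..} \<alpha> x + pot {T<..} (\<alpha> - \<sigma>) x * v T x)
    + (M * k * (T powr \<alpha> / (\<alpha> * Gamma \<alpha>)) + - (\<Sum>y\<in>B. M * k * v T y))"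
  proof (rule add_mono[OF sum_mono tail])
    fix x :: "int ^ 'd"
    define r where "r = pot {T<..} \<alpha> x"
    define \<rho>' where "\<rho>' = pot {T<..} (\<alpha> - \<sigma>) x"
    have us: "u x = v T x + r" unfolding r_def by (rule pot_split) (use ranges \<alpha> T in auto)
    have \<rho>s: "\<rho> x = \<rho>T T x + \<rho>'" unfolding \<rho>'_def by (rule pot_split) (use ranges T in auto)
    have nn: "0 \<le> r" "0 \<le> \<rho>'" "0 \<le> \<rho>T T x" "0 \<le> v T x" 
      unfolding r_def \<rho>'_def using T ranges by (auto intro!: pot_nonneg)
    have "v T x * (k * v T x - g x - hardy_w \<sigma> \<alpha> x * v T x) \<le> v T x * (\<rho> x - hardy_w \<sigma> \<alpha> x * v T x)"
      using g(2)[of x] nn \<rho>s by (intro mult_left_mono) auto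
    also have "\<dots> = \<rho> x * (v T x * r / u x)"
      unfolding hardy_w_eq using u_pos[of x] us by (simp add: field_simps)
    \<comment> \<open>Early times of \<rho> keep the factor r, late ones keep \<open>v T\<close>;
      the other factor over u is at most 1.\<close>
    also have "\<dots> = \<rho>T T x * (v T x / u x * r) + \<rho>' * (r / u x * v T x)" unfolding \<rho>s by (simp add: algebra_simps add_divide_distrib)
    also have "\<dots> \<le> \<rho>T T x * r + \<rho>' * v T x"
      using nn u_pos[of x] us by (intro add_mono mult_left_mono mult_left_le_one_le) (auto simp: divide_le_eq)
    finally show "v T x * (k * v T x - g x - hardy_w \<sigma> \<alpha> x * v T x) \<le> \<rho>T T x * pot {T<..} \<alpha> x + pot {T<..} (\<alpha> - \<sigma>) x * v T x"
      unfolding r_def \<rho>'_def .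
  qed
  finally show ?thesis by (simp add: right_diff_distrib sum_distrib_left)
qed

text \<open>Both products pair a mass with a uniform tail, T^{\<alpha>-\<sigma>} with
  T^{\<alpha>-d/2} and T^\<alpha> with T^{\<alpha>-\<sigma>-d/2}. The exponents add up to the same
  number, zero precisely at the threshold.\<close>

lemma truncated_cross_le:
  "\<exists>C>0. \<forall>T>0. \<forall>B. finite B \<longrightarrow> (\<Sum>x\<in>B. \<rho>T T x * pot {T<..} \<alpha> x + pot {T<..} (\<alpha> - \<sigma>) x * v T x)
    \<le> C * T powr (2 * \<alpha> - \<sigma> - real CARD('d) / 2)"
proof -
  let ?D = "real CARD('d) / 2"
  obtain C1 where C1: "0 < C1" "\<And>T x. 0 < T \<Longrightarrow> pot {T<..} \<alpha> (x :: int ^ 'd) \<le> C1 * T powr (\<alpha> - ?D)"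
    using pot_tail_le[OF ranges(1) \<alpha>(2)] by blast
  obtain C2 where C2: "0 < C2" "\<And>T x. 0 < T \<Longrightarrow> pot {T<..} (\<alpha> - \<sigma>) (x :: int ^ 'd) \<le> C2 * T powr (\<alpha> - \<sigma> - ?D)"
    using pot_tail_le[OF ranges(2,3)] by blast
  define a1 a2 where "a1 = (\<alpha> - \<sigma>) * Gamma (\<alpha> - \<sigma>)" and "a2 = \<alpha> * Gamma \<alpha>"
  have a: "0 < a1" "0 < a2" using ranges Gamma_real_pos by (auto simp: a1_def a2_def)
  have "(\<Sum>x\<in>B. \<rho>T T x * pot {T<..} \<alpha> x + pot {T<..} (\<alpha> - \<sigma>) x * v T x) \<le> (C1 / a1 + C2 / a2) * T powr (2 * \<alpha> - \<sigma> - ?D)"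
    if T: "0 < T" and B: "finite B" for T B
  proof -
    have n: "0 \<le> \<rho>T T x" "0 \<le> v T x" for x :: "int ^ 'd" using ranges by (auto intro!: pot_nonneg)
    have s1: "(\<Sum>x\<in>B. \<rho>T T x) \<le> T powr (\<alpha> - \<sigma>) / a1"
      unfolding a1_def by (rule finite_sum_le_has_sum[OF pot_has_sum B]) (use ranges T n in auto)
    have s2: "(\<Sum>x\<in>B. v T x) \<le> T powr \<alpha> / a2"
      unfolding a2_def by (rule finite_sum_le_has_sum[OF pot_has_sum B]) (use ranges T n in auto)
    have "(\<Sum>x\<in>B. \<rho>T T x * pot {T<..} \<alpha> x + pot {T<..} (\<alpha> - \<sigma>) x * v T x)
        \<le> (\<Sum>x\<in>B. \<rho>T T x * (C1 * T powr (\<alpha> - ?D)) + (C2 * T powr (\<alpha> - \<sigma> - ?D)) * v T x)"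
      by (intro sum_mono add_mono mult_left_mono mult_right_mono C1 C2 T n)
    also have "\<dots> = (\<Sum>x\<in>B. \<rho>T T x) * (C1 * T powr (\<alpha> - ?D)) + (C2 * T powr (\<alpha> - \<sigma> - ?D)) * (\<Sum>x\<in>B. v T x)"
      by (simp only: sum.distrib sum_distrib_left sum_distrib_right)
    also have "\<dots> \<le> T powr (\<alpha> - \<sigma>) / a1 * (C1 * T powr (\<alpha> - ?D)) + (C2 * T powr (\<alpha> - \<sigma> - ?D)) * (T powr \<alpha> / a2)"
      using C1 C2 by (intro add_mono mult_left_mono mult_right_mono s1 s2) auto
    also have "\<dots> = (C1 / a1) * (T powr (\<alpha> - \<sigma>) * T powr (\<alpha> - ?D)) + (C2 / a2) * (T powr (\<alpha> - \<sigma> - ?D) * T powr \<alpha>)"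
      by (simp add: mult_ac)
    also have "T powr (\<alpha> - \<sigma>) * T powr (\<alpha> - ?D) = T powr (2 * \<alpha> - \<sigma> - ?D)"
      unfolding powr_add[symmetric] by (simp add: algebra_simps)
    also have "T powr (\<alpha> - \<sigma> - ?D) * T powr \<alpha> = T powr (2 * \<alpha> - \<sigma> - ?D)"
      unfolding powr_add[symmetric] by (simp add: algebra_simps)
    finally show ?thesis by (simp only: distrib_right)
  qed
  moreover have "0 < C1 / a1 + C2 / a2" using C1 C2 a by (auto intro!: add_pos_pos)
  ultimately show ?thesis by blast
qed

text \<open>The truncation at time n + 1 is cut to a set so large that the lost mass costs at most 1
  / (n + 1), and which contains the points of index up to n, so that pointwise convergence to u
  survives.\<close>

lemma test_sequence:
  "\<exists>\<phi> S C. 0 < C \<and> (\<forall>n. finite (S n)) \<and> (\<forall>n x. x \<notin> S n \<longrightarrow> \<phi> n x = 0) \<and> (\<forall>n x. 0 \<le> \<phi> n x \<and> \<phi> n x \<le> u x)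
    \<and> (\<forall>x. (\<lambda>n. \<phi> n x) \<longlonglongrightarrow> u x)
    \<and> (\<forall>n. hp.hf (S n) (\<phi> n) (\<phi> n) \<le> C * real (Suc n) powr (2 * \<alpha> - \<sigma> - real CARD('d) / 2) + 1 / real (Suc n))"
proof -
  obtain M where M: "0 < M" "\<And>x :: int ^ 'd. u x \<le> M" using pot_bounded[OF ranges(1) \<alpha>(2), of "{0<..}"] by auto
  obtain C where C: "0 < C" "\<And>T B. 0 < T \<Longrightarrow> finite B \<Longrightarrow> (\<Sum>x\<in>B. \<rho>T T x * pot {T<..} \<alpha> x + pot {T<..} (\<alpha> - \<sigma>) x * v T x)
    \<le> C * T powr (2 * \<alpha> - \<sigma> - real CARD('d) / 2)" using truncated_cross_le by blast
  let ?T = "\<lambda>n. real (Suc n)"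
  have v_nn: "0 \<le> v T x" for T and x :: "int ^ 'd" by (rule pot_nonneg[OF ranges(1)]) auto
  have v_le: "v T x \<le> u x" if "0 < T" for T and x :: "int ^ 'd"
    using pot_split[of \<alpha> T x] pot_nonneg[OF ranges(1), of "{T<..}" x] ranges \<alpha> that by auto
  have "\<exists>B. finite B \<and> {x :: int ^ 'd. to_nat x \<le> n} \<subseteq> B \<and> M * k * (?T n powr \<alpha> / (\<alpha> * Gamma \<alpha>) - (\<Sum>x\<in>B. v (?T n) x)) \<le> 1 / ?T n" for n
  proof -
    let ?V = "?T n powr \<alpha> / (\<alpha> * Gamma \<alpha>)"
    have "(v (?T n) has_sum ?V) UNIV" by (rule pot_has_sum) (use ranges in auto)
    then have "((\<lambda>B. M * k * (?V - (\<Sum>x\<in>B. v (?T n) x))) \<longlongrightarrow> M * k * (?V - ?V)) (finite_subsets_at_top UNIV)"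
      unfolding has_sum_def by (intro tendsto_intros)
    then have "\<forall>\<^sub>F B in finite_subsets_at_top UNIV. M * k * (?V - (\<Sum>x\<in>B. v (?T n) x)) < 1 / ?T n"
      by (rule order_tendstoD) simp
    then obtain X where X: "finite X" "\<And>B. finite B \<Longrightarrow> X \<subseteq> B \<Longrightarrow> M * k * (?V - (\<Sum>x\<in>B. v (?T n) x)) < 1 / ?T n"
      unfolding eventually_finite_subsets_at_top by auto
    have "finite {x :: int ^ 'd. to_nat x \<le> n}"
      by (rule finite_imageD[where f = to_nat]) (auto intro: finite_subset[of _ "{..n}"])
    then have fin: "finite (X \<union> {x. to_nat x \<le> n})" using X(1) by simp
    then have "M * k * (?V - (\<Sum>x\<in>X \<union> {x. to_nat x \<le> n}. v (?T n) x)) \<le> 1 / ?T n"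
      by (intro less_imp_le[OF X(2)] Un_upper1)
    then show ?thesis using fin by blast
  qed
  then have "\<exists>B. \<forall>n. finite (B n) \<and> {x :: int ^ 'd. to_nat x \<le> n} \<subseteq> B n \<and> M * k * (?T n powr \<alpha> / (\<alpha> * Gamma \<alpha>) - (\<Sum>x\<in>B n. v (?T n) x)) \<le> 1 / ?T n"
    by (intro choice allI)
  then obtain B where B: "\<And>n. finite (B n)" "\<And>n. {x :: int ^ 'd. to_nat x \<le> n} \<subseteq> B n"
    "\<And>n. M * k * (?T n powr \<alpha> / (\<alpha> * Gamma \<alpha>) - (\<Sum>x\<in>B n. v (?T n) x)) \<le> 1 / ?T n" by blast
  define \<phi> where "\<phi> n x = (if x \<in> B n then v (?T n) x else 0)" for n x
  show ?thesis
  proof (intro exI[of _ \<phi>] exI[of _ B] exI[of _ C] conjI allI impI C B)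
    fix n and x :: "int ^ 'd"
    show "x \<notin> B n \<Longrightarrow> \<phi> n x = 0" by (simp add: \<phi>_def)
    show "0 \<le> \<phi> n x" using v_nn by (simp add: \<phi>_def)
    show "\<phi> n x \<le> u x" using v_le[of "?T n" x] u_pos[of x] by (simp add: \<phi>_def less_imp_le)
  next
    fix x :: "int ^ 'd"
    have "(\<lambda>n. v (?T n) x) \<longlonglongrightarrow> u x"
      using pot_tendsto_full[OF ranges(1) \<alpha>(2), of x] by (rule LIMSEQ_Suc)
    moreover have "\<forall>\<^sub>F n in sequentially. v (?T n) x = \<phi> n x"
      using eventually_ge_at_top[of "to_nat x"] by eventually_elim (use B(2) in \<open>auto simp: \<phi>_def\<close>)
    ultimately show "(\<lambda>n. \<phi> n x) \<longlonglongrightarrow> u x" by (rule Lim_transform_eventually)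
  next
    fix n
    have "hp.hf (B n) (\<phi> n) (\<phi> n) = hp.hf (B n) (v (?T n)) (v (?T n))"
      unfolding form_def \<phi>_def by simp
    also have "\<dots> \<le> (\<Sum>x\<in>B n. \<rho>T (?T n) x * pot {?T n<..} \<alpha> x + pot {?T n<..} (\<alpha> - \<sigma>) x * v (?T n) x)
      + M * k * (?T n powr \<alpha> / (\<alpha> * Gamma \<alpha>) - (\<Sum>x\<in>B n. v (?T n) x))"
      by (rule truncated_form_le) (use B order_trans[OF v_le M(2)] in auto)
    also have "\<dots> \<le> C * ?T n powr (2 * \<alpha> - \<sigma> - real CARD('d) / 2) + 1 / ?T n"
      using C(2)[of "?T n" "B n"] B(1,3)[of n] by (intro add_mono) auto
    finally show "hp.hf (B n) (\<phi> n) (\<phi> n) \<le> C * ?T n powr (2 * \<alpha> - \<sigma> - real CARD('d) / 2) + 1 / ?T n" .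
  qed
qed

end

section \<open>Summability of \<rho> u and the critical regimes\<close>

context riesz
begin

text \<open>The value of e^{-s\<Delta>} u at 0, that is, the pairing of u with the heat kernel at
  time s. Integrating it against s^{\<alpha>-\<sigma>-1} gives \<Sum> \<rho> u up to the Gamma
  factor.\<close>

definition G :: "real \<Rightarrow> real" where
  "G s = (LINT t:{0<..}|lborel. heat (s + t) (0 :: int ^ 'd) * t powr (\<alpha> - 1)) / Gamma \<alpha>"

lemma G_measurable [measurable]: "G \<in> borel_measurable borel"
  unfolding G_def[abs_def] set_lebesgue_integral_def by measurable

lemma heat_u_sum: "0 \<le> s \<Longrightarrow> ((\<lambda>y. heat s y * u y) has_sum G s) UNIV"
  using pot_semigroup(2)[OF ranges(1) \<alpha>(2), of "{0<..}" s 0] by (simp add: G_def)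

lemma G_nonneg: "0 \<le> s \<Longrightarrow> 0 \<le> G s"
  by (rule has_sum_nonneg[OF heat_u_sum]) (auto intro!: mult_nonneg_nonneg heat_nonneg less_imp_le[OF u_pos])

lemma G_bounded: "\<exists>M>0. \<forall>s\<ge>0. G s \<le> M"
proof -
  obtain M where M: "0 < M" "\<And>x :: int ^ 'd. u x \<le> M" using pot_bounded[OF ranges(1) \<alpha>(2), of "{0<..}"] by auto
  have "G s \<le> 1 * M" if "0 \<le> s" for s
    by (rule has_sum_mono[OF heat_u_sum[OF that] has_sum_cmult_left[OF heat_mass[OF that]]])
       (use M that heat_nonneg in \<open>auto intro!: mult_left_mono\<close>)
  then show ?thesis using M(1) by auto
qed

text \<open>Split u at time s: the early part has mass of order s^\<alpha> and meets the maximum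
  s^{-d/2} of the heat kernel, the late part has maximum of order s^{\<alpha>-d/2} and meets mass
  1.\<close>

lemma G_upper: "\<exists>C>0. \<forall>s>0. G s \<le> C * s powr (\<alpha> - real CARD('d) / 2)"
proof -
  let ?D = "real CARD('d) / 2"
  obtain C where C: "0 < C" "\<And>t x. 0 < t \<Longrightarrow> heat t (x :: int ^ 'd) \<le> C * t powr (- real CARD('d) / 2)"
    using heat_upper by blast
  obtain C1 where C1: "0 < C1" "\<And>T x. 0 < T \<Longrightarrow> pot {T<..} \<alpha> (x :: int ^ 'd) \<le> C1 * T powr (\<alpha> - ?D)"
    using pot_tail_le[OF ranges(1) \<alpha>(2)] by blast
  define a where "a = \<alpha> * Gamma \<alpha>"
  have a: "0 < a" using ranges Gamma_real_pos[of \<alpha>] by (simp add: a_def)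
  have "G s \<le> (C / a + C1) * s powr (\<alpha> - ?D)" if s: "0 < s" for s
  proof -
    have hn: "0 \<le> heat s y" for y :: "int ^ 'd" using heat_nonneg[of s y] s by simp
    have vn: "0 \<le> v s y" for y :: "int ^ 'd" by (rule pot_nonneg[OF ranges(1)]) auto
    have "G s \<le> C * s powr (- real CARD('d) / 2) * (s powr \<alpha> / a) + 1 * (C1 * s powr (\<alpha> - ?D))"
      unfolding a_def
    proof (rule has_sum_mono[OF heat_u_sum])
      show "((\<lambda>y. C * s powr (- real CARD('d) / 2) * v s y + heat s y * (C1 * s powr (\<alpha> - ?D))) has_sum
        C * s powr (- real CARD('d) / 2) * (s powr \<alpha> / (\<alpha> * Gamma \<alpha>)) + 1 * (C1 * s powr (\<alpha> - ?D))) UNIV"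
        by (intro has_sum_add has_sum_cmult_right has_sum_cmult_left pot_has_sum heat_mass) (use s ranges in auto)
      fix y :: "int ^ 'd"
      have "u y = v s y + pot {s<..} \<alpha> y" by (rule pot_split) (use ranges \<alpha> s in auto)
      moreover have "heat s y * v s y \<le> C * s powr (- real CARD('d) / 2) * v s y"
        by (intro mult_right_mono C s vn)
      moreover have "heat s y * pot {s<..} \<alpha> y \<le> heat s y * (C1 * s powr (\<alpha> - ?D))"
        by (intro mult_left_mono C1 s hn)
      ultimately show "heat s y * u y \<le> C * s powr (- real CARD('d) / 2) * v s y + heat s y * (C1 * s powr (\<alpha> - ?D))"
        by (simp add: distrib_left)
    qed (use s in simp)
    also have "C * s powr (- real CARD('d) / 2) * (s powr \<alpha> / a) = C / a * (s powr (- real CARD('d) / 2) * s powr \<alpha>)" by simp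
    also have "s powr (- real CARD('d) / 2) * s powr \<alpha> = s powr (\<alpha> - ?D)"
      unfolding powr_add[symmetric] by simp
    finally show ?thesis by (simp add: distrib_right)
  qed
  moreover have "0 < C / a + C1" using C C1 a by (simp add: add_pos_pos)
  ultimately show ?thesis by blast
qed

lemma G_lower: "\<exists>c>0. \<exists>T>0. \<forall>s\<ge>T. c * s powr (\<alpha> - real CARD('d) / 2) \<le> G s"
proof -
  let ?D = "real CARD('d) / 2"
  obtain c T where c: "0 < c" "0 < T" "\<And>t. T \<le> t \<Longrightarrow> c * t powr (- real CARD('d) / 2) \<le> heat t (0 :: int ^ 'd)"
    using heat_lower by blast
  \<comment> \<open>Only t between s and 2s is used: there s + t \<le> 3s, and t^{\<alpha>-1}
    integrates to s^\<alpha> (2^\<alpha> - 1) / \<alpha>.\<close>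
  define c' where "c' = c * 3 powr (- real CARD('d) / 2) * ((2 powr \<alpha> - 1) / \<alpha>) / Gamma \<alpha>"
  have p2: "1 < 2 powr \<alpha>" using ranges by simp
  have c': "0 < c'" using c ranges p2 Gamma_real_pos[of \<alpha>] by (simp add: c'_def)
  have "c' * s powr (\<alpha> - ?D) \<le> G s" if s: "T \<le> s" for s
  proof -
    have s0: "0 < s" using s c by simp
    have i: "set_integrable lborel {0<..} (\<lambda>t. heat (s + t) (0 :: int ^ 'd) * t powr (\<alpha> - 1))"
      by (rule pot_semigroup(1)) (use ranges \<alpha> s0 in auto)
    have sub: "set_integrable lborel {s<..2 * s} (\<lambda>t. t powr (\<alpha> - 1))"
      by (rule set_integrable_subset[OF set_integral_powr_from_0(1)[of \<alpha> "2 * s"]]) (use s0 ranges in auto)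
    have val: "(LINT t:{s<..2 * s}|lborel. t powr (\<alpha> - 1)) = s powr \<alpha> * ((2 powr \<alpha> - 1) / \<alpha>)"
    proof -
      have "{0<..2 * s} = {0<..s} \<union> {s<..2 * s}" using s0 by auto
      then have "(LINT t:{0<..2 * s}|lborel. t powr (\<alpha> - 1)) = (LINT t:{0<..s}|lborel. t powr (\<alpha> - 1)) + (LINT t:{s<..2 * s}|lborel. t powr (\<alpha> - 1))"
        by (simp only:) (rule set_integral_Un, use s0 ranges sub set_integral_powr_from_0(1) in auto)
      then show ?thesis
        using set_integral_powr_from_0(2)[of \<alpha> s] set_integral_powr_from_0(2)[of \<alpha> "2 * s"] s0 ranges
        by (simp add: powr_mult diff_divide_distrib right_diff_distrib mult.commute)
    qed
    have "c * (3 * s) powr (- real CARD('d) / 2) * (LINT t:{s<..2 * s}|lborel. t powr (\<alpha> - 1))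
      = (LINT t:{s<..2 * s}|lborel. c * (3 * s) powr (- real CARD('d) / 2) * t powr (\<alpha> - 1))" by simp
    also have "\<dots> \<le> (LINT t:{s<..2 * s}|lborel. heat (s + t) (0 :: int ^ 'd) * t powr (\<alpha> - 1))"
    proof (rule set_integral_mono)
      show "set_integrable lborel {s<..2 * s} (\<lambda>t. c * (3 * s) powr (- real CARD('d) / 2) * t powr (\<alpha> - 1))"
        by (rule set_integrable_mult_right) (rule sub)
      show "set_integrable lborel {s<..2 * s} (\<lambda>t. heat (s + t) (0 :: int ^ 'd) * t powr (\<alpha> - 1))"
        by (rule set_integrable_subset[OF i]) (use s0 in auto)
      fix t assume t: "t \<in> {s<..2 * s}"
      have "c * (3 * s) powr (- real CARD('d) / 2) \<le> c * (s + t) powr (- real CARD('d) / 2)"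
        using t s0 c by (intro mult_left_mono powr_mono2') auto
      also have "\<dots> \<le> heat (s + t) (0 :: int ^ 'd)" using c(3)[of "s + t"] s s0 t by simp
      finally show "c * (3 * s) powr (- real CARD('d) / 2) * t powr (\<alpha> - 1) \<le> heat (s + t) (0 :: int ^ 'd) * t powr (\<alpha> - 1)"
        by (intro mult_right_mono) auto
    qed
    also have "\<dots> \<le> (LINT t:{0<..}|lborel. heat (s + t) (0 :: int ^ 'd) * t powr (\<alpha> - 1))"
    proof -
      have "integrable lborel (\<lambda>t. indicator {s<..2 * s} t *\<^sub>R (heat (s + t) (0 :: int ^ 'd) * t powr (\<alpha> - 1)))"
      proof -
        have "{s<..2 * s} \<subseteq> {0<..}" using s0 by auto
        from set_integrable_subset[OF i _ this] show ?thesis by (simp add: set_integrable_def)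
      qed
      then show ?thesis
        using i unfolding set_lebesgue_integral_def set_integrable_def
        by (rule integral_mono) (use s0 heat_nonneg[of "s + _" "0 :: int ^ 'd"] in \<open>auto simp: indicator_def\<close>)
    qed
    finally have "c * (3 * s) powr (- real CARD('d) / 2) * (LINT t:{s<..2 * s}|lborel. t powr (\<alpha> - 1)) / Gamma \<alpha> \<le> G s"
      unfolding G_def using Gamma_real_pos[of \<alpha>] ranges by (intro divide_right_mono) auto
    moreover have "c * (3 * s) powr (- real CARD('d) / 2) * (LINT t:{s<..2 * s}|lborel. t powr (\<alpha> - 1)) / Gamma \<alpha>
      = c' * (s powr (- real CARD('d) / 2) * s powr \<alpha>)"
      unfolding val c'_def using s0 by (simp add: powr_mult mult_ac)
    moreover have "s powr (- real CARD('d) / 2) * s powr \<alpha> = s powr (\<alpha> - ?D)"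
      unfolding powr_add[symmetric] by simp
    ultimately show ?thesis by simp
  qed
  then show ?thesis using c' c(2) by blast
qed

lemma \<rho>T_u_sum:
  assumes S: "S \<in> sets borel" "S \<subseteq> {0<..}"
    and g: "set_integrable lborel S (\<lambda>s. G s * s powr (\<alpha> - \<sigma> - 1))"
  shows "((\<lambda>y. pot S (\<alpha> - \<sigma>) y * u y) has_sum (LINT s:S|lborel. G s * s powr (\<alpha> - \<sigma> - 1)) / Gamma (\<alpha> - \<sigma>)) UNIV"
proof -
  have "((\<lambda>y. LINT s:S|lborel. heat s y * u y * s powr (\<alpha> - \<sigma> - 1)) has_sum (LINT s:S|lborel. G s * s powr (\<alpha> - \<sigma> - 1))) UNIV"
  proof (rule has_sum_set_integral[OF S(1) _ _ _ g])
    show "(\<lambda>s. heat s y * u y * s powr (\<alpha> - \<sigma> - 1)) \<in> borel_measurable borel" for y by measurable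
    show "0 \<le> heat s y * u y * s powr (\<alpha> - \<sigma> - 1)" if "s \<in> S" for s y
      using heat_nonneg[of s y] u_pos[of y] S that by auto
    show "((\<lambda>y. heat s y * u y * s powr (\<alpha> - \<sigma> - 1)) has_sum G s * s powr (\<alpha> - \<sigma> - 1)) UNIV" if "s \<in> S" for s
      using S that by (intro has_sum_cmult_left heat_u_sum) auto
  qed
  then have "((\<lambda>y. (LINT s:S|lborel. heat s y * u y * s powr (\<alpha> - \<sigma> - 1)) * (1 / Gamma (\<alpha> - \<sigma>))) has_sum
    (LINT s:S|lborel. G s * s powr (\<alpha> - \<sigma> - 1)) * (1 / Gamma (\<alpha> - \<sigma>))) UNIV"
    by (rule has_sum_cmult_left)
  moreover have "(LINT s:S|lborel. heat s y * u y * s powr (\<alpha> - \<sigma> - 1)) * (1 / Gamma (\<alpha> - \<sigma>)) = pot S (\<alpha> - \<sigma>) y * u y" for y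
  proof -
    have "(LINT s:S|lborel. heat s y * u y * s powr (\<alpha> - \<sigma> - 1)) = (LINT s:S|lborel. u y * (heat s y * s powr (\<alpha> - \<sigma> - 1)))"
      by (simp add: mult_ac)
    then show ?thesis by (simp add: pot_def[of S])
  qed
  ultimately show ?thesis by simp
qed

lemma wsum_u: "wsum (hardy_w \<sigma> \<alpha>) u = (\<integral>\<^sup>+x. ennreal (\<rho> x * u x) \<partial>count_space UNIV)"
  unfolding wsum_eq_nn_integral hardy_w_eq
  using u_pos by (intro nn_integral_cong) (simp add: power2_eq_square less_imp_neq[THEN not_sym])

text \<open>For large s the integrand is of order s^{2\<alpha>-\<sigma>-d/2-1}, which is integrable
  under the assumption; near 0 boundedness of G suffices.\<close>

lemma wsum_u_finite:
  assumes "2 * \<alpha> - \<sigma> < real CARD('d) / 2"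
  shows "wsum (hardy_w \<sigma> \<alpha>) u < \<top>"
proof -
  let ?D = "real CARD('d) / 2"
  obtain M where M: "0 < M" "\<And>s. 0 \<le> s \<Longrightarrow> G s \<le> M" using G_bounded by blast
  obtain C where C: "0 < C" "\<And>s. 0 < s \<Longrightarrow> G s \<le> C * s powr (\<alpha> - ?D)" using G_upper by blast
  let ?g = "\<lambda>s. G s * s powr (\<alpha> - \<sigma> - 1)"
  have "set_integrable lborel {0<..1} ?g"
  proof (rule set_integrable_comparison[where g = "\<lambda>s. M * s powr (\<alpha> - \<sigma> - 1)"])
    show "set_integrable lborel {0<..1} (\<lambda>s. M * s powr (\<alpha> - \<sigma> - 1))"
      by (rule set_integrable_mult_right) (use set_integral_powr_from_0(1)[of "\<alpha> - \<sigma>" 1] ranges in auto)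
    fix s :: real assume "s \<in> {0<..1}"
    then show "\<bar>?g s\<bar> \<le> M * s powr (\<alpha> - \<sigma> - 1)"
      using M(2)[of s] G_nonneg[of s] by (auto simp: abs_mult intro!: mult_right_mono)
  qed auto
  moreover have "set_integrable lborel {1<..} ?g"
  proof (rule set_integrable_comparison[where g = "\<lambda>s. C * s powr (- (?D - 2 * \<alpha> + \<sigma>) - 1)"])
    show "set_integrable lborel {1<..} (\<lambda>s. C * s powr (- (?D - 2 * \<alpha> + \<sigma>) - 1))"
      by (rule set_integrable_mult_right) (use set_integral_powr_to_inf(1)[of "?D - 2 * \<alpha> + \<sigma>" 1] assms in auto)
    fix s :: real assume s: "s \<in> {1<..}"
    have "?g s \<le> C * s powr (\<alpha> - ?D) * s powr (\<alpha> - \<sigma> - 1)"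
      using C(2)[of s] s by (intro mult_right_mono) auto
    also have "\<dots> = C * s powr (- (?D - 2 * \<alpha> + \<sigma>) - 1)"
      by (simp add: mult.assoc powr_add[symmetric] algebra_simps)
    finally show "\<bar>?g s\<bar> \<le> C * s powr (- (?D - 2 * \<alpha> + \<sigma>) - 1)" using G_nonneg[of s] s by simp
  qed auto
  ultimately have "set_integrable lborel ({0<..1} \<union> {1<..}) ?g" by (rule set_integrable_Un) auto
  moreover have "{0<..1} \<union> {1<..} = {0::real<..}" by auto
  ultimately have "set_integrable lborel {0<..} ?g" by simp
  from \<rho>T_u_sum[OF _ _ this]
  have "((\<lambda>y. \<rho> y * u y) has_sum (LINT s:{0<..}|lborel. ?g s) / Gamma (\<alpha> - \<sigma>)) UNIV" by simp
  from has_sum_imp_nn_integral[OF this] show ?thesis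
    unfolding wsum_u using \<rho>_pos u_pos by (simp add: less_imp_le)
qed

text \<open>At the threshold the integrand is at least c / s for large s, so restricting \<rho> to
  times up to N already gives a sum growing like log N.\<close>

lemma wsum_u_infinite:
  assumes "2 * \<alpha> - \<sigma> = real CARD('d) / 2"
  shows "wsum (hardy_w \<sigma> \<alpha>) u = \<top>"
proof (rule ccontr)
  let ?D = "real CARD('d) / 2"
  assume "wsum (hardy_w \<sigma> \<alpha>) u \<noteq> \<top>"
  then obtain V where V: "wsum (hardy_w \<sigma> \<alpha>) u = ennreal V" "0 \<le> V"
    by (cases "wsum (hardy_w \<sigma> \<alpha>) u") auto
  obtain M where M: "0 < M" "\<And>s. 0 \<le> s \<Longrightarrow> G s \<le> M" using G_bounded by blast
  obtain c T where c: "0 < c" "0 < T" "\<And>s. T \<le> s \<Longrightarrow> c * s powr (\<alpha> - ?D) \<le> G s" using G_lower by blast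
  let ?g = "\<lambda>s. G s * s powr (\<alpha> - \<sigma> - 1)"
  have \<Gamma>: "0 < Gamma (\<alpha> - \<sigma>)" using ranges by (simp add: Gamma_real_pos)
  have bound: "c * (ln N - ln T) / Gamma (\<alpha> - \<sigma>) \<le> V" if N: "T \<le> N" for N
  proof -
    have ig: "set_integrable lborel {0<..N} ?g"
    proof (rule set_integrable_comparison[where g = "\<lambda>s. M * s powr (\<alpha> - \<sigma> - 1)"])
      show "set_integrable lborel {0<..N} (\<lambda>s. M * s powr (\<alpha> - \<sigma> - 1))"
        by (rule set_integrable_mult_right) (use set_integral_powr_from_0(1)[of "\<alpha> - \<sigma>" N] ranges N c in auto)
      fix s :: real assume "s \<in> {0<..N}"
      then show "\<bar>?g s\<bar> \<le> M * s powr (\<alpha> - \<sigma> - 1)"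
        using M(2)[of s] G_nonneg[of s] by (auto simp: abs_mult intro!: mult_right_mono)
    qed auto
    have le: "(LINT s:{0<..N}|lborel. ?g s) / Gamma (\<alpha> - \<sigma>) \<le> V"
    proof -
      have "((\<lambda>y. \<rho>T N y * u y) has_sum (LINT s:{0<..N}|lborel. ?g s) / Gamma (\<alpha> - \<sigma>)) UNIV"
        by (rule \<rho>T_u_sum) (use ig in auto)
      moreover have n: "0 \<le> \<rho>T N y" for y :: "int ^ 'd" by (rule pot_nonneg[OF ranges(2)]) auto
      ultimately have "ennreal ((LINT s:{0<..N}|lborel. ?g s) / Gamma (\<alpha> - \<sigma>)) = (\<integral>\<^sup>+y. ennreal (\<rho>T N y * u y) \<partial>count_space UNIV)"
        using u_pos by (intro has_sum_imp_nn_integral[symmetric]) (auto simp: less_imp_le)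
      also have "\<dots> \<le> wsum (hardy_w \<sigma> \<alpha>) u"
        unfolding wsum_u
      proof (intro nn_integral_mono ennreal_leI mult_right_mono)
        fix y :: "int ^ 'd"
        show "\<rho>T N y \<le> \<rho> y"
          using pot_split[OF ranges(2,3), of N y] pot_nonneg[OF ranges(2), of "{N<..}" y] N c by auto
        show "0 \<le> u y" using u_pos[of y] by simp
      qed
      finally show ?thesis unfolding V(1) using V(2) by simp
    qed
    have "((\<lambda>s. 1 / s) has_integral ln N - ln T) {T..N}"
      by (rule fundamental_theorem_of_calculus[OF N])
         (use c in \<open>auto intro!: derivative_eq_intros simp: has_real_derivative_iff_has_vector_derivative[symmetric]\<close>)
    then have "set_integrable lborel {T..N} (\<lambda>s. 1 / s)" "(LINT s:{T..N}|lborel. 1 / s) = ln N - ln T"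
      using has_integral_nonneg_lborel[of "\<lambda>s. 1 / s" "{T..N}"] c by auto
    note l = this
    have "c * (ln N - ln T) = (LINT s:{T..N}|lborel. c * (1 / s))" using l(2) by (simp only: set_integral_mult_right)
    also have "\<dots> \<le> (LINT s:{T..N}|lborel. ?g s)"
    proof (rule set_integral_mono)
      show "set_integrable lborel {T..N} (\<lambda>s. c * (1 / s))" by (rule set_integrable_mult_right) (rule l(1))
      show "set_integrable lborel {T..N} ?g" by (rule set_integrable_subset[OF ig]) (use c in auto)
      fix s assume s: "s \<in> {T..N}"
      have "c * (1 / s) = c * s powr (\<alpha> - ?D) * s powr (\<alpha> - \<sigma> - 1)"
      proof -
        have e: "(\<alpha> - ?D) + (\<alpha> - \<sigma> - 1) = -1" using assms by simp
        have "s powr (\<alpha> - ?D) * s powr (\<alpha> - \<sigma> - 1) = s powr (-1)" by (simp only: powr_add[symmetric] e)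
        also have "\<dots> = 1 / s" using s c powr_minus_divide[of s 1] by simp
        finally show ?thesis by (simp add: mult.assoc)
      qed
      also have "\<dots> \<le> ?g s" using c(3)[of s] s by (intro mult_right_mono) auto
      finally show "c * (1 / s) \<le> ?g s" .
    qed
    also have "\<dots> \<le> (LINT s:{0<..N}|lborel. ?g s)"
    proof -
      have "integrable lborel (\<lambda>s. indicator {T..N} s *\<^sub>R ?g s)"
      proof -
        have "{T..N} \<subseteq> {0<..N}" using c by auto
        from set_integrable_subset[OF ig _ this] show ?thesis by (simp add: set_integrable_def)
      qed
      then show ?thesis
        using ig unfolding set_lebesgue_integral_def set_integrable_def
        by (rule integral_mono) (use c G_nonneg in \<open>auto simp: indicator_def\<close>)
    qed
    finally have "c * (ln N - ln T) / Gamma (\<alpha> - \<sigma>) \<le> (LINT s:{0<..N}|lborel. ?g s) / Gamma (\<alpha> - \<sigma>)"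
      using \<Gamma> by (intro divide_right_mono) auto
    then show ?thesis using le by linarith
  qed
  \<comment> \<open>Chosen so that the lower bound for the sum is at least V + 1.\<close>
  define N where "N = max T (exp (ln T + (V + 1) * Gamma (\<alpha> - \<sigma>) / c))"
  have "ln T + (V + 1) * Gamma (\<alpha> - \<sigma>) / c \<le> ln N"
    unfolding N_def using c by (subst ln_exp[symmetric]) (rule ln_mono, auto)
  then have "(V + 1) * Gamma (\<alpha> - \<sigma>) \<le> c * (ln N - ln T)" using c by (simp add: field_simps)
  then have "V + 1 \<le> c * (ln N - ln T) / Gamma (\<alpha> - \<sigma>)" using \<Gamma> by (simp add: field_simps)
  then show False using bound[of N] by (simp add: N_def)
qed

lemma positive_critical:
  assumes "2 * \<alpha> - \<sigma> < real CARD('d) / 2"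
  shows "positive_critical \<sigma> (hardy_w \<sigma> \<alpha> :: int ^ 'd \<Rightarrow> real)"
proof -
  obtain \<phi> S C where t: "\<And>n. finite (S n)" "\<And>n x. x \<notin> S n \<Longrightarrow> \<phi> n x = 0" "\<And>n x. 0 \<le> \<phi> n x" "\<And>n x. \<phi> n x \<le> u x"
    "\<And>x. (\<lambda>n. \<phi> n x) \<longlonglongrightarrow> u x"
    "\<And>n. hp.hf (S n) (\<phi> n) (\<phi> n) \<le> C * real (Suc n) powr (2 * \<alpha> - \<sigma> - real CARD('d) / 2) + 1 / real (Suc n)"
    using test_sequence by blast
  have "(\<lambda>n. C * real (Suc n) powr (2 * \<alpha> - \<sigma> - real CARD('d) / 2) + 1 / real (Suc n)) \<longlonglongrightarrow> C * 0 + 0"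
  proof (intro tendsto_add tendsto_mult tendsto_const tendsto_neg_powr)
    show "filterlim (\<lambda>n. real (Suc n)) at_top sequentially"
      using filterlim_real_sequentially by (rule filterlim_compose[OF _ filterlim_Suc])
    show "(\<lambda>n. 1 / real (Suc n)) \<longlonglongrightarrow> 0" by (rule LIMSEQ_Suc[OF lim_1_over_n])
  qed (use assms in auto)
  then show ?thesis
    by (intro hp.positive_critical_if[OF wsum_u_finite[OF assms] _ t(1,2,6,3,4,5)]) simp
qed

lemma null_critical:
  assumes "2 * \<alpha> - \<sigma> = real CARD('d) / 2"
  shows "null_critical \<sigma> (hardy_w \<sigma> \<alpha> :: int ^ 'd \<Rightarrow> real)"
proof (rule hp.null_critical_if[OF _ wsum_u_infinite[OF assms]])
  obtain \<phi> S C where t: "\<And>n. finite (S n)" "\<And>n x. x \<notin> S n \<Longrightarrow> \<phi> n x = 0" "\<And>n x. 0 \<le> \<phi> n x" "\<And>n x. \<phi> n x \<le> u x"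
    "\<And>x. (\<lambda>n. \<phi> n x) \<longlonglongrightarrow> u x"
    "\<And>n. hp.hf (S n) (\<phi> n) (\<phi> n) \<le> C * real (Suc n) powr (2 * \<alpha> - \<sigma> - real CARD('d) / 2) + 1 / real (Suc n)"
    using test_sequence by blast
  have "hp.hf (S n) (\<phi> n) (\<phi> n) \<le> C + 1" for n
  proof -
    have "1 / real (Suc n) \<le> 1" by simp
    moreover have z: "2 * \<alpha> - \<sigma> - real CARD('d) / 2 = 0" using assms by simp
    have "real (Suc n) powr (2 * \<alpha> - \<sigma> - real CARD('d) / 2) = 1" unfolding z by simp
    then have "hp.hf (S n) (\<phi> n) (\<phi> n) \<le> C * 1 + 1 / real (Suc n)" using t(6)[of n] by (simp only:)
    ultimately show ?thesis by linarith
  qed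
  note bound = this
  have "hp.null_seq (C + 1) \<phi>"
    unfolding hp.null_seq_def
  proof (intro conjI allI)
    fix n show "\<exists>S. finite S \<and> (\<forall>x. x \<notin> S \<longrightarrow> \<phi> n x = 0) \<and> hp.hf S (\<phi> n) (\<phi> n) \<le> C + 1"
      using t(1,2) bound[of n] by (intro exI[of _ "S n"]) auto
  qed (rule t)+
  then show "critical \<sigma> (hardy_w \<sigma> \<alpha> :: int ^ 'd \<Rightarrow> real)" by (rule hp.critical_if_bounded)
qed

end

section \<open>Asymptotics at infinity\<close>

text \<open>Euler's integral after the substitution s = 1 / (4\<tau>); it evaluates the time
  integral of the limiting Gaussian.\<close>

lemma inverse_Gamma_integral:
  assumes "0 < (b :: real)"
  shows "set_integrable lborel {0<..} (\<lambda>\<tau>. \<tau> powr (- b - 1) * exp (- (1 / (4 * \<tau>))))"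
    and "(LINT \<tau>:{0<..}|lborel. \<tau> powr (- b - 1) * exp (- (1 / (4 * \<tau>)))) = 4 powr b * Gamma b"
proof -
  let ?f = "\<lambda>s::real. s powr (b - 1) * exp (- s)"
  let ?g = "\<lambda>\<tau>::real. 1 / (4 * \<tau>)" and ?g' = "\<lambda>\<tau>::real. - 1 / (4 * \<tau>^2)"
  have f0: "(?f has_integral Gamma b) {0<..}"
    using Gamma_integral_real[OF assms]
    by (subst (asm) has_integral_spike_set_eq[where T = "{0<..}"])
       (auto intro: negligible_subset[of "{0}"] simp: exp_minus divide_inverse)
  have fa: "?f absolutely_integrable_on {0<..}"
    by (rule nonnegative_absolutely_integrable_1) (use f0 in auto)
  have im: "?g ` {0<..} = {0<..}"
  proof (intro equalityI subsetI)
    fix s :: real assume "s \<in> {0<..}"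
    then show "s \<in> ?g ` {0<..}" by (intro image_eqI[of _ _ "1 / (4 * s)"]) auto
  qed auto
  have "(\<lambda>\<tau>. \<bar>?g' \<tau>\<bar> * ?f (?g \<tau>)) absolutely_integrable_on {0<..} \<and>
      integral {0<..} (\<lambda>\<tau>. \<bar>?g' \<tau>\<bar> * ?f (?g \<tau>)) = Gamma b
    \<longleftrightarrow> ?f absolutely_integrable_on (?g ` {0<..}) \<and> integral (?g ` {0<..}) ?f = Gamma b"
  proof (rule has_absolute_integral_change_of_variables_1')
    fix \<tau> :: real assume "\<tau> \<in> {0<..}"
    then show "(?g has_field_derivative ?g' \<tau>) (at \<tau> within {0<..})"
      by (auto intro!: derivative_eq_intros simp: power2_eq_square)
  qed (auto simp: inj_on_def)
  then have "(\<lambda>\<tau>. \<bar>?g' \<tau>\<bar> * ?f (?g \<tau>)) absolutely_integrable_on {0<..}"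
    and "integral {0<..} (\<lambda>\<tau>. \<bar>?g' \<tau>\<bar> * ?f (?g \<tau>)) = Gamma b"
    using fa f0 by (auto simp only: im integral_unique)
  then have h: "((\<lambda>\<tau>. \<bar>?g' \<tau>\<bar> * ?f (?g \<tau>)) has_integral Gamma b) {0<..}"
    using has_integral_integral[of "\<lambda>\<tau>. \<bar>?g' \<tau>\<bar> * ?f (?g \<tau>)" "{0<..}"]
    by (auto dest: set_lebesgue_integral_eq_integral(1))
  have eq: "\<bar>?g' \<tau>\<bar> * ?f (?g \<tau>) = 4 powr (- b) * (\<tau> powr (- b - 1) * exp (- (1 / (4 * \<tau>))))" if "\<tau> \<in> {0<..}" for \<tau>
  proof -
    have t: "0 < \<tau>" using that by simp
    have "\<bar>?g' \<tau>\<bar> = 4 powr (-1) * \<tau> powr (-2)"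
      using t by (simp add: powr_minus powr_numeral field_simps)
    moreover have "?g \<tau> powr (b - 1) = 4 powr (1 - b) * \<tau> powr (1 - b)"
      using t by (simp add: powr_divide powr_mult powr_minus_divide[of _ "b - 1", simplified])
    moreover have "4 powr (-1) * 4 powr (1 - b) = (4 :: real) powr (- b)" by (simp only: powr_add[symmetric]) simp
    moreover have e: "-2 + (1 - b) = - b - 1" by simp
    have "\<tau> powr (-2) * \<tau> powr (1 - b) = \<tau> powr (- b - 1)" by (simp only: powr_add[symmetric] e)
    moreover have "(4 powr (-1) * \<tau> powr (-2)) * ((4 powr (1 - b) * \<tau> powr (1 - b)) * E)
        = (4 powr (-1) * 4 powr (1 - b)) * ((\<tau> powr (-2) * \<tau> powr (1 - b)) * E)" for E
      by (simp only: mult_ac)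
    ultimately show ?thesis by (simp only:)
  qed
  have "((\<lambda>\<tau>. 4 powr (- b) * (\<tau> powr (- b - 1) * exp (- (1 / (4 * \<tau>))))) has_integral Gamma b) {0<..}"
    by (rule has_integral_eq[OF _ h]) (rule eq)
  from has_integral_mult_right[OF this, of "4 powr b"]
  have "((\<lambda>\<tau>. 4 powr b * (4 powr (- b) * (\<tau> powr (- b - 1) * exp (- (1 / (4 * \<tau>)))))) has_integral 4 powr b * Gamma b) {0<..}" .
  moreover have "4 powr b * (4 powr (- b) * y) = (y :: real)" for y
    by (simp add: mult.assoc[symmetric] powr_add[symmetric])
  ultimately have "((\<lambda>\<tau>. \<tau> powr (- b - 1) * exp (- (1 / (4 * \<tau>)))) has_integral 4 powr b * Gamma b) {0<..}" by simp
  from has_integral_nonneg_lborel[OF _ _ _ this]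
  show "set_integrable lborel {0<..} (\<lambda>\<tau>. \<tau> powr (- b - 1) * exp (- (1 / (4 * \<tau>))))"
    and "(LINT \<tau>:{0<..}|lborel. \<tau> powr (- b - 1) * exp (- (1 / (4 * \<tau>)))) = 4 powr b * Gamma b"
    by auto
qed

lemma square_powr: "0 < R \<Longrightarrow> (R^2) powr p = R powr (2 * p)" for R :: real
  using powr_powr[of R 2 p] by (simp add: powr_numeral)

text \<open>With D = d/2, the coefficient of |x|^{2a-d} in the Riesz kernel of Euclidean
  space.\<close>

definition riesz_const :: "real \<Rightarrow> real \<Rightarrow> real" where
  "riesz_const D a = 4 powr (D - a) * Gamma (D - a) / ((4 * pi) powr D * Gamma a)"

lemma pot_scaled:
  assumes "0 < R"
  shows "R powr (real CARD('d) - 2 * a) * pot {0<..} a (x :: int ^ 'd::finite)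
    = (LINT \<tau>:{0<..}|lborel. R powr real CARD('d) * heat (R^2 * \<tau>) x * \<tau> powr (a - 1)) / Gamma a"
proof -
  let ?d = "real CARD('d)"
  let ?f = "\<lambda>t. indicator {0<..} t * (heat t x * t powr (a - 1))"
  have R2: "R^2 \<noteq> 0" using assms by simp
  have "(\<integral>t. ?f t \<partial>lborel) = \<bar>R^2\<bar> *\<^sub>R (\<integral>\<tau>. ?f (0 + R^2 * \<tau>) \<partial>lborel)"
    by (rule lborel_integral_real_affine[OF R2])
  also have "\<dots> = R^2 * (\<integral>\<tau>. ?f (R^2 * \<tau>) \<partial>lborel)" by simp
  also have "\<dots> = (\<integral>\<tau>. R^2 * ?f (R^2 * \<tau>) \<partial>lborel)" by simp
  finally have "R powr (?d - 2 * a) * (\<integral>t. ?f t \<partial>lborel) = (\<integral>\<tau>. R powr (?d - 2 * a) * (R^2 * ?f (R^2 * \<tau>)) \<partial>lborel)" by simp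
  also have "\<dots> = (\<integral>\<tau>. indicator {0<..} \<tau> * (R powr ?d * heat (R^2 * \<tau>) x * \<tau> powr (a - 1)) \<partial>lborel)"
  proof (rule Bochner_Integration.integral_cong[OF refl])
    fix \<tau> :: real
    show "R powr (?d - 2 * a) * (R^2 * ?f (R^2 * \<tau>)) = indicator {0<..} \<tau> * (R powr ?d * heat (R^2 * \<tau>) x * \<tau> powr (a - 1))"
    proof (cases "0 < \<tau>")
      case True
      have "(R^2 * \<tau>) powr (a - 1) = R powr (2 * (a - 1)) * \<tau> powr (a - 1)"
        using assms True by (simp add: powr_mult square_powr)
      moreover have "R powr (?d - 2 * a) * (R^2 * R powr (2 * (a - 1))) = R powr ?d"
      proof -
        have "R^2 = R powr 2" using assms by (simp add: powr_numeral)
        moreover have "(?d - 2 * a) + (2 + 2 * (a - 1)) = ?d" by simp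
        ultimately show ?thesis by (simp only: powr_add[symmetric])
      qed
      moreover have "p * (q * (h * (r * s))) = (p * (q * r)) * h * s" for p q h r s :: real
        by (simp only: mult_ac)
      ultimately have "R powr (?d - 2 * a) * (R^2 * (heat (R^2 * \<tau>) x * (R^2 * \<tau>) powr (a - 1)))
        = R powr ?d * heat (R^2 * \<tau>) x * \<tau> powr (a - 1)" by (simp only:)
      then show ?thesis using True assms by (simp add: zero_less_mult_iff)
    qed (use assms in \<open>simp add: zero_less_mult_iff\<close>)
  qed
  finally show ?thesis by (simp add: pot_def set_lebesgue_integral_def)
qed

text \<open>In the parabolic variable \<tau> = t / |x|^2 every fixed \<tau> corresponds to t tending
  to infinity, so the local limit theorem gives the pointwise limit; the rest is dominated
  convergence.\<close>

lemma pot_asymptotics: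
  fixes X :: "nat \<Rightarrow> int ^ 'd::finite"
  assumes a: "0 < a" "a < real CARD('d) / 2" and X: "filterlim (\<lambda>n. lnorm (X n)) at_top sequentially"
  shows "(\<lambda>n. lnorm (X n) powr (real CARD('d) - 2 * a) * pot {0<..} a (X n)) \<longlonglongrightarrow> riesz_const (real CARD('d) / 2) a"
proof -
  let ?d = "real CARD('d)" and ?D = "real CARD('d) / 2"
  let ?R = "\<lambda>n. lnorm (X n)"
  obtain C1 where C1: "0 < C1" "\<And>t x. 0 < t \<Longrightarrow> heat t (x :: int ^ 'd) \<le> C1 * t powr (- ?d / 2)" using heat_upper by blast
  obtain C2 where C2: "0 < C2" "\<And>t x. 0 < t \<Longrightarrow> x \<noteq> 0 \<Longrightarrow> heat t (x :: int ^ 'd) \<le> C2 / lnorm x powr ?d" using heat_off_diagonal by blast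
  obtain E where E: "(E \<longlongrightarrow> 0) at_top" and
    Eb: "\<And>t x. 0 < t \<Longrightarrow> \<bar>t powr ?D * heat t (x :: int ^ 'd) - exp (- ((lnorm x)^2) / (4 * t)) / (4 * pi) powr ?D\<bar> \<le> E t"
    using heat_local_clt by blast
  define F where "F n \<tau> = ?R n powr ?d * heat ((?R n)^2 * \<tau>) (X n) * \<tau> powr (a - 1)" for n \<tau>
  \<comment> \<open>The majorant uses the off-diagonal bound for short scaled times and the uniform
    bound for long ones.\<close>
  define W where "W \<tau> = (if \<tau> \<le> 1 then C2 * \<tau> powr (a - 1) else C1 * \<tau> powr (- (?D - a) - 1))" for \<tau> :: real
  have pos: "\<forall>\<^sub>F n in sequentially. 0 < ?R n" using X by (auto simp: filterlim_at_top_dense)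
  have [measurable]: "W \<in> borel_measurable borel" unfolding W_def[abs_def] by measurable
  have W_int: "set_integrable lborel {0<..} W"
  proof -
    have "set_integrable lborel {0<..1} W"
      by (rule set_integrable_comparison[where g = "\<lambda>\<tau>. C2 * \<tau> powr (a - 1)"])
         (use a C2 set_integral_powr_from_0(1)[of a 1] in \<open>auto simp: W_def intro!: set_integrable_mult_right\<close>)
    moreover have "set_integrable lborel {1<..} W"
      by (rule set_integrable_comparison[where g = "\<lambda>\<tau>. C1 * \<tau> powr (- (?D - a) - 1)"])
         (use a C1 set_integral_powr_to_inf(1)[of "?D - a" 1] in \<open>auto simp: W_def intro!: set_integrable_mult_right\<close>)
    ultimately have "set_integrable lborel ({0<..1} \<union> {1<..}) W" by (rule set_integrable_Un) auto
    moreover have "{0<..1} \<union> {1<..} = {0::real<..}" by auto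
    ultimately show ?thesis by simp
  qed
  have F_bound: "\<bar>F n \<tau>\<bar> \<le> W \<tau>" if R: "0 < ?R n" and \<tau>: "0 < \<tau>" for n \<tau>
  proof -
    have t: "0 < (?R n)^2 * \<tau>" using R \<tau> by simp
    have x: "X n \<noteq> 0" using R by (auto simp: lnorm_def)
    have F0: "0 \<le> F n \<tau>" unfolding F_def using heat_nonneg[of "(?R n)^2 * \<tau>" "X n"] t by simp
    have "F n \<tau> \<le> W \<tau>"
    proof (cases "\<tau> \<le> 1")
      case True
      have "?R n powr ?d * heat ((?R n)^2 * \<tau>) (X n) \<le> ?R n powr ?d * (C2 / ?R n powr ?d)"
        using C2(2)[OF t x] by (intro mult_left_mono) auto
      also have "\<dots> = C2" using R by simp
      finally show ?thesis using True unfolding F_def W_def by (simp add: mult_right_mono)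
    next
      case False
      have "?R n powr ?d * heat ((?R n)^2 * \<tau>) (X n) \<le> ?R n powr ?d * (C1 * ((?R n)^2 * \<tau>) powr (- ?d / 2))"
        using C1(2)[OF t] by (intro mult_left_mono) auto
      also have "((?R n)^2 * \<tau>) powr (- ?d / 2) = ?R n powr (- ?d) * \<tau> powr (- ?d / 2)"
        using R \<tau> by (simp add: powr_mult square_powr)
      also have "?R n powr ?d * (C1 * (?R n powr (- ?d) * \<tau> powr (- ?d / 2))) = C1 * \<tau> powr (- ?d / 2)"
        using R by (simp add: powr_minus field_simps)
      finally have "F n \<tau> \<le> C1 * \<tau> powr (- ?d / 2) * \<tau> powr (a - 1)"
        unfolding F_def by (intro mult_right_mono) auto
      also have "\<dots> = C1 * \<tau> powr (- (?D - a) - 1)"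
        by (simp add: mult.assoc powr_add[symmetric] algebra_simps)
      finally show ?thesis using False by (simp add: W_def)
    qed
    then show ?thesis using F0 by simp
  qed
  define L where "L \<tau> = \<tau> powr (- (?D - a) - 1) * exp (- (1 / (4 * \<tau>))) / (4 * pi) powr ?D" for \<tau>
  have F_lim: "(\<lambda>n. F n \<tau>) \<longlonglongrightarrow> L \<tau>" if \<tau>: "0 < \<tau>" for \<tau>
  proof -
    let ?t = "\<lambda>n. (?R n)^2 * \<tau>"
    have t_lim: "filterlim ?t at_top sequentially"
      unfolding power2_eq_square
      by (intro filterlim_at_top_mult_tendsto_pos[OF tendsto_const \<tau>] filterlim_at_top_mult_at_top X)
    have diff: "(\<lambda>n. ?t n powr ?D * heat (?t n) (X n) - exp (- (1 / (4 * \<tau>))) / (4 * pi) powr ?D) \<longlonglongrightarrow> 0"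
    proof (rule Lim_null_comparison)
      show "(\<lambda>n. E (?t n)) \<longlonglongrightarrow> 0" by (rule filterlim_compose[OF E t_lim])
      show "\<forall>\<^sub>F n in sequentially. norm (?t n powr ?D * heat (?t n) (X n) - exp (- (1 / (4 * \<tau>))) / (4 * pi) powr ?D) \<le> E (?t n)"
        using pos
      proof eventually_elim
        case (elim n)
        have "- ((?R n)^2) / (4 * ?t n) = - (1 / (4 * \<tau>))" using elim \<tau> by simp
        then show ?case using Eb[of "?t n" "X n"] elim \<tau> by simp
      qed
    qed
    have "(\<lambda>n. (?t n powr ?D * heat (?t n) (X n)) * \<tau> powr (- (?D - a) - 1)) \<longlonglongrightarrow> (exp (- (1 / (4 * \<tau>))) / (4 * pi) powr ?D) * \<tau> powr (- (?D - a) - 1)"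
      using Lim_transform[OF tendsto_const diff] by (intro tendsto_mult tendsto_const)
    moreover have "\<forall>\<^sub>F n in sequentially. (?t n powr ?D * heat (?t n) (X n)) * \<tau> powr (- (?D - a) - 1) = F n \<tau>"
      using pos
    proof eventually_elim
      case (elim n)
      have "?t n powr ?D = ?R n powr ?d * \<tau> powr ?D"
        using elim \<tau> by (simp add: powr_mult square_powr)
      moreover have "\<tau> powr ?D * \<tau> powr (- (?D - a) - 1) = \<tau> powr (a - 1)" by (simp only: powr_add[symmetric]) simp
      moreover have "((p * q) * h) * r = p * h * (q * r)" for p q h r :: real by (simp only: mult_ac)
      ultimately show ?case unfolding F_def by (simp only:)
    qed
    ultimately have "(\<lambda>n. F n \<tau>) \<longlonglongrightarrow> (exp (- (1 / (4 * \<tau>))) / (4 * pi) powr ?D) * \<tau> powr (- (?D - a) - 1)"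
      by (rule Lim_transform_eventually)
    then show ?thesis by (simp add: L_def mult.commute)
  qed
  \<comment> \<open>Dominated convergence wants the bound for every n, and \<open>F_bound\<close>
    fails to apply while X n is the origin, which happens finitely often.\<close>
  define F' where "F' n \<tau> = (if 0 < ?R n then F n \<tau> else 0)" for n \<tau>
  have "(\<lambda>n. \<integral>\<tau>. indicator {0<..} \<tau> * F' n \<tau> \<partial>lborel) \<longlonglongrightarrow> (\<integral>\<tau>. indicator {0<..} \<tau> * L \<tau> \<partial>lborel)"
  proof (rule integral_dominated_convergence[where w = "\<lambda>\<tau>. indicator {0<..} \<tau> * W \<tau>"])
    show "(\<lambda>\<tau>. indicator {0<..} \<tau> * L \<tau>) \<in> borel_measurable lborel" unfolding L_def by measurable
    show "(\<lambda>\<tau>. indicator {0<..} \<tau> * F' n \<tau>) \<in> borel_measurable lborel" for n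
      unfolding F'_def F_def by (cases "0 < ?R n") auto
    show "integrable lborel (\<lambda>\<tau>. indicator {0<..} \<tau> * W \<tau>)" using W_int by (simp add: set_integrable_def)
    show "AE \<tau> in lborel. (\<lambda>n. indicator {0<..} \<tau> * F' n \<tau>) \<longlonglongrightarrow> indicator {0<..} \<tau> * L \<tau>"
    proof (intro AE_I2)
      fix \<tau> :: real
      show "(\<lambda>n. indicator {0<..} \<tau> * F' n \<tau>) \<longlonglongrightarrow> indicator {0<..} \<tau> * L \<tau>"
      proof (cases "0 < \<tau>")
        case True
        have "\<forall>\<^sub>F n in sequentially. F n \<tau> = F' n \<tau>" using pos by eventually_elim (simp add: F'_def)
        then have "(\<lambda>n. F' n \<tau>) \<longlonglongrightarrow> L \<tau>" by (rule Lim_transform_eventually[OF F_lim[OF True]])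
        then show ?thesis using True by simp
      qed simp
    qed
    show "AE \<tau> in lborel. norm (indicator {0<..} \<tau> * F' n \<tau>) \<le> indicator {0<..} \<tau> * W \<tau>" for n
    proof (intro AE_I2)
      fix \<tau> :: real
      have "0 \<le> W \<tau>" using C1(1) C2(1) by (simp add: W_def)
      then show "norm (indicator {0<..} \<tau> * F' n \<tau>) \<le> indicator {0<..} \<tau> * W \<tau>"
        using F_bound[of n \<tau>] by (auto simp: indicator_def F'_def)
    qed
  qed
  then have "(\<lambda>n. (\<integral>\<tau>. indicator {0<..} \<tau> * F' n \<tau> \<partial>lborel) / Gamma a) \<longlonglongrightarrow> (\<integral>\<tau>. indicator {0<..} \<tau> * L \<tau> \<partial>lborel) / Gamma a"
    using Gamma_real_pos[OF a(1)] by (intro tendsto_divide tendsto_const) auto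
  moreover have "\<forall>\<^sub>F n in sequentially. (\<integral>\<tau>. indicator {0<..} \<tau> * F' n \<tau> \<partial>lborel) / Gamma a = ?R n powr (?d - 2 * a) * pot {0<..} a (X n)"
    using pos
  proof eventually_elim
    case (elim n)
    then show ?case using pot_scaled[of "?R n" a "X n"] by (simp add: F'_def F_def[symmetric] set_lebesgue_integral_def)
  qed
  moreover have "(\<integral>\<tau>. indicator {0<..} \<tau> * L \<tau> \<partial>lborel) / Gamma a = riesz_const ?D a"
  proof -
    have "(\<integral>\<tau>. indicator {0<..} \<tau> * L \<tau> \<partial>lborel) = (LINT \<tau>:{0<..}|lborel. \<tau> powr (- (?D - a) - 1) * exp (- (1 / (4 * \<tau>)))) / (4 * pi) powr ?D"
      unfolding L_def set_lebesgue_integral_def by simp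
    also have "\<dots> = 4 powr (?D - a) * Gamma (?D - a) / (4 * pi) powr ?D"
      by (subst inverse_Gamma_integral(2)) (use a in auto)
    finally show ?thesis by (simp add: riesz_const_def)
  qed
  ultimately show ?thesis by (auto dest: Lim_transform_eventually)
qed

section \<open>Comparison of the constants at infinity\<close>

lemma Gamma_spread_ratio:
  assumes "0 < \<delta>" "\<delta> < a" "a < (b :: real)"
  shows "Gamma (b + \<delta>) * Gamma (b - \<delta>) * Gamma a ^ 2 < Gamma b ^ 2 * (Gamma (a + \<delta>) * Gamma (a - \<delta>))"
proof -
  \<comment> \<open>The claim is F b < F a. The derivative of F is a second difference of
    \<open>Digamma\<close>, negative because the trigamma function \<open>Polygamma 1\<close>
    strictly decreases.\<close>
  define F where "F x = ln_Gamma (x + \<delta>) + ln_Gamma (x - \<delta>) - 2 * ln_Gamma x" for x :: real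
  have "\<exists>z>a. z < b \<and> F b - F a = (b - a) * (Digamma (z + \<delta>) + Digamma (z - \<delta>) - 2 * Digamma z)"
    using assms unfolding F_def
    by (intro MVT2) (auto intro!: derivative_eq_intros)
  then obtain z where z: "a < z" "z < b" "F b - F a = (b - a) * (Digamma (z + \<delta>) + Digamma (z - \<delta>) - 2 * Digamma z)" by blast
  have nn: "x \<notin> \<int>\<^sub>\<le>\<^sub>0" if "0 < x" for x :: real using that by (auto elim!: nonpos_Ints_cases)
  have "\<exists>y>z. y < z + \<delta> \<and> Digamma (z + \<delta>) - Digamma z = (z + \<delta> - z) * Polygamma 1 y"
    using assms z by (intro MVT2) (auto intro!: derivative_eq_intros nn)
  then obtain y1 where y1: "z < y1" "y1 < z + \<delta>" "Digamma (z + \<delta>) - Digamma z = \<delta> * Polygamma 1 y1" by auto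
  have "\<exists>y>z-\<delta>. y < z \<and> Digamma z - Digamma (z - \<delta>) = (z - (z - \<delta>)) * Polygamma 1 y"
    using assms z by (intro MVT2) (auto intro!: derivative_eq_intros nn)
  then obtain y2 where y2: "z - \<delta> < y2" "y2 < z" "Digamma z - Digamma (z - \<delta>) = \<delta> * Polygamma 1 y2" by auto
  have "Polygamma 1 y1 < Polygamma 1 y2"
    by (rule Polygamma_real_strict_antimono) (use assms z y1 y2 in auto)
  then have "\<delta> * Polygamma 1 y1 < \<delta> * Polygamma 1 y2" using assms by simp
  then have "Digamma (z + \<delta>) + Digamma (z - \<delta>) - 2 * Digamma z < 0" using y1(3) y2(3) by linarith
  then have "F b < F a" using z(3) assms by (smt (verit) mult_pos_neg)
  then have "exp (F b + 2 * ln_Gamma a + 2 * ln_Gamma b) < exp (F a + 2 * ln_Gamma a + 2 * ln_Gamma b)" by simp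
  moreover have "exp (F b + 2 * ln_Gamma a + 2 * ln_Gamma b) = exp (ln_Gamma (b + \<delta>)) * exp (ln_Gamma (b - \<delta>)) * exp (ln_Gamma a)^2"
    unfolding F_def by (simp add: exp_add[symmetric] power2_eq_square)
  moreover have "exp (F a + 2 * ln_Gamma a + 2 * ln_Gamma b) = exp (ln_Gamma b)^2 * (exp (ln_Gamma (a + \<delta>)) * exp (ln_Gamma (a - \<delta>)))"
    unfolding F_def by (simp add: exp_add[symmetric] power2_eq_square)
  ultimately show ?thesis
    using assms by (simp add: Gamma_real_pos_exp)
qed

lemma finite_lnorm_ball: "finite {x :: int ^ 'd::finite. lnorm x \<le> r}"
proof -
  let ?m = "\<lceil>r\<rceil>"
  have sub: "vec_nth ` {x :: int ^ 'd. lnorm x \<le> r} \<subseteq> Pi\<^sub>E UNIV (\<lambda>_. {- ?m..?m})"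
  proof
    fix f assume "f \<in> vec_nth ` {x :: int ^ 'd. lnorm x \<le> r}"
    then obtain x :: "int ^ 'd" where x: "f = vec_nth x" "lnorm x \<le> r" by auto
    have "x $ i \<in> {- ?m..?m}" for i
    proof -
      have "(real_of_int (x $ i))^2 \<le> (\<Sum>i\<in>UNIV. (real_of_int (x $ i))^2)"
        by (rule member_le_sum) auto
      then have "sqrt ((real_of_int (x $ i))^2) \<le> lnorm x" unfolding lnorm_def by (rule real_sqrt_le_mono)
      then have "\<bar>real_of_int (x $ i)\<bar> \<le> r" using x(2) by simp
      then have "x $ i \<le> ?m" "- (x $ i) \<le> ?m" by linarith+
      then show ?thesis by auto
    qed
    then show "f \<in> Pi\<^sub>E UNIV (\<lambda>_. {- ?m..?m})" using x(1) by auto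
  qed
  have "finite (Pi\<^sub>E (UNIV :: 'd set) (\<lambda>_. {- ?m..?m}))" by (intro finite_PiE) auto
  then have "finite (vec_nth ` {x :: int ^ 'd. lnorm x \<le> r})" using sub by (rule finite_subset[rotated])
  then show ?thesis by (rule finite_imageD) (auto simp: inj_on_def vec_nth_inject)
qed

text \<open>Turns statements about all but finitely many points into limits along sequences, the
  form in which the asymptotics are available.\<close>

lemma infinite_imp_lnorm_sequence:
  assumes "infinite (A :: (int ^ 'd::finite) set)"
  obtains X where "\<And>n. X n \<in> A" "filterlim (\<lambda>n. lnorm (X n)) at_top sequentially"
proof -
  have "\<exists>x\<in>A. real n < lnorm x" for n :: nat
  proof (rule ccontr)
    assume "\<not> (\<exists>x\<in>A. real n < lnorm x)"
    then have "A \<subseteq> {x. lnorm x \<le> real n}" by force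
    then show False using assms finite_lnorm_ball finite_subset by blast
  qed
  then obtain X where X: "\<And>n :: nat. X n \<in> A" "\<And>n. real n < lnorm (X n)" by metis
  have "filterlim (\<lambda>n. lnorm (X n)) at_top sequentially"
    by (rule filterlim_at_top_mono[OF filterlim_real_sequentially]) (intro always_eventually allI less_imp_le X(2))
  then show ?thesis by (rule that[OF X(1)])
qed

lemma riesz_const_pos: "0 < a \<Longrightarrow> a < D \<Longrightarrow> 0 < riesz_const D a"
  unfolding riesz_const_def by (intro divide_pos_pos mult_pos_pos Gamma_real_pos) auto

text \<open>With \<delta> = \<alpha> - \<open>\<alpha>\<^sub>0\<close> and b =
  \<open>\<alpha>\<^sub>0\<close> - \<sigma>, the ratio of the constants at \<alpha> - \<sigma> and
  \<alpha> is 4^\<sigma> times \<Gamma>(\<open>\<alpha>\<^sub>0\<close> + \<delta>)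
  \<Gamma>(\<open>\<alpha>\<^sub>0\<close> - \<delta>) over \<Gamma>(b + \<delta>) \<Gamma>(b -
  \<delta>); \<open>Gamma_spread_ratio\<close> compares it with its value at \<delta> = 0. The claim
  is cross-multiplied.\<close>

lemma riesz_const_ratio_less:
  assumes "0 < \<sigma>" "\<sigma> < D" "\<alpha>\<^sub>0 = (D + \<sigma>) / 2" "\<alpha>\<^sub>0 < \<alpha>" "\<alpha> < D"
  shows "riesz_const D (\<alpha> - \<sigma>) * riesz_const D \<alpha>\<^sub>0 < riesz_const D (\<alpha>\<^sub>0 - \<sigma>) * riesz_const D \<alpha>"
proof -
  define \<delta> where "\<delta> = \<alpha> - \<alpha>\<^sub>0"
  define b where "b = \<alpha>\<^sub>0 - \<sigma>"
  have r: "D - (\<alpha> - \<sigma>) = \<alpha>\<^sub>0 - \<delta>" "D - \<alpha>\<^sub>0 = b" "D - (\<alpha>\<^sub>0 - \<sigma>) = \<alpha>\<^sub>0" "D - \<alpha> = b - \<delta>" "\<alpha> = \<alpha>\<^sub>0 + \<delta>" "\<alpha> - \<sigma> = b + \<delta>" "\<alpha>\<^sub>0 - \<sigma> = b"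
    using assms by (simp_all add: \<delta>_def b_def field_simps)
  have \<delta>: "0 < \<delta>" "\<delta> < b" "b < \<alpha>\<^sub>0"
    using assms(1,4,5) r(4,5,7) by linarith+
  let ?g = "Gamma :: real \<Rightarrow> real"
  have g: "0 < ?g (b + \<delta>)" "0 < ?g (b - \<delta>)" "0 < ?g b" "0 < ?g (\<alpha>\<^sub>0 + \<delta>)" "0 < ?g (\<alpha>\<^sub>0 - \<delta>)" "0 < ?g \<alpha>\<^sub>0"
    using \<delta> by (auto intro!: Gamma_real_pos)
  define q where "q = (4 * pi) powr D"
  have q: "0 < q" by (simp add: q_def)
  have p: "4 powr (\<alpha>\<^sub>0 - \<delta>) * 4 powr b = (4 :: real) powr \<alpha>\<^sub>0 * 4 powr (b - \<delta>)"
    by (simp only: powr_add[symmetric]) (simp add: algebra_simps)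
  have c: "riesz_const D (\<alpha> - \<sigma>) = 4 powr (\<alpha>\<^sub>0 - \<delta>) * ?g (\<alpha>\<^sub>0 - \<delta>) / (q * ?g (b + \<delta>))"
    "riesz_const D \<alpha>\<^sub>0 = 4 powr b * ?g b / (q * ?g \<alpha>\<^sub>0)"
    "riesz_const D (\<alpha>\<^sub>0 - \<sigma>) = 4 powr \<alpha>\<^sub>0 * ?g \<alpha>\<^sub>0 / (q * ?g b)"
    "riesz_const D \<alpha> = 4 powr (b - \<delta>) * ?g (b - \<delta>) / (q * ?g (\<alpha>\<^sub>0 + \<delta>))"
  proof -
    show "riesz_const D (\<alpha> - \<sigma>) = 4 powr (\<alpha>\<^sub>0 - \<delta>) * ?g (\<alpha>\<^sub>0 - \<delta>) / (q * ?g (b + \<delta>))"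
      unfolding riesz_const_def q_def[symmetric] r(1) unfolding r(6) ..
    show "riesz_const D \<alpha>\<^sub>0 = 4 powr b * ?g b / (q * ?g \<alpha>\<^sub>0)"
      unfolding riesz_const_def q_def[symmetric] r(2) ..
    show "riesz_const D (\<alpha>\<^sub>0 - \<sigma>) = 4 powr \<alpha>\<^sub>0 * ?g \<alpha>\<^sub>0 / (q * ?g b)"
      unfolding riesz_const_def q_def[symmetric] r(3) unfolding r(7) ..
    show "riesz_const D \<alpha> = 4 powr (b - \<delta>) * ?g (b - \<delta>) / (q * ?g (\<alpha>\<^sub>0 + \<delta>))"
      unfolding riesz_const_def q_def[symmetric] r(4) unfolding r(5)[symmetric] ..
  qed
  have L: "riesz_const D (\<alpha> - \<sigma>) * riesz_const D \<alpha>\<^sub>0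
      = (4 powr (\<alpha>\<^sub>0 - \<delta>) * 4 powr b) / q^2 * (?g (\<alpha>\<^sub>0 - \<delta>) * ?g b / (?g (b + \<delta>) * ?g \<alpha>\<^sub>0))"
    unfolding c by (simp add: power2_eq_square mult_ac)
  have R: "riesz_const D (\<alpha>\<^sub>0 - \<sigma>) * riesz_const D \<alpha>
      = (4 powr \<alpha>\<^sub>0 * 4 powr (b - \<delta>)) / q^2 * (?g \<alpha>\<^sub>0 * ?g (b - \<delta>) / (?g b * ?g (\<alpha>\<^sub>0 + \<delta>)))"
    unfolding c by (simp add: power2_eq_square mult_ac)
  have "?g (\<alpha>\<^sub>0 - \<delta>) * ?g b / (?g (b + \<delta>) * ?g \<alpha>\<^sub>0) < ?g \<alpha>\<^sub>0 * ?g (b - \<delta>) / (?g b * ?g (\<alpha>\<^sub>0 + \<delta>))"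
    using Gamma_spread_ratio[OF \<delta>] g by (simp add: field_simps power2_eq_square)
  then show ?thesis unfolding L R p using q by (intro mult_strict_left_mono) auto
qed

text \<open>Both weights decay like |x|^{-2\<sigma>}: after cross-multiplication the powers of |x|
  coincide, and the constants decide.\<close>

lemma hardy_w_less_eventually:
  fixes X :: "nat \<Rightarrow> int ^ 'd::finite"
  assumes \<sigma>: "0 < \<sigma>" "\<sigma> < real CARD('d) / 2" and \<alpha>0: "\<alpha>\<^sub>0 = (real CARD('d) / 2 + \<sigma>) / 2"
    and \<alpha>: "\<alpha>\<^sub>0 < \<alpha>" "\<alpha> < real CARD('d) / 2"
    and X: "filterlim (\<lambda>n. lnorm (X n)) at_top sequentially"
  shows "\<forall>\<^sub>F n in sequentially. hardy_w \<sigma> \<alpha> (X n) < hardy_w \<sigma> \<alpha>\<^sub>0 (X n)"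
proof -
  let ?D = "real CARD('d) / 2" and ?d = "real CARD('d)"
  define L where "L a n = lnorm (X n) powr (?d - 2 * a) * pot {0<..} a (X n)" for a n
  have lim: "L a \<longlonglongrightarrow> riesz_const ?D a" if "0 < a" "a < ?D" for a
    unfolding L_def using pot_asymptotics[OF that X] .
  have rg: "0 < \<alpha>\<^sub>0 - \<sigma>" "\<alpha>\<^sub>0 < ?D" "0 < \<alpha>\<^sub>0" "0 < \<alpha> - \<sigma>" "0 < \<alpha>" "\<alpha>\<^sub>0 - \<sigma> < ?D" "\<alpha> - \<sigma> < ?D"
    using \<sigma> \<alpha> unfolding \<alpha>0 by auto
  have "(\<lambda>n. L (\<alpha>\<^sub>0 - \<sigma>) n * L \<alpha> n - L (\<alpha> - \<sigma>) n * L \<alpha>\<^sub>0 n) \<longlonglongrightarrow>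
    riesz_const ?D (\<alpha>\<^sub>0 - \<sigma>) * riesz_const ?D \<alpha> - riesz_const ?D (\<alpha> - \<sigma>) * riesz_const ?D \<alpha>\<^sub>0"
    by (intro tendsto_intros lim rg \<alpha>)
  moreover have "0 < riesz_const ?D (\<alpha>\<^sub>0 - \<sigma>) * riesz_const ?D \<alpha> - riesz_const ?D (\<alpha> - \<sigma>) * riesz_const ?D \<alpha>\<^sub>0"
    using riesz_const_ratio_less[OF \<sigma> \<alpha>0 \<alpha>] by simp
  ultimately have "\<forall>\<^sub>F n in sequentially. 0 < L (\<alpha>\<^sub>0 - \<sigma>) n * L \<alpha> n - L (\<alpha> - \<sigma>) n * L \<alpha>\<^sub>0 n"
    by (rule order_tendstoD)
  moreover have "\<forall>\<^sub>F n in sequentially. 0 < lnorm (X n)" using X by (auto simp: filterlim_at_top_dense)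
  ultimately show ?thesis
  proof eventually_elim
    case (elim n)
    define R where "R = lnorm (X n)"
    have e: "(?d - 2 * (\<alpha>\<^sub>0 - \<sigma>)) + (?d - 2 * \<alpha>) = (?d - 2 * (\<alpha> - \<sigma>)) + (?d - 2 * \<alpha>\<^sub>0)" by simp
    have pw: "R powr (?d - 2 * (\<alpha>\<^sub>0 - \<sigma>)) * R powr (?d - 2 * \<alpha>) = R powr (?d - 2 * (\<alpha> - \<sigma>)) * R powr (?d - 2 * \<alpha>\<^sub>0)"
      by (simp only: powr_add[symmetric] e)
    have pp: "0 < pot {0<..} \<alpha> (X n)" "0 < pot {0<..} \<alpha>\<^sub>0 (X n)"
      by (rule pot_pos[where b = 1], use rg \<alpha> in auto)+
    have "L (\<alpha>\<^sub>0 - \<sigma>) n * L \<alpha> n - L (\<alpha> - \<sigma>) n * L \<alpha>\<^sub>0 n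
      = (R powr (?d - 2 * (\<alpha>\<^sub>0 - \<sigma>)) * R powr (?d - 2 * \<alpha>)) * (pot {0<..} (\<alpha>\<^sub>0 - \<sigma>) (X n) * pot {0<..} \<alpha> (X n))
      - (R powr (?d - 2 * (\<alpha> - \<sigma>)) * R powr (?d - 2 * \<alpha>\<^sub>0)) * (pot {0<..} (\<alpha> - \<sigma>) (X n) * pot {0<..} \<alpha>\<^sub>0 (X n))"
      unfolding L_def R_def by (simp only: mult_ac)
    then have "0 < (R powr (?d - 2 * (\<alpha> - \<sigma>)) * R powr (?d - 2 * \<alpha>\<^sub>0)) *
      (pot {0<..} (\<alpha>\<^sub>0 - \<sigma>) (X n) * pot {0<..} \<alpha> (X n) - pot {0<..} (\<alpha> - \<sigma>) (X n) * pot {0<..} \<alpha>\<^sub>0 (X n))"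
      using elim(1) unfolding pw by (simp only: right_diff_distrib)
    then have "pot {0<..} (\<alpha> - \<sigma>) (X n) * pot {0<..} \<alpha>\<^sub>0 (X n) < pot {0<..} (\<alpha>\<^sub>0 - \<sigma>) (X n) * pot {0<..} \<alpha> (X n)"
      by (rule zero_less_mult_pos[THEN iffD1[OF diff_gt_0_iff_gt]]) (use elim(2) in \<open>simp add: R_def\<close>)
    moreover have "hardy_w \<sigma> a (X n) = pot {0<..} (a - \<sigma>) (X n) / pot {0<..} a (X n)" if "0 < a - \<sigma>" "0 < a" for a
      using kappa_neg_eq_pot[OF that(1), of "X n"] kappa_neg_eq_pot[OF that(2), of "X n"] by (simp add: hardy_w_def)
    ultimately show ?case using pp rg by (simp add: field_simps)
  qed
qed

lemma pot_ratio_tendsto_0: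
  fixes X :: "nat \<Rightarrow> int ^ 'd::finite"
  assumes "0 < a" "a < b" "b < real CARD('d) / 2" and X: "filterlim (\<lambda>n. lnorm (X n)) at_top sequentially"
  shows "(\<lambda>n. pot {0<..} a (X n) / pot {0<..} b (X n)) \<longlonglongrightarrow> 0"
proof -
  let ?d = "real CARD('d)"
  define L where "L a n = lnorm (X n) powr (?d - 2 * a) * pot {0<..} a (X n)" for a n
  have lim: "L a \<longlonglongrightarrow> riesz_const (?d / 2) a" "L b \<longlonglongrightarrow> riesz_const (?d / 2) b"
    unfolding L_def using assms by (auto intro!: pot_asymptotics)
  have "(\<lambda>n. lnorm (X n) powr (2 * a - 2 * b)) \<longlonglongrightarrow> 0"
    by (rule tendsto_neg_powr[OF _ X]) (use assms in simp)
  then have "(\<lambda>n. L a n / L b n * lnorm (X n) powr (2 * a - 2 * b)) \<longlonglongrightarrow> riesz_const (?d / 2) a / riesz_const (?d / 2) b * 0"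
    using riesz_const_pos[of b "?d / 2"] assms by (intro tendsto_intros lim) auto
  moreover have "\<forall>\<^sub>F n in sequentially. 0 < lnorm (X n)" using X by (auto simp: filterlim_at_top_dense)
  then have "\<forall>\<^sub>F n in sequentially. L a n / L b n * lnorm (X n) powr (2 * a - 2 * b) = pot {0<..} a (X n) / pot {0<..} b (X n)"
  proof eventually_elim
    case (elim n)
    have "lnorm (X n) powr (?d - 2 * a) / lnorm (X n) powr (?d - 2 * b) = lnorm (X n) powr ((?d - 2 * a) - (?d - 2 * b))"
      by (rule powr_diff[symmetric])
    moreover have "lnorm (X n) powr ((?d - 2 * a) - (?d - 2 * b)) * lnorm (X n) powr (2 * a - 2 * b) = 1"
      using elim by (simp add: powr_add[symmetric])
    moreover have "L a n / L b n * lnorm (X n) powr (2 * a - 2 * b)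
      = (lnorm (X n) powr (?d - 2 * a) / lnorm (X n) powr (?d - 2 * b)) * lnorm (X n) powr (2 * a - 2 * b) * (pot {0<..} a (X n) / pot {0<..} b (X n))"
      unfolding L_def by simp
    ultimately show ?case by simp
  qed
  ultimately show ?thesis by (auto dest: Lim_transform_eventually)
qed

section \<open>The four claims\<close>

lemma infinite_int_vec: "infinite (UNIV :: (int ^ 'd::finite) set)"
proof
  assume "finite (UNIV :: (int ^ 'd) set)"
  moreover have "inj (\<lambda>n. axis undefined n :: int ^ 'd)" by (auto simp: inj_on_def axis_eq_axis)
  ultimately have "finite (UNIV :: int set)" by (rule finite_imageD[OF finite_subset[OF subset_UNIV]])
  then show False by simp
qed

theorem theorem3p5:
  fixes \<sigma> :: real
  assumes "0 < \<sigma>" and "\<sigma> \<le> 1"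
    and "CARD('d::finite) \<in> {1, 2} \<longrightarrow> \<sigma> < real CARD('d) / 2"
  defines "\<alpha>\<^sub>0 \<equiv> (real CARD('d) / 2 + \<sigma>) / 2"
  shows "(\<forall>\<alpha>. \<sigma> < \<alpha> \<and> \<alpha> < real CARD('d) / 2 \<longrightarrow>
            hardy_weight \<sigma> (hardy_w \<sigma> \<alpha> :: int ^ 'd \<Rightarrow> real))
       \<and> (\<forall>\<alpha>. \<sigma> < \<alpha> \<and> \<alpha> < \<alpha>\<^sub>0 \<longrightarrow>
            positive_critical \<sigma> (hardy_w \<sigma> \<alpha> :: int ^ 'd \<Rightarrow> real))
       \<and> null_critical \<sigma> (hardy_w \<sigma> \<alpha>\<^sub>0 :: int ^ 'd \<Rightarrow> real)
       \<and> (\<forall>\<alpha>. \<alpha>\<^sub>0 < \<alpha> \<and> \<alpha> < real CARD('d) / 2 \<longrightarrow>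
            subcritical \<sigma> (hardy_w \<sigma> \<alpha> :: int ^ 'd \<Rightarrow> real))"
proof -
  have \<sigma>D: "\<sigma> < real CARD('d) / 2"
  proof (cases "CARD('d) \<in> {1, 2}")
    case False
    have "CARD('d) \<noteq> 0" "CARD('d) \<noteq> 1" "CARD('d) \<noteq> 2" using False by auto
    then have "3 \<le> CARD('d)" by linarith
    then show ?thesis using assms(2) by simp
  qed (use assms(3) in blast)
  have a0: "\<sigma> < \<alpha>\<^sub>0" "\<alpha>\<^sub>0 < real CARD('d) / 2" using \<sigma>D unfolding \<alpha>\<^sub>0_def by auto
  obtain k where k: "((\<lambda>x :: int ^ 'd. kappa \<sigma> x) has_sum k) UNIV"
    using kappa_basic(4)[OF assms(1,2)] by blast
  have R: "riesz TYPE('d) \<sigma> \<alpha> k" if "\<sigma> < \<alpha>" "\<alpha> < real CARD('d) / 2" for \<alpha>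
    by unfold_locales (use assms(1,2) that k in auto)
  show ?thesis
  proof (intro conjI allI impI)
    fix \<alpha> assume "\<sigma> < \<alpha> \<and> \<alpha> < real CARD('d) / 2"
    then interpret riesz \<sigma> \<alpha> k "TYPE('d)" by (intro R) auto
    show "hardy_weight \<sigma> (hardy_w \<sigma> \<alpha> :: int ^ 'd \<Rightarrow> real)" by (rule hp.hardy)
  next
    fix \<alpha> assume less: "\<sigma> < \<alpha> \<and> \<alpha> < \<alpha>\<^sub>0"
    then interpret riesz \<sigma> \<alpha> k "TYPE('d)" using a0 by (intro R) auto
    show "positive_critical \<sigma> (hardy_w \<sigma> \<alpha> :: int ^ 'd \<Rightarrow> real)"
      by (rule positive_critical) (use less in \<open>simp add: \<alpha>\<^sub>0_def field_simps\<close>)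
  next
    interpret riesz \<sigma> \<alpha>\<^sub>0 k "TYPE('d)" by (rule R[OF a0])
    show "null_critical \<sigma> (hardy_w \<sigma> \<alpha>\<^sub>0 :: int ^ 'd \<Rightarrow> real)"
      by (rule null_critical) (simp add: \<alpha>\<^sub>0_def field_simps)
  next
    fix \<alpha> assume \<alpha>: "\<alpha>\<^sub>0 < \<alpha> \<and> \<alpha> < real CARD('d) / 2"
    interpret r: riesz \<sigma> \<alpha> k "TYPE('d)" using a0 \<alpha> by (intro R) auto
    interpret r0: riesz \<sigma> \<alpha>\<^sub>0 k "TYPE('d)" by (rule R[OF a0])
    show "subcritical \<sigma> (hardy_w \<sigma> \<alpha> :: int ^ 'd \<Rightarrow> real)"
    \<comment> \<open>The comparison function is an exact solution for its own weight
      \<open>hardy_w \<sigma> \<alpha>\<^sub>0\<close>; where that weight is at least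
      \<open>hardy_w \<sigma> \<alpha>\<close> it is a supersolution for the latter.\<close>
    proof (rule r.hp.subcritical_if[OF r0.u_pos r0.hp.eqn])
      show "finite {x :: int ^ 'd. hardy_w \<sigma> \<alpha>\<^sub>0 x < hardy_w \<sigma> \<alpha> x}"
      proof (rule ccontr)
        assume "infinite {x :: int ^ 'd. hardy_w \<sigma> \<alpha>\<^sub>0 x < hardy_w \<sigma> \<alpha> x}"
        then obtain X where X: "\<And>n. X n \<in> {x :: int ^ 'd. hardy_w \<sigma> \<alpha>\<^sub>0 x < hardy_w \<sigma> \<alpha> x}"
          and lim: "filterlim (\<lambda>n. lnorm (X n)) at_top sequentially"
          using infinite_imp_lnorm_sequence by blast
        have "\<forall>\<^sub>F n in sequentially. hardy_w \<sigma> \<alpha> (X n) < hardy_w \<sigma> \<alpha>\<^sub>0 (X n)"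
          by (rule hardy_w_less_eventually) (use assms \<sigma>D \<alpha> lim in auto)
        then obtain n where "hardy_w \<sigma> \<alpha> (X n) < hardy_w \<sigma> \<alpha>\<^sub>0 (X n)" by (auto simp: eventually_sequentially)
        with X[of n] show False by simp
      qed
      fix c :: real assume c: "0 < c"
      have "infinite (UNIV :: (int ^ 'd) set)" by (rule infinite_int_vec)
      then obtain X :: "nat \<Rightarrow> int ^ 'd" where lim: "filterlim (\<lambda>n. lnorm (X n)) at_top sequentially"
        using infinite_imp_lnorm_sequence by blast
      have "(\<lambda>n. r0.u (X n) / r.u (X n)) \<longlonglongrightarrow> 0"
        by (rule pot_ratio_tendsto_0) (use lim \<alpha> r0.ranges in auto)
      then have "\<forall>\<^sub>F n in sequentially. r0.u (X n) / r.u (X n) < c" using c by (rule order_tendstoD)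
      then obtain n where "r0.u (X n) / r.u (X n) < c" by (auto simp: eventually_sequentially)
      then show "\<exists>x. r0.u x < c * r.u x" using r.u_pos[of "X n"] by (auto simp: field_simps)
    qed
  qed
qed

end
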